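(* Assume the following. (1) There is a constant $C>0$ such that $|b(x,\theta)-b(y,\theta)|\le C|x-y|$ for all $x,y\in\mathbb{R}^d$, $\theta\in\Theta$. (2) $b\in C^{\infty,0}(\mathbb{R}^d\times\Theta;\mathbb{R}^d)$ and $\|b\|_{C^{\infty,0}(B_M\times\Theta)}<\infty$ for all $M>0$. (3) $b$ is differentiable with respect to $\theta\in\Theta_0$, and for each $j=1,\dots,p$ the family $\{\partial_{\theta_j}b(\cdot,\theta)\}_{\theta\in\Theta_0}$ is equi-Lipschitz continuous on $\mathbb{R}^d$ (a common Lipschitz constant in $x$ for all $\theta\in\Theta_0$). (4) If $\theta\in\Theta$ and $\theta\ne\theta_0$, then $b(x_t,\theta)\neq b(x_t,\theta_0)$ for some $t\in[0,1]$. If $2^{\ell}\varepsilon\to0$ and $\ell 2^{2\ell}/n$ is bounded as $n\to\infty$ and $\varepsilon\to0$, then the least squares estimator $\hat\theta_{n,\varepsilon,\ell}$ is consistent: $$\hat\theta_{n,\varepsilon,\ell}\longrightarrow\theta_0\quad\text{in probability (under } P_{\theta_0})$$ as $n\to\infty$ and $\varepsilon\to0$.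
   Context: Setting. $\Theta_0\subset\mathbb{R}^p$ ($p\in\mathbb{N}$) is a smooth bounded open convex set, $\Theta$ is its closure, and $\theta_0\in\Theta_0$ is the true parameter. $b:\mathbb{R}^d\times\Theta\to\mathbb{R}^d$. $L=(L_t)_{t\ge0}$ is the $d$-dimensional Lévy process $$L_t=at+\sigma B_t+\int_0^t\!\int_{|z|\le1}z\,\tilde N(ds,dz)+\int_0^t\!\int_{|z|>1}z\,N(ds,dz),$$ with $a\in\mathbb{R}^d$, $\sigma$ a real $d\times r$ matrix, $B$ an $r$-dimensional standard Brownian motion, $N$ an independent Poisson random measure with intensity $dt\,\nu(dz)$, $\tilde N(ds,dz)=N(ds,dz)-\nu(dz)ds$, and $\nu$ a Lévy measure on $\mathbb{R}^d\setminus\{0\}$ with $\int_{|z|>0}|z|\,\nu(dz)<\infty$. For $\varepsilon>0$, $X^\varepsilon$ is the solution of $dX^\varepsilon_t=b(X^\varepsilon_t,\theta_0)\,dt+\varepsilon\,dL_t$, $X^\varepsilon_0=x_0\in\mathbb{R}^d$ ($x_0$ fixed), and $x_t$ is the solution of $dx_t/dt=b(x_t,\theta_0)$ with initial value $x_0$. $P_{\theta_0}$ is the underlying probability. Observation times: $t_k=k/n$, $k=0,\dots,n$. Adams–Moulton coefficients: for $\ell\in\mathbb{N}_0=\mathbb{N}\cup\{0\}$ and $\nu=0,\dots,\ell$, $$\beta_{\ell\nu}=\frac{(-1)^\nu}{\nu!(\ell-\nu)!}\int_0^1\prod_{0\le j\le\ell,\,j\ne\nu}(u+j-1)\,du .$$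 For $f:\mathbb{R}^d\times\Theta\to\mathbb{R}^d$, $A_\ell f(\boldsymbol{X}^\varepsilon_{t_k:t_{k-\ell}},\theta)=\sum_{\nu=0}^\ell\beta_{\ell\nu}f(X^\varepsilon_{t_{k-\nu}},\theta)$. Contrast function and estimator: $$\Psi_{n,\varepsilon,\ell}(\theta)=\sum_{k=\max(\ell,1)}^n\frac{\left|X^\varepsilon_{t_k}-X^\varepsilon_{t_{k-1}}-\frac1n A_\ell b(\boldsymbol{X}^\varepsilon_{t_k:t_{k-\ell}},\theta)\right|^2}{\varepsilon^2/n},\qquad \hat\theta_{n,\varepsilon,\ell}\in\operatorname{argmin}_{\theta\in\Theta}\Psi_{n,\varepsilon,\ell}(\theta).$$ Function spaces: $B_M\subset\mathbb{R}^d$ is the closed ball of radius $M$ centred at the origin. $C^{\infty,0}(\mathbb{R}^d\times\Theta;\mathbb{R}^d)$ is the set of $f:\mathbb{R}^d\times\Theta\to\mathbb{R}^d$ that are smooth in $x$ and whose $k$-th derivatives in $x$ are continuous on $\mathbb{R}^d\times\Theta$ for all $k\in\mathbb{N}_0$. $\|f\|_{C^{\infty,0}(B_M\times\Theta)}=\sup_{\alpha\in\mathbb{N}_0^d}\sup_{(x,\theta)\in B_M\times\Theta}|D_x^\alpha f(x,\theta)|$. Limits: $n\to\infty$ and $\varepsilon\to0$ simultaneously; the order $\ell\in\mathbb{N}_0$ ($\ell\le n$) may depend on $n$ and $\varepsilon$. The assertion is meant along any sequence of triples $(n,\varepsilon,\ell)$ with $n\to\infty$, $\varepsilon\to0$ satisfying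 the stated conditions. *)

theory Defs
  imports "HOL-Probability.Probability"
begin

section \<open>Iterated partial derivatives, smooth functions and smooth domains\<close>

definition partial_deriv ::
    "'m::finite \<Rightarrow> (real ^ 'm \<Rightarrow> 'b::real_normed_vector) \<Rightarrow> real ^ 'm \<Rightarrow> 'b" where
  "partial_deriv i f x = vector_derivative (\<lambda>h. f (x + h *\<^sub>R axis i 1)) (at 0)"

text \<open>A multi-index is encoded by a list \<open>js\<close> of coordinate indices, the entry at \<open>i\<close> of the
  multi-index being \<open>count_list js i\<close>. Mixed partial derivatives of smooth functions commute, so
  the order of the list is irrelevant there, and every multi-index is the count of some list.\<close>

primrec iter_partial ::
    "'m::finite list \<Rightarrow> (real ^ 'm \<Rightarrow> 'b::real_normed_vector) \<Rightarrow> real ^ 'm \<Rightarrow> 'b" where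
  "iter_partial [] f = f"
| "iter_partial (j # js) f = partial_deriv j (iter_partial js f)"

definition smooth_on :: "(real ^ 'm::finite) set \<Rightarrow> (real ^ 'm \<Rightarrow> 'b::real_normed_vector) \<Rightarrow> bool" where
  "smooth_on U f \<longleftrightarrow> open U \<and> (\<forall>js. \<forall>x\<in>U. iter_partial js f differentiable (at x))"

text \<open>An open set has smooth boundary if near each boundary point it is the sublevel set of a
  smooth function with nonvanishing gradient.\<close>

definition smooth_domain :: "(real ^ 'm::finite) set \<Rightarrow> bool" where
  "smooth_domain S \<longleftrightarrow> open S \<and>
     (\<forall>x\<in>frontier S. \<exists>U \<rho> :: real ^ 'm \<Rightarrow> real.
        x \<in> U \<and> smooth_on U \<rho> \<and> (\<exists>i. partial_deriv i \<rho> x \<noteq> 0) \<and>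
        S \<inter> U = {y \<in> U. \<rho> y < 0})"

definition C_inf_0 ::
    "'t::topological_space set \<Rightarrow> (real ^ 'd::finite \<Rightarrow> 't \<Rightarrow> 'b::real_normed_vector) \<Rightarrow> bool" where
  "C_inf_0 \<Theta> f \<longleftrightarrow>
     (\<forall>\<theta>\<in>\<Theta>. smooth_on UNIV (\<lambda>x. f x \<theta>)) \<and>
     (\<forall>js. continuous_on (UNIV \<times> \<Theta>) (\<lambda>(x, \<theta>). iter_partial js (\<lambda>y. f y \<theta>) x))"

definition C_inf_0_norm ::
    "(real ^ 'd::finite) set \<Rightarrow> 't set \<Rightarrow> (real ^ 'd \<Rightarrow> 't \<Rightarrow> 'b::real_normed_vector) \<Rightarrow> ennreal" where
  "C_inf_0_norm K \<Theta> f =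
     (SUP js. SUP (x, \<theta>)\<in>K \<times> \<Theta>. ennreal (norm (iter_partial js (\<lambda>y. f y \<theta>) x)))"


section \<open>Brownian motion, Poisson random measures and the driving process\<close>

context prob_space
begin

definition standard_brownian_motion :: "(real \<Rightarrow> 'a \<Rightarrow> real ^ 'r::finite) \<Rightarrow> bool" where
  "standard_brownian_motion B \<longleftrightarrow>
     (\<forall>t\<ge>0. random_variable borel (B t)) \<and>
     (AE \<omega> in M. B 0 \<omega> = 0) \<and>
     (\<forall>\<tau> :: nat \<Rightarrow> real. \<forall>m. 0 \<le> \<tau> 0 \<longrightarrow> mono \<tau> \<longrightarrow>
        indep_vars (\<lambda>_. borel) (\<lambda>k \<omega>. B (\<tau> (Suc k)) \<omega> - B (\<tau> k) \<omega>) {..<m}) \<and>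
     (\<forall>s t. 0 \<le> s \<longrightarrow> s < t \<longrightarrow>
        distributed M lborel (\<lambda>\<omega>. B t \<omega> - B s \<omega>)
          (\<lambda>x. ennreal (\<Prod>i\<in>UNIV. normal_density 0 (sqrt (t - s)) (x $ i)))) \<and>
     (AE \<omega> in M. continuous_on {0..} (\<lambda>t. B t \<omega>))"

definition poisson_random_measure :: "'e measure \<Rightarrow> ('a \<Rightarrow> 'e measure) \<Rightarrow> bool" where
  "poisson_random_measure \<mu> N \<longleftrightarrow>
     (\<forall>\<omega>\<in>space M. sets (N \<omega>) = sets \<mu>) \<and>
     (\<forall>\<omega>\<in>space M. \<forall>A\<in>sets \<mu>. emeasure (N \<omega>) A \<in> insert \<infinity> (range of_nat)) \<and>
     (\<forall>A\<in>sets \<mu>. random_variable borel (\<lambda>\<omega>. emeasure (N \<omega>) A)) \<and>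
     (\<forall>A\<in>sets \<mu>. emeasure \<mu> A < \<infinity> \<longrightarrow>
        (\<forall>k::nat. prob {\<omega> \<in> space M. emeasure (N \<omega>) A = of_nat k}
                  = measure \<mu> A ^ k / fact k * exp (- measure \<mu> A))) \<and>
     (\<forall>A\<in>sets \<mu>. emeasure \<mu> A = \<infinity> \<longrightarrow> (AE \<omega> in M. emeasure (N \<omega>) A = \<infinity>)) \<and>
     (\<forall>(A :: nat \<Rightarrow> 'e set) m. (\<forall>k<m. A k \<in> sets \<mu>) \<longrightarrow> disjoint_family_on A {..<m} \<longrightarrow>
        indep_vars (\<lambda>_. borel) (\<lambda>k \<omega>. emeasure (N \<omega>) (A k)) {..<m})"

definition indep_process_random_measure ::
    "(real \<Rightarrow> 'a \<Rightarrow> 'b::topological_space) \<Rightarrow> 'e measure \<Rightarrow> ('a \<Rightarrow> 'e measure) \<Rightarrow> bool" where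
  "indep_process_random_measure B \<mu> N \<longleftrightarrow>
     indep_set
       (sigma_sets (space M) {B t -` A \<inter> space M | t A. 0 \<le> t \<and> A \<in> sets borel})
       (sigma_sets (space M)
          {(\<lambda>\<omega>. emeasure (N \<omega>) E) -` A \<inter> space M | E A. E \<in> sets \<mu> \<and> A \<in> sets borel})"

text \<open>With additive noise the stochastic differential equation is a pathwise integral equation.\<close>

definition solves_sde ::
    "(real ^ 'd::finite \<Rightarrow> real ^ 'd) \<Rightarrow> real \<Rightarrow> (real \<Rightarrow> 'a \<Rightarrow> real ^ 'd) \<Rightarrow> real ^ 'd
      \<Rightarrow> (real \<Rightarrow> 'a \<Rightarrow> real ^ 'd) \<Rightarrow> bool" where
  "solves_sde drift \<epsilon> L x\<^sub>0 X \<longleftrightarrow>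
     (\<forall>t\<ge>0. random_variable borel (X t)) \<and>
     (AE \<omega> in M. \<forall>t\<ge>0. set_integrable lborel {0..t} (\<lambda>s. drift (X s \<omega>)) \<and>
        X t \<omega> = x\<^sub>0 + (LINT s:{0..t}|lborel. drift (X s \<omega>)) + \<epsilon> *\<^sub>R L t \<omega>)"

definition tendsto_in_probability ::
    "(nat \<Rightarrow> 'a \<Rightarrow> 'b::metric_space) \<Rightarrow> 'b \<Rightarrow> bool" where
  "tendsto_in_probability Y c \<longleftrightarrow>
     (\<forall>\<delta>>0. (\<lambda>i. prob {\<omega> \<in> space M. dist (Y i \<omega>) c > \<delta>}) \<longlonglongrightarrow> 0)"

end

text \<open>A measure on the punctured space is a Borel measure on the whole space without mass at 0.\<close>

definition levy_measure :: "'b::real_normed_vector measure \<Rightarrow> bool" where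
  "levy_measure \<nu> \<longleftrightarrow> sets \<nu> = sets borel \<and> emeasure \<nu> {0} = 0 \<and>
     (\<integral>\<^sup>+z. ennreal (min 1 ((norm z)\<^sup>2)) \<partial>\<nu>) < \<infinity>"

definition jump_intensity :: "'b measure \<Rightarrow> (real \<times> 'b) measure" where
  "jump_intensity \<nu> = restrict_space lborel {0..} \<Otimes>\<^sub>M \<nu>"

text \<open>The difference of the two integrals is the integral against the compensated measure
  whenever the integrand is integrable for the intensity; for the small jumps this is the case
  since the first moment of the jump measure is finite.\<close>

definition compensated_integral ::
    "'e measure \<Rightarrow> 'e measure \<Rightarrow> 'e set \<Rightarrow> ('e \<Rightarrow> 'b::{banach, second_countable_topology}) \<Rightarrow> 'b" where
  "compensated_integral \<mu> N A f = (LINT p:A|N. f p) - (LINT p:A|\<mu>. f p)"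

definition levy_ito ::
    "real ^ 'd::finite \<Rightarrow> real ^ 'r::finite ^ 'd \<Rightarrow> (real ^ 'd) measure
      \<Rightarrow> (real \<Rightarrow> 'w \<Rightarrow> real ^ 'r) \<Rightarrow> ('w \<Rightarrow> (real \<times> (real ^ 'd)) measure)
      \<Rightarrow> real \<Rightarrow> 'w \<Rightarrow> real ^ 'd" where
  "levy_ito a \<sigma> \<nu> B N t \<omega> =
     t *\<^sub>R a + \<sigma> *v B t \<omega>
     + compensated_integral (jump_intensity \<nu>) (N \<omega>) ({0<..t} \<times> {z. norm z \<le> 1}) snd
     + (LINT p:{0<..t} \<times> {z. norm z > 1}|N \<omega>. snd p)"


section \<open>Adams--Moulton contrast function\<close>

definition am_coeff :: "nat \<Rightarrow> nat \<Rightarrow> real" where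
  "am_coeff l v = (-1) ^ v / (fact v * fact (l - v)) *
     integral {0..1} (\<lambda>u::real. \<Prod>j\<in>{0..l} - {v}. u + real j - 1)"

text \<open>\<open>Y k\<close> stands for the observation at time \<open>k / n\<close>. The subtraction \<open>k - v\<close> is only used
  for \<open>v \<le> l \<le> k\<close>.\<close>

definition adams_moulton ::
    "nat \<Rightarrow> ('x \<Rightarrow> 't \<Rightarrow> 'b::real_vector) \<Rightarrow> (nat \<Rightarrow> 'x) \<Rightarrow> nat \<Rightarrow> 't \<Rightarrow> 'b" where
  "adams_moulton l f Y k \<theta> = (\<Sum>v=0..l. am_coeff l v *\<^sub>R f (Y (k - v)) \<theta>)"

definition contrast ::
    "('x::real_normed_vector \<Rightarrow> 't \<Rightarrow> 'x) \<Rightarrow> nat \<Rightarrow> real \<Rightarrow> nat \<Rightarrow> (nat \<Rightarrow> 'x) \<Rightarrow> 't \<Rightarrow> real" where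
  "contrast b n \<epsilon> l Y \<theta> =
     (\<Sum>k = max l 1..n.
        (norm (Y k - Y (k - 1) - (1 / real n) *\<^sub>R adams_moulton l b Y k \<theta>))\<^sup>2 / (\<epsilon>\<^sup>2 / real n))"

end

theory Submission
  imports Defs "HOL-Computational_Algebra.Polynomial"
begin

text \<open>
  The Adams--Moulton coefficients sum to 1 and have total variation at most \<open>2 ^ l\<close>, so by Lipschitz
  continuity the quadrature of
  \<open>b (X t) \<theta>\<close> differs from \<open>b (x t) \<theta>\<close> by at most a constant times \<open>2 ^ l * \<epsilon> + 2 ^ l * l / n\<close>,
  and both summands vanish in the limit. Comparing the contrast at the minimiser with the contrast at
  \<open>\<theta>\<^sub>0\<close> then bounds the mean square of \<open>b (x t) \<theta> - b (x t) \<theta>\<^sub>0\<close> by an inner product of the noise with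
  the difference of the drifts, which has to be small uniformly in the parameter.

  The jumps have finite variation because the jump measure has a first moment, so they are harmless
  pathwise. For the Brownian part write \<open>X = Y + \<epsilon> W\<close> with \<open>Y\<close> of bounded variation and expand
  \<open>b (X t) \<theta>\<close> in its Taylor series at \<open>Y t\<close>, which converges because all derivatives of \<open>b\<close> share one
  bound. The Brownian increments now only meet monomials in \<open>\<epsilon> W\<close>, which do not depend on the
  parameter; summation by parts moves the coefficients, of bounded variation, away from them, and
  the maxima of the remaining martingale transforms are controlled by Doob's inequality.
\<close>

section \<open>Adams--Moulton coefficients\<close>

text \<open>The obstacle is that the minimiser depends on the whole path: evaluated there, the noise
  term is not a martingale transform, and bounds for each fixed parameter do not help. In dimension
  d the expansion leaves d ^ m lists of degree m with weight 1 / fact m, so the expected total is at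
  most exp d times a constant that does not grow with n. The coefficients then cost 2 ^ l and the
  noise carries a factor \<epsilon>; so 2 ^ l * \<epsilon> must vanish here as well as in the
  quadrature error. The scheme is implicit: its lag 0 term evaluates the drift at the right end of
  the very increment it is multiplied with. It is shifted to lag 1, and the price is paid by the
  quadratic variation of \<epsilon> W and by max \<bar>\<epsilon> W\<bar> times the variation of Y.
  The coefficient of lag 0 is at most 1, so no factor 2 ^ l appears there. Only the Taylor noise and
  the quadratic variation are handled in probability. All other errors vanish on almost every path,
  with constants that may depend on the path.\<close>

lemma am_coeff_abs_le:
  assumes "v \<le> l"
  shows "\<bar>am_coeff l v\<bar> \<le> real (l choose v)"
proof -
  let ?P = "\<lambda>u::real. \<Prod>j\<in>{0..l} - {v}. u + real j - 1"
  have cont: "continuous_on {0..1} ?P"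
    by (intro continuous_intros)
  \<comment> \<open>The factors j = 0 and j = 1 are at most 1, and factor j is at most j beyond, so
    the product is at most \<open>fact l\<close>; the prefactor then turns this into a binomial
    coefficient.\<close>
  have factor: "\<bar>u + real j - 1\<bar> \<le> real (max j 1)" if "u \<in> {0..1}" for u :: real and j
    using that by (cases "j = 0") auto
  have "\<bar>?P u\<bar> \<le> fact l" if u: "u \<in> {0..1}" for u
  proof -
    have "\<bar>?P u\<bar> = (\<Prod>j\<in>{0..l} - {v}. \<bar>u + real j - 1\<bar>)"
      by (simp add: abs_prod)
    also have "\<dots> \<le> (\<Prod>j\<in>{0..l} - {v}. real (max j 1))"
      by (intro prod_mono) (use factor[OF u] in auto)
    also have "\<dots> \<le> (\<Prod>j\<in>{0..l}. real (max j 1))"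
      by (intro prod_mono2) auto
    also have "\<dots> = (\<Prod>j\<in>{1..l}. real (max j 1))"
      by (intro prod.mono_neutral_right) (auto simp: not_le)
    also have "\<dots> = fact l"
      by (simp add: fact_prod)
    finally show ?thesis .
  qed
  then have "norm (integral {0..1} ?P) \<le> integral {0..1} (\<lambda>u::real. fact l)"
    by (intro integral_norm_bound_integral integrable_continuous_interval cont) auto
  then have "\<bar>integral {0..1} ?P\<bar> \<le> fact l" by simp
  then show ?thesis
    using assms unfolding am_coeff_def
    by (simp add: abs_mult binomial_fact divide_right_mono field_simps)
qed

lemma sum_abs_am_coeff_le: "(\<Sum>v=0..l. \<bar>am_coeff l v\<bar>) \<le> 2 ^ l"
proof -
  have "(\<Sum>v=0..l. \<bar>am_coeff l v\<bar>) \<le> (\<Sum>v=0..l. real (l choose v))"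
    by (intro sum_mono am_coeff_abs_le) auto
  also have "\<dots> = real (\<Sum>v\<le>l. l choose v)"
    by (simp add: atLeast0AtMost)
  finally show ?thesis by (simp add: choose_row_sum)
qed

text \<open>This is the value of the unnormalised Lagrange basis polynomial at its own node
  \<open>1 - v\<close>; the prefactor in \<open>am_coeff\<close> is its reciprocal.\<close>

lemma prod_diff_nodes:
  assumes "v \<le> l"
  shows "(\<Prod>j\<in>{0..l} - {v}. real j - real v) = (-1) ^ v * (fact v * fact (l - v))"
proof -
  have split: "{0..l} - {v} = {0..<v} \<union> {Suc v..l}"
    using assms by auto
  have "(\<Prod>j\<in>{0..l} - {v}. real j - real v)
      = (\<Prod>j\<in>{0..<v}. real j - real v) * (\<Prod>j\<in>{Suc v..l}. real j - real v)"
    unfolding split by (intro prod.union_disjoint) auto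
  also have "(\<Prod>j\<in>{0..<v}. real j - real v) = (\<Prod>i\<in>{1..v}. - real i)"
    by (rule prod.reindex_bij_witness[of _ "\<lambda>i. v - i" "\<lambda>i. v - i"]) auto
  also have "\<dots> = (-1) ^ v * fact v"
    by (simp add: prod_uminus fact_prod)
  also have "(\<Prod>j\<in>{Suc v..l}. real j - real v) = (\<Prod>i\<in>{1..l - v}. real i)"
    by (rule prod.reindex_bij_witness[of _ "\<lambda>i. i + v" "\<lambda>i. i - v"]) auto
  also have "\<dots> = fact (l - v)"
    by (simp add: fact_prod)
  finally show ?thesis by simp
qed

text \<open>Lagrange interpolation of the constant 1 at the \<open>l + 1\<close> nodes
  \<open>1 - w\<close>: a polynomial of degree at most \<open>l\<close> that takes the value 1 at
  all of them is constant.\<close>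

lemma lagrange_sum_one:
  "(\<Sum>v=0..l. (-1) ^ v / (fact v * fact (l - v)) * (\<Prod>j\<in>{0..l} - {v}. u + real j - 1)) = 1"
proof -
  define c where "c = (\<lambda>v. (-1) ^ v / (fact v * fact (l - v)) :: real)"
  define p where "p = (\<Sum>v=0..l. smult (c v) (\<Prod>j\<in>{0..l} - {v}. [:real j - 1, 1:]))"
  have deg: "degree p \<le> l"
    unfolding p_def
  proof (intro degree_sum_le, goal_cases)
    case (2 v)
    have "degree (\<Prod>j\<in>{0..l} - {v}. [:real j - 1, 1:]) \<le> (\<Sum>j\<in>{0..l} - {v}. degree [:real j - 1, 1:])"
      by (intro degree_prod_sum_le[unfolded o_def]) auto
    also have "\<dots> = l" using 2 by simp
    finally show ?case using degree_smult_le order_trans by blast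
  qed auto
  have val: "poly p u = (\<Sum>v=0..l. c v * (\<Prod>j\<in>{0..l} - {v}. u + real j - 1))" for u
    by (simp add: p_def poly_sum poly_prod algebra_simps)
  have node: "poly p (1 - real w) = 1" if w: "w \<le> l" for w
  proof -
    have "poly p (1 - real w) = (\<Sum>v=0..l. c v * (\<Prod>j\<in>{0..l} - {v}. real j - real w))"
      by (simp add: val)
    also have "\<dots> = (\<Sum>v\<in>{w}. c v * (\<Prod>j\<in>{0..l} - {v}. real j - real w))"
      using w by (intro sum.mono_neutral_right) (auto simp: prod_zero_iff)
    also have "\<dots> = 1"
      using prod_diff_nodes[OF w] by (simp add: c_def field_simps flip: power_mult_distrib)
    finally show ?thesis .
  qed
  have "p = 1"
  proof (rule poly_eqI_degree[where A = "(\<lambda>w. 1 - real w) ` {0..l}"])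
    have "card ((\<lambda>w. 1 - real w) ` {0..l}) = Suc l"
      by (subst card_image) (auto simp: inj_on_def)
    then show "card ((\<lambda>w. 1 - real w) ` {0..l}) > degree p"
      "card ((\<lambda>w. 1 - real w) ` {0..l}) > degree (1 :: real poly)"
      using deg by auto
  qed (auto simp: node)
  then have "poly p u = 1" by simp
  then show ?thesis by (simp add: val c_def)
qed

text \<open>Exactness of the quadrature on constants. It allows a fixed vector to be subtracted
  inside \<open>adams_moulton\<close>.\<close>

lemma sum_am_coeff: "(\<Sum>v=0..l. am_coeff l v) = 1"
proof -
  have "(\<Sum>v=0..l. am_coeff l v) = integral {0..1} (\<lambda>u::real. \<Sum>v=0..l.
      (-1) ^ v / (fact v * fact (l - v)) * (\<Prod>j\<in>{0..l} - {v}. u + real j - 1))"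
    unfolding am_coeff_def
    by (subst integral_sum)
      (auto intro!: integrable_continuous_interval continuous_intros)
  also have "\<dots> = integral {0..1} (\<lambda>u::real. 1)"
    by (simp only: lagrange_sum_one)
  finally show ?thesis by simp
qed

section \<open>Taylor expansion along lists of coordinates, Gronwall\<close>

text \<open>\<open>partial_deriv\<close> is only a choice by \<open>vector_derivative\<close>;
  differentiability identifies it with the derivative applied to a unit vector, and linearity does
  the rest.\<close>

lemma has_derivative_partial_deriv:
  fixes f :: "real ^ 'm::finite \<Rightarrow> 'b::real_normed_vector"
  assumes "f differentiable (at x)"
  shows "(f has_derivative (\<lambda>h. \<Sum>j\<in>UNIV. (h $ j) *\<^sub>R partial_deriv j f x)) (at x)"
proof -
  obtain f' where f': "(f has_derivative f') (at x)"
    using assms by (auto simp: differentiable_def)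
  interpret f': bounded_linear f' using f' by (rule has_derivative_bounded_linear)
  have pd: "partial_deriv j f x = f' (axis j 1)" for j
  proof -
    have "((\<lambda>h. x + h *\<^sub>R axis j 1) has_derivative (\<lambda>h. h *\<^sub>R axis j (1::real))) (at 0)"
      by (auto intro!: derivative_eq_intros)
    moreover have "(f has_derivative f') (at (x + 0 *\<^sub>R axis j 1))"
      using f' by simp
    ultimately have "((\<lambda>h. f (x + h *\<^sub>R axis j 1)) has_derivative (\<lambda>h. f' (h *\<^sub>R axis j 1))) (at 0)"
      by (rule has_derivative_compose)
    then show ?thesis
      unfolding partial_deriv_def
      by (intro vector_derivative_at) (simp add: has_vector_derivative_def f'.scaleR)
  qed
  have "f' h = (\<Sum>j\<in>UNIV. (h $ j) *\<^sub>R partial_deriv j f x)" for h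
  proof -
    have "f' h = f' (\<Sum>j\<in>UNIV. (h $ j) *\<^sub>R axis j 1)"
      using basis_expansion[of h] by (simp add: scalar_mult_eq_scaleR)
    then show ?thesis by (simp add: f'.sum f'.scaleR pd)
  qed
  then show ?thesis using f' by presburger
qed

lemma lipschitz_of_partial_deriv_bound:
  fixes f :: "real ^ 'm::finite \<Rightarrow> 'b::real_normed_vector"
  assumes "convex S" "y \<in> S" "z \<in> S"
    and diff: "\<And>x. x \<in> S \<Longrightarrow> f differentiable (at x)"
    and bnd: "\<And>j x. x \<in> S \<Longrightarrow> norm (partial_deriv j f x) \<le> K"
  shows "norm (f y - f z) \<le> K * real CARD('m) * norm (y - z)"
proof (rule differentiable_bound[OF \<open>convex S\<close> _ _ \<open>y \<in> S\<close> \<open>z \<in> S\<close>])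
  fix x assume x: "x \<in> S"
  show "(f has_derivative (\<lambda>h. \<Sum>j\<in>UNIV. (h $ j) *\<^sub>R partial_deriv j f x)) (at x within S)"
    using has_derivative_partial_deriv[OF diff[OF x]] by (rule has_derivative_at_withinI)
  show "onorm (\<lambda>h. \<Sum>j\<in>UNIV. (h $ j) *\<^sub>R partial_deriv j f x) \<le> K * real CARD('m)"
  proof (rule onorm_le)
    fix h :: "real ^ 'm"
    have "norm (\<Sum>j\<in>UNIV. (h $ j) *\<^sub>R partial_deriv j f x) \<le> (\<Sum>j\<in>(UNIV::'m set). norm h * K)"
      by (intro sum_norm_le) (auto intro!: mult_mono component_le_norm_cart bnd x)
    then show "norm (\<Sum>j\<in>UNIV. (h $ j) *\<^sub>R partial_deriv j f x) \<le> K * real CARD('m) * norm h"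
      by (simp add: mult_ac)
  qed
qed

text \<open>The monomial of the multi-index counted by \<open>js\<close>. A multi-index \<alpha> of
  degree m is the count of m! / \<alpha>! lists, so summing over lists with weight 1 / m! reproduces
  the usual weight 1 / \<alpha>!.\<close>

definition list_monomial :: "'m list \<Rightarrow> real ^ 'm \<Rightarrow> real" where
  "list_monomial js h = prod_list (map (($) h) js)"

lemma list_monomial_simps [simp]:
  "list_monomial [] h = 1"
  "list_monomial (j # js) h = h $ j * list_monomial js h"
  by (simp_all add: list_monomial_def)

lemma abs_list_monomial_le_1:
  assumes "\<And>q. \<bar>h $ q\<bar> \<le> 1"
  shows "\<bar>list_monomial js h\<bar> \<le> 1"
  by (induction js) (auto simp: abs_mult intro!: mult_le_one assms)

lemma finite_lists_length [simp]: "finite {js :: 'm::finite list. length js = m}"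
  using finite_lists_length_eq[of "UNIV :: 'm set" m] by simp

lemma card_lists_length: "card {js :: 'm::finite list. length js = m} = CARD('m) ^ m"
  using card_lists_length_eq[of "UNIV :: 'm set" m] by simp

lemma sum_lists_length_Suc:
  fixes g :: "'m::finite list \<Rightarrow> 'b::comm_monoid_add"
  shows "(\<Sum>js | length js = Suc m. g js) = (\<Sum>js | length js = m. \<Sum>j\<in>UNIV. g (j # js))"
proof -
  have "{js :: 'm list. length js = Suc m} = (\<lambda>(js, j). j # js) ` ({js. length js = m} \<times> UNIV)"
    by (auto simp: length_Suc_conv image_iff)
  moreover have "inj_on (\<lambda>(js, j). j # js) ({js :: 'm list. length js = m} \<times> UNIV)"
    by (auto simp: inj_on_def)
  ultimately have "(\<Sum>js | length js = Suc m. g js) =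
      (\<Sum>(js, j)\<in>{js :: 'm list. length js = m} \<times> UNIV. g (j # js))"
    by (simp only: sum.reindex) (simp add: split_beta)
  then show ?thesis by (simp add: sum.cartesian_product)
qed

text \<open>Summing over all lists of length \<open>m\<close> instead of over multi-indices makes \<open>1 / fact m\<close> the
  only combinatorial factor and never uses that partial derivatives commute.\<close>

lemma taylor_sums:
  fixes f :: "real ^ 'm::finite \<Rightarrow> real ^ 'k::finite"
  assumes smooth: "smooth_on UNIV f"
    and bnd: "\<And>js t. 0 \<le> t \<Longrightarrow> t \<le> 1 \<Longrightarrow> norm (iter_partial js f (y + t *\<^sub>R h)) \<le> K"
    and h: "\<And>q. \<bar>h $ q\<bar> \<le> 1"
  shows "(\<lambda>m. (\<Sum>js | length js = m. list_monomial js h * (iter_partial js f y $ i)) / fact m)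
           sums (f (y + h) $ i)"
proof -
  \<comment> \<open>\<open>D m\<close> is the m-th derivative of
    \<open>t \<mapsto> f (y + t h) $ i\<close> along the segment; appending one more coordinate to
    the front of each list is one more differentiation.\<close>
  define D where "D = (\<lambda>m t. \<Sum>js | length js = m.
    list_monomial js h * (iter_partial js f (y + t *\<^sub>R h) $ i))"
  have deriv1: "((\<lambda>t. iter_partial js f (y + t *\<^sub>R h) $ i) has_real_derivative
      (\<Sum>j\<in>UNIV. h $ j * (iter_partial (j # js) f (y + t *\<^sub>R h) $ i))) (at t)" for js t
  proof -
    have "iter_partial js f differentiable (at (y + t *\<^sub>R h))"
      using smooth by (auto simp: smooth_on_def)
    from has_derivative_partial_deriv[OF this]
    have d: "(iter_partial js f has_derivative
      (\<lambda>h'. \<Sum>j\<in>UNIV. (h' $ j) *\<^sub>R iter_partial (j # js) f (y + t *\<^sub>R h))) (at (y + t *\<^sub>R h))"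
      by simp
    have "((\<lambda>t. y + t *\<^sub>R h) has_derivative (\<lambda>s. s *\<^sub>R h)) (at t)"
      by (auto intro!: derivative_eq_intros)
    from has_derivative_compose[OF this d]
    have "((\<lambda>t. iter_partial js f (y + t *\<^sub>R h)) has_derivative
      (\<lambda>s. \<Sum>j\<in>UNIV. ((s *\<^sub>R h) $ j) *\<^sub>R iter_partial (j # js) f (y + t *\<^sub>R h))) (at t)" .
    from bounded_linear.has_derivative[OF bounded_linear_vec_nth this]
    show ?thesis
      unfolding has_field_derivative_def
      by (rule has_derivative_eq_rhs) (auto simp: sum_distrib_left mult_ac simp del: iter_partial.simps)
  qed
  have deriv: "(D m has_real_derivative D (Suc m) t) (at t)" for m t
  proof -
    have "(D m has_real_derivative (\<Sum>js | length js = m. list_monomial js h *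
       (\<Sum>j\<in>UNIV. h $ j * (iter_partial (j # js) f (y + t *\<^sub>R h) $ i)))) (at t)"
      unfolding D_def by (intro DERIV_sum DERIV_cmult deriv1)
    then show ?thesis
      unfolding D_def sum_lists_length_Suc
      by (simp add: sum_distrib_left mult_ac del: iter_partial.simps)
  qed

  have D_bnd: "\<bar>D m t\<bar> \<le> K * real CARD('m) ^ m" if "0 \<le> t" "t \<le> 1" for m t
  proof -
    have "\<bar>D m t\<bar> \<le> (\<Sum>js :: 'm list | length js = m. 1 * K)"
      unfolding D_def
    proof (intro order_trans[OF sum_abs] sum_mono)
      fix js :: "'m list"
      have "\<bar>iter_partial js f (y + t *\<^sub>R h) $ i\<bar> \<le> K"
        using component_le_norm_cart bnd[OF that] order_trans by blast
      then show "\<bar>list_monomial js h * (iter_partial js f (y + t *\<^sub>R h) $ i)\<bar> \<le> 1 * K"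
        unfolding abs_mult by (intro mult_mono abs_list_monomial_le_1 h) auto
    qed
    then show ?thesis by (simp add: card_lists_length mult_ac)
  qed
  \<comment> \<open>One bound \<open>K\<close> for derivatives of all orders makes the Lagrange
    remainder a term of an exponential series. The case \<open>N = 0\<close> is separate because
    \<open>Maclaurin\<close> asks for a positive order.\<close>
  have "norm (D 0 1 - (\<Sum>m<N. D m 0 / fact m)) \<le> K * (real CARD('m) ^ N / fact N)" for N
  proof (cases "N = 0")
    case True
    then show ?thesis using D_bnd[of 1 0] by simp
  next
    case False
    obtain t where t: "0 < t" "t < 1" "D 0 1 = (\<Sum>m<N. D m 0 / fact m * 1 ^ m) + D N t / fact N * 1 ^ N"
      using Maclaurin[of 1 N D "D 0"] deriv False by auto
    have "norm (D 0 1 - (\<Sum>m<N. D m 0 / fact m)) = \<bar>D N t\<bar> / fact N"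
      using t by simp
    also have "\<dots> \<le> K * real CARD('m) ^ N / fact N"
      using t by (intro divide_right_mono D_bnd) auto
    finally show ?thesis by simp
  qed
  note remainder = this
  have "(\<lambda>N. inverse (fact N) * real CARD('m) ^ N) \<longlonglongrightarrow> 0"
    by (rule summable_LIMSEQ_zero[OF summable_exp])
  then have lim: "(\<lambda>N. K * (real CARD('m) ^ N / fact N)) \<longlonglongrightarrow> 0"
    by (intro tendsto_mult_right_zero) (simp add: divide_inverse mult.commute)
  have "(\<lambda>N. D 0 1 - (\<Sum>m<N. D m 0 / fact m)) \<longlonglongrightarrow> 0"
    by (rule Lim_null_comparison[OF always_eventually lim]) (use remainder in blast)
  then have "(\<lambda>N. D 0 1 - (D 0 1 - (\<Sum>m<N. D m 0 / fact m))) \<longlonglongrightarrow> D 0 1 - 0"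
    by (intro tendsto_diff tendsto_const)
  then have "(\<lambda>m. D m 0 / fact m) sums D 0 1"
    by (simp add: sums_def)
  then show ?thesis by (simp add: D_def)
qed

text \<open>Summation by parts. The rough sequence \<open>S\<close> enters only through its maximum,
  and the regular one \<open>c\<close> through its supremum and variation; \<open>S 0 = 0\<close>
  removes one boundary term.\<close>

lemma abel_sum_bound:
  fixes S c :: "nat \<Rightarrow> real"
  assumes "S 0 = 0" and S: "\<And>k. k \<le> n \<Longrightarrow> \<bar>S k\<bar> \<le> m"
    and c: "\<And>k. k < n \<Longrightarrow> \<bar>c k\<bar> \<le> K" and V: "(\<Sum>k<n - 1. \<bar>c (Suc k) - c k\<bar>) \<le> V"
    and "0 \<le> K" "0 \<le> m"
  shows "\<bar>\<Sum>k<n. (S (Suc k) - S k) * c k\<bar> \<le> m * (K + V)"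
proof (cases n)
  case 0
  then show ?thesis using assms by simp
next
  case (Suc n')
  have eq: "(\<Sum>k<Suc N. (S (Suc k) - S k) * c k)
    = S (Suc N) * c N - (\<Sum>k<N. S (Suc k) * (c (Suc k) - c k))" for N
    by (induction N) (simp_all add: \<open>S 0 = 0\<close> algebra_simps)
  have "\<bar>\<Sum>k<n'. S (Suc k) * (c (Suc k) - c k)\<bar> \<le> (\<Sum>k<n'. m * \<bar>c (Suc k) - c k\<bar>)"
    using Suc by (intro order_trans[OF sum_abs] sum_mono) (auto simp: abs_mult intro!: mult_right_mono S)
  also have "\<dots> \<le> m * V"
    using V Suc \<open>0 \<le> m\<close> by (simp flip: sum_distrib_left add: mult_left_mono)
  finally have "\<bar>\<Sum>k<n'. S (Suc k) * (c (Suc k) - c k)\<bar> \<le> m * V" .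
  moreover have "\<bar>S (Suc n') * c n'\<bar> \<le> m * K"
    unfolding abs_mult using Suc \<open>0 \<le> m\<close> by (intro mult_mono S c) auto
  ultimately show ?thesis
    unfolding Suc eq by (simp add: distrib_left)
qed

text \<open>The function \<open>w\<close> is only continuous, so the integrating factor is applied
  to the primitive \<open>g\<close> on the right-hand side, which dominates \<open>w\<close> and can
  be differentiated.\<close>

lemma gronwall_integral:
  fixes w :: "real \<Rightarrow> real"
  assumes cont: "continuous_on {0..T} w" and "C > 0"
    and le: "\<And>t. t \<in> {0..T} \<Longrightarrow> w t \<le> integral {0..t} (\<lambda>s. C * w s + C * a)"
    and t: "t \<in> {0..T}"
  shows "w t + a \<le> a * exp (C * t)"
proof -
  define g where "g = (\<lambda>t. integral {0..t} (\<lambda>s. C * w s + C * a))"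
  have cont': "continuous_on {0..T} (\<lambda>s. C * w s + C * a)"
    by (intro continuous_intros cont)
  have g': "(g has_real_derivative C * w s + C * a) (at s within {0..T})" if "s \<in> {0..T}" for s
    unfolding g_def by (rule integral_has_real_derivative[OF cont' that])
  define G where "G = (\<lambda>t. exp (- C * t) * (g t + a))"
  have contG: "continuous_on {0..T} G"
    unfolding G_def
    by (intro continuous_intros DERIV_continuous_on[OF g']) auto
  have "G t \<le> G 0"
  proof (cases "t = 0")
    case False
    then have "0 < t" using t by auto
    show ?thesis
    proof (rule DERIV_nonpos_imp_decreasing_open[OF less_imp_le[OF \<open>0 < t\<close>]])
      show "continuous_on {0..t} G"
        using contG t by (auto elim: continuous_on_subset)
      fix s assume s: "0 < s" "s < t"
      have "(g has_real_derivative C * w s + C * a) (at s)"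
        using g'[of s] s t at_within_Icc_at[of 0 s T] by auto
      then have "(G has_real_derivative exp (- C * s) * (C * w s + C * a)
         + exp (- C * s) * (- C) * (g s + a)) (at s)"
        unfolding G_def by (auto intro!: derivative_eq_intros)
      moreover have "exp (- C * s) * (C * w s + C * a) + exp (- C * s) * (- C) * (g s + a)
         = exp (- C * s) * C * (w s - g s)"
        by (simp add: algebra_simps)
      moreover have "w s \<le> g s" unfolding g_def using s t by (intro le) auto
      then have "exp (- C * s) * C * (w s - g s) \<le> 0"
        using \<open>C > 0\<close> by (simp add: mult_nonneg_nonpos)
      ultimately show "\<exists>y. (G has_real_derivative y) (at s) \<and> y \<le> 0" by metis
    qed
  qed simp
  also have "G 0 = a" by (simp add: G_def g_def)
  finally have "exp (- C * t) * (g t + a) \<le> a" by (simp add: G_def)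
  then have "exp (C * t) * (exp (- C * t) * (g t + a)) \<le> exp (C * t) * a"
    by (intro mult_left_mono) auto
  then have "g t + a \<le> exp (C * t) * a"
    by (simp add: mult.assoc[symmetric] flip: exp_add)
  moreover have "w t \<le> g t" unfolding g_def by (rule le[OF t])
  ultimately show ?thesis by (simp add: mult.commute)
qed

text \<open>\<open>X\<close> need not be continuous, so Gronwall is not applied to the distance of
  \<open>X\<close> and \<open>x\<close> but to the primitive \<open>w\<close> of the drift
  difference. That primitive is continuous, and the distance is at most
  \<open>w + a\<close>.\<close>

lemma integral_equation_deviation:
  fixes F :: "'b::euclidean_space \<Rightarrow> 'b"
  assumes "C > 0" and lip: "\<And>y z. norm (F y - F z) \<le> C * norm (y - z)"
    and X: "\<And>t. t \<in> {0..1} \<Longrightarrow> X t = x\<^sub>0 + (LINT s:{0..t}|lborel. F (X s)) + l t"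
    and int: "set_integrable lborel {0..1::real} (\<lambda>s. F (X s))"
    and l: "\<And>t. t \<in> {0..1} \<Longrightarrow> norm (l t) \<le> a"
    and x: "x 0 = x\<^sub>0"
      "\<And>t. t \<ge> 0 \<Longrightarrow> (x has_vector_derivative F (x t)) (at t within {0..})"
    and t: "t \<in> {0..1}"
  shows "norm (X t - x t) \<le> a * exp C"
proof -
  have contx: "continuous_on {0..1} x"
    by (rule continuous_on_subset[OF continuous_on_vector_derivative[OF x(2)]]) auto
  have contF: "continuous_on UNIV F"
    by (rule lipschitz_on_continuous_on[of C], rule lipschitz_onI)
       (use lip \<open>C > 0\<close> in \<open>auto simp: dist_norm\<close>)
  have contFx: "continuous_on {0..1} (\<lambda>s. F (x s))"
    by (rule continuous_on_compose2[OF contF contx]) auto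
  define \<phi> where "\<phi> = (\<lambda>s. norm (F (X s) - F (x s)))"
  have diff_int: "set_integrable lborel {0..1} (\<lambda>s. F (X s) - F (x s))"
    by (intro set_integral_diff int borel_integrable_atLeastAtMost' contFx)
  have \<phi>_int: "\<phi> integrable_on {0..1}"
    unfolding \<phi>_def by (intro set_borel_integral_eq_integral set_integrable_norm diff_int)
  define w where "w = (\<lambda>t. integral {0..t} \<phi>)"
  have contw: "continuous_on {0..1} w"
    unfolding w_def by (rule indefinite_integral_continuous_1[OF \<phi>_int])
  have dev: "norm (X t - x t) \<le> w t + a" if t: "t \<in> {0..1}" for t
  proof -
    have sub: "set_integrable lborel {0..t} (\<lambda>s. F (X s) - F (x s))"
      "set_integrable lborel {0..t} (\<lambda>s. F (X s))"
      using t by (auto intro: set_integrable_subset[OF diff_int] set_integrable_subset[OF int])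
    have subc: "set_integrable lborel {0..t} (\<lambda>s. F (x s))"
      using t by (intro borel_integrable_atLeastAtMost' continuous_on_subset[OF contFx]) auto
    have "((\<lambda>s. F (x s)) has_integral x t - x 0) {0..t}"
      using t by (intro fundamental_theorem_of_calculus has_vector_derivative_within_subset[OF x(2)]) auto
    then have "x t = x\<^sub>0 + integral {0..t} (\<lambda>s. F (x s))"
      using x(1) by (simp add: has_integral_iff)
    then have "X t - x t = integral {0..t} (\<lambda>s. F (X s) - F (x s)) + l t"
      using X[OF t] set_borel_integral_eq_integral[OF sub(2)] set_borel_integral_eq_integral[OF subc]
      by (simp add: Henstock_Kurzweil_Integration.integral_diff)
    moreover have "norm (integral {0..t} (\<lambda>s. F (X s) - F (x s))) \<le> w t"
      unfolding w_def using t
      by (intro integral_norm_bound_integral set_borel_integral_eq_integral sub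
          integrable_on_subinterval[OF \<phi>_int]) (auto simp: \<phi>_def)
    ultimately show ?thesis using l[OF t] by (smt (verit) norm_triangle_ineq)
  qed
  have "w t \<le> integral {0..t} (\<lambda>s. C * w s + C * a)" if t: "t \<in> {0..1}" for t
  proof -
    have w_t: "w t = integral {0..t} \<phi>" by (simp add: w_def)
    show ?thesis
      unfolding w_t
    proof (rule integral_le)
      show "\<phi> integrable_on {0..t}"
        using t by (intro integrable_on_subinterval[OF \<phi>_int]) auto
      have "continuous_on {0..t} w"
        using t by (intro continuous_on_subset[OF contw]) auto
      then show "(\<lambda>s. C * w s + C * a) integrable_on {0..t}"
        by (intro integrable_continuous_interval continuous_intros)
      fix s assume "s \<in> {0..t}"
      then have "s \<in> {0..1}" using t by auto
      have "\<phi> s \<le> C * norm (X s - x s)" unfolding \<phi>_def by (rule lip)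
      also have "\<dots> \<le> C * (w s + a)"
        using dev[OF \<open>s \<in> {0..1}\<close>] \<open>C > 0\<close> by simp
      finally show "\<phi> s \<le> C * w s + C * a" by (simp add: distrib_left)
    qed
  qed
  then have "w t + a \<le> a * exp (C * t)"
    by (rule gronwall_integral[OF contw \<open>C > 0\<close> _ t])
  also have "\<dots> \<le> a * exp C"
  proof (intro mult_left_mono)
    show "0 \<le> a" using order_trans[OF norm_ge_zero l[of 0]] by simp
  qed (use t \<open>C > 0\<close> in auto)
  finally show ?thesis using dev[OF t] by simp
qed

section \<open>Martingale transforms of independent increments\<close>

context prob_space begin

text \<open>The sigma-algebra generated by the variables with index below \<open>j\<close>, encoded
  through one map into a finite product so that independence of blocks of indices applies to it
  directly.\<close>

definition past :: "(nat \<Rightarrow> 'a \<Rightarrow> 'b::topological_space) \<Rightarrow> nat \<Rightarrow> 'a measure" where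
  "past \<xi> j = vimage_algebra (space M) (\<lambda>\<omega>. restrict (\<lambda>i. \<xi> i \<omega>) {..<j}) (PiM {..<j} (\<lambda>_. borel))"

lemma space_past [simp]: "space (past \<xi> j) = space M"
  by (simp add: past_def)

lemma measurable_past_component: "i < j \<Longrightarrow> \<xi> i \<in> borel_measurable (past \<xi> j)"
proof -
  assume i: "i < j"
  have "(\<lambda>\<omega>. restrict (\<lambda>i. \<xi> i \<omega>) {..<j}) \<in> measurable (past \<xi> j) (PiM {..<j} (\<lambda>_. borel))"
    unfolding past_def by (rule measurable_vimage_algebra1) (auto simp: space_PiM)
  from measurable_compose[OF this measurable_component_singleton[of i]] i
  show ?thesis by simp
qed

lemma past_mono:
  assumes "Z \<in> borel_measurable (past \<xi> i)" "i \<le> j"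
  shows "Z \<in> borel_measurable (past \<xi> j)"
proof -
  have "(\<lambda>\<omega>. restrict (\<lambda>k. \<xi> k \<omega>) {..<i}) \<in> measurable (past \<xi> j) (PiM {..<i} (\<lambda>_. borel))"
    using assms(2) by (intro measurable_restrict measurable_past_component) auto
  then have "(\<lambda>\<omega>. \<omega>) \<in> measurable (past \<xi> j) (past \<xi> i)"
    by (subst (2) past_def) (rule measurable_vimage_algebra2, auto)
  from measurable_compose[OF this assms(1)] show ?thesis .
qed

lemma measurable_past_imp:
  assumes "\<And>i. i < j \<Longrightarrow> \<xi> i \<in> borel_measurable M" "Z \<in> borel_measurable (past \<xi> j)"
  shows "Z \<in> borel_measurable M"
proof -
  have "(\<lambda>\<omega>. restrict (\<lambda>k. \<xi> k \<omega>) {..<j}) \<in> measurable M (PiM {..<j} (\<lambda>_. borel))"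
    by (intro measurable_restrict assms) auto
  then have "(\<lambda>\<omega>. \<omega>) \<in> measurable M (past \<xi> j)"
    by (subst past_def) (rule measurable_vimage_algebra2, auto)
  from measurable_compose[OF this assms(2)] show ?thesis .
qed

text \<open>The blocks \<open>{..<j}\<close> and \<open>{j}\<close> are independent, and
  independence passes to smaller sigma-algebras. The argument runs through sigma-algebras because
  \<open>Z\<close> comes without a factorisation through the first \<open>j\<close>
  variables.\<close>

lemma indep_var_past:
  fixes Z :: "'a \<Rightarrow> 'c::topological_space" and \<xi> :: "nat \<Rightarrow> 'a \<Rightarrow> 'b::topological_space"
  assumes ind: "indep_vars (\<lambda>_. borel) \<xi> {..<n}" and j: "j < n"
    and Z: "Z \<in> borel_measurable (past \<xi> j)" and g: "g \<in> borel_measurable borel"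
  shows "indep_var borel Z borel (\<lambda>\<omega>. g (\<xi> j \<omega>))"
proof -
  let ?R = "\<lambda>\<omega>. restrict (\<lambda>i. \<xi> i \<omega>) {..<j}" and ?P = "PiM {..<j} (\<lambda>_. borel :: 'b measure)"
  let ?R' = "\<lambda>\<omega>. restrict (\<lambda>i. \<xi> i \<omega>) {j}" and ?P' = "PiM {j} (\<lambda>_. borel :: 'b measure)"
  have "indep_var ?P ?R ?P' ?R'"
    using j by (intro indep_var_restrict[OF ind]) auto
  then have ind2: "indep_set (sigma_sets (space M) {?R -` A \<inter> space M | A. A \<in> sets ?P})
       (sigma_sets (space M) {?R' -` A \<inter> space M | A. A \<in> sets ?P'})"
    by (auto simp: indep_var_eq)
  have rv: "random_variable borel (\<xi> j)"
    using ind j by (auto simp: indep_vars_def)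
  have "{Z -` A \<inter> space M | A. A \<in> sets borel} \<subseteq> {?R -` A \<inter> space M | A. A \<in> sets ?P}"
  proof clarify
    fix A :: "'c set" assume "A \<in> sets borel"
    then have "Z -` A \<inter> space M \<in> sets (past \<xi> j)"
      using measurable_sets[OF Z] by simp
    also have "sets (past \<xi> j) = {?R -` A \<inter> space M | A. A \<in> sets ?P}"
      unfolding past_def by (intro sets_vimage_algebra2) (auto simp: space_PiM)
    finally show "\<exists>A'. Z -` A \<inter> space M = ?R -` A' \<inter> space M \<and> A' \<in> sets ?P" by blast
  qed
  note 1 = sigma_sets_mono'[OF this, of "space M"]
  have "{(\<lambda>\<omega>. g (\<xi> j \<omega>)) -` A \<inter> space M | A. A \<in> sets borel} \<subseteq> {?R' -` A \<inter> space M | A. A \<in> sets ?P'}"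
  proof clarify
    fix A :: "'c set" assume A: "A \<in> sets borel"
    have "(\<lambda>f. g (f j)) \<in> borel_measurable ?P'"
      by (rule measurable_compose[OF _ g], rule measurable_component_singleton) simp
    from measurable_sets[OF this A] have "(\<lambda>f. g (f j)) -` A \<inter> space ?P' \<in> sets ?P'" .
    moreover have "(\<lambda>\<omega>. g (\<xi> j \<omega>)) -` A \<inter> space M = ?R' -` ((\<lambda>f. g (f j)) -` A \<inter> space ?P') \<inter> space M"
      by (auto simp: space_PiM)
    ultimately show "\<exists>A'. (\<lambda>\<omega>. g (\<xi> j \<omega>)) -` A \<inter> space M = ?R' -` A' \<inter> space M \<and> A' \<in> sets ?P'"
      by blast
  qed
  note 2 = sigma_sets_mono'[OF this, of "space M"]
  have "indep_set (sigma_sets (space M) {Z -` A \<inter> space M | A. A \<in> sets borel})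
       (sigma_sets (space M) {(\<lambda>\<omega>. g (\<xi> j \<omega>)) -` A \<inter> space M | A. A \<in> sets borel})"
    unfolding indep_set_def
    by (rule indep_sets_mono_sets[OF ind2[unfolded indep_set_def]]) (use 1 2 in \<open>simp split: bool.split\<close>)
  moreover have "random_variable borel Z"
    using ind j by (intro measurable_past_imp[OF _ Z]) (auto simp: indep_vars_def)
  ultimately show ?thesis using measurable_compose[OF rv g] by (simp add: indep_var_eq)
qed

end

text \<open>Doob's L2 maximal inequality before taking expectations: the sum on the right is a
  transform of \<open>s\<close>, so for a martingale its mean vanishes.\<close>

lemma doob_pathwise:
  fixes s m :: "nat \<Rightarrow> real"
  assumes "m 0 = s 0" "\<And>k. m (Suc k) = max (m k) (s (Suc k))"
  shows "(m n)\<^sup>2 \<le> 4 * (s n)\<^sup>2 - 4 * (\<Sum>k<n. m k * (s (Suc k) - s k))"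
proof -
  \<comment> \<open>A discrete integration by parts: \<open>m\<close> grows only at times when it
    coincides with \<open>s\<close>. Young's inequality for \<open>m n * s n\<close> then finishes
    the proof.\<close>
  have "(\<Sum>k<n. m k * (s (Suc k) - s k)) \<le> m n * s n - (m n)\<^sup>2 / 2"
  proof (induction n)
    case 0
    then show ?case using assms(1) by (simp add: power2_eq_square)
  next
    case (Suc n)
    \<comment> \<open>At a new maximum the two sides differ by half the square of the jump of the
      maximum; otherwise they agree.\<close>
    have "m n * s (Suc n) - (m n)\<^sup>2 / 2 \<le> m (Suc n) * s (Suc n) - (m (Suc n))\<^sup>2 / 2"
    proof (cases "m n \<ge> s (Suc n)")
      case False
      then have eq: "m (Suc n) = s (Suc n)" using assms(2)[of n] by simp
      have "0 \<le> (s (Suc n) - m n)\<^sup>2" by simp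
      then show ?thesis unfolding eq power2_diff by (simp add: power2_eq_square mult.commute)
    next
      case True
      then have eq: "m (Suc n) = m n" using assms(2)[of n] by simp
      show ?thesis unfolding eq by simp
    qed
    moreover have "(\<Sum>k<Suc n. m k * (s (Suc k) - s k))
        = (\<Sum>k<n. m k * (s (Suc k) - s k)) + (m n * s (Suc n) - m n * s n)"
      by (simp add: right_diff_distrib)
    ultimately show ?case using Suc by linarith
  qed
  moreover have "4 * (m n * s n) \<le> (m n)\<^sup>2 + 4 * (s n)\<^sup>2"
    using zero_le_power2[of "m n - 2 * s n"] by (simp add: power2_diff power_mult_distrib)
  ultimately show ?thesis by linarith
qed

text \<open>The recursion has the shape required by \<open>doob_pathwise\<close>, and it makes
  measurability and adaptedness plain inductions.\<close>

primrec running_max :: "(nat \<Rightarrow> real) \<Rightarrow> nat \<Rightarrow> real" where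
  "running_max S 0 = \<bar>S 0\<bar>"
| "running_max S (Suc n) = max (running_max S n) \<bar>S (Suc n)\<bar>"

lemma abs_le_running_max: "k \<le> n \<Longrightarrow> \<bar>S k\<bar> \<le> running_max S n"
  by (induction n) (auto simp: le_Suc_eq le_max_iff_disj)

lemma running_max_nonneg: "0 \<le> running_max S n"
  using abs_le_running_max[of 0 n S] by simp

text \<open>A crude bound whose only purpose is integrability of the maximum.\<close>

lemma running_max_le_sum: "running_max S n \<le> (\<Sum>k\<le>n. \<bar>S k\<bar>)"
  by (induction n) (auto simp: sum_nonneg)

lemma measurable_running_max:
  assumes "\<And>k. k \<le> n \<Longrightarrow> (\<lambda>\<omega>. S \<omega> k) \<in> borel_measurable N"
  shows "(\<lambda>\<omega>. running_max (S \<omega>) n) \<in> borel_measurable N"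
  using assms by (induction n) auto

text \<open>\<open>sgn (S k)\<close> is a subgradient of \<open>\<bar>\<cdot>\<bar>\<close> at \<open>S k\<close>, so the pathwise inequality for \<open>\<bar>S\<bar>\<close> turns into one
  whose correction term is a martingale transform of \<open>S\<close>.\<close>

lemma running_max_sq_le:
  "(running_max S n)\<^sup>2 \<le> 4 * (S n)\<^sup>2 - 4 * (\<Sum>k<n. running_max S k * (sgn (S k) * (S (Suc k) - S k)))"
proof -
  have "sgn x * (y - x) \<le> \<bar>y\<bar> - \<bar>x\<bar>" for x y :: real
    by (auto simp: sgn_if abs_if)
  then have "(\<Sum>k<n. running_max S k * (sgn (S k) * (S (Suc k) - S k)))
      \<le> (\<Sum>k<n. running_max S k * (\<bar>S (Suc k)\<bar> - \<bar>S k\<bar>))"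
    by (intro sum_mono mult_left_mono running_max_nonneg)
  then show ?thesis
    using doob_pathwise[of "running_max S" "\<lambda>k. \<bar>S k\<bar>" n] by simp
qed

context prob_space begin

lemma expectation_past_mult:
  fixes Z :: "'a \<Rightarrow> real" and \<xi> :: "nat \<Rightarrow> 'a \<Rightarrow> real ^ 'd::finite"
  assumes ind: "indep_vars (\<lambda>_. borel) \<xi> {..<n}" and j: "j < n"
    and Z: "Z \<in> borel_measurable (past \<xi> j)" and int: "integrable M Z" "integrable M (\<lambda>\<omega>. \<xi> j \<omega> $ i)"
  shows "integrable M (\<lambda>\<omega>. Z \<omega> * (\<xi> j \<omega> $ i))"
    "expectation (\<lambda>\<omega>. Z \<omega> * (\<xi> j \<omega> $ i)) = expectation Z * expectation (\<lambda>\<omega>. \<xi> j \<omega> $ i)"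
proof -
  have "indep_var borel Z borel (\<lambda>\<omega>. \<xi> j \<omega> $ i)"
    by (rule indep_var_past[OF ind j Z]) simp
  from indep_var_integrable[OF this int] indep_var_lebesgue_integral[OF this int]
  show "integrable M (\<lambda>\<omega>. Z \<omega> * (\<xi> j \<omega> $ i))"
    "expectation (\<lambda>\<omega>. Z \<omega> * (\<xi> j \<omega> $ i)) = expectation Z * expectation (\<lambda>\<omega>. \<xi> j \<omega> $ i)" .
qed

text \<open>The multipliers are predictable, so increments are orthogonal and the second moment of
  the transform is at most \<open>n * v\<close>. In the mean the correction term of
  \<open>running_max_sq_le\<close> drops out. With \<open>v\<close> of order 1 / n the result does
  not depend on n.\<close>

lemma expectation_running_max_transform_le:
  fixes \<xi> :: "nat \<Rightarrow> 'a \<Rightarrow> real ^ 'd::finite" and \<phi> :: "nat \<Rightarrow> 'a \<Rightarrow> real"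
  assumes ind: "indep_vars (\<lambda>_. borel) \<xi> {..<n}"
    and \<phi>: "\<And>j. j < n \<Longrightarrow> \<phi> j \<in> borel_measurable (past \<xi> j)" "\<And>j \<omega>. \<bar>\<phi> j \<omega>\<bar> \<le> 1"
    and int: "\<And>j. j < n \<Longrightarrow> integrable M (\<lambda>\<omega>. \<xi> j \<omega> $ i)" "\<And>j. j < n \<Longrightarrow> expectation (\<lambda>\<omega>. \<xi> j \<omega> $ i) = 0"
    and sq: "\<And>j. j < n \<Longrightarrow> integrable M (\<lambda>\<omega>. (\<xi> j \<omega> $ i)\<^sup>2)"
       "\<And>j. j < n \<Longrightarrow> expectation (\<lambda>\<omega>. (\<xi> j \<omega> $ i)\<^sup>2) \<le> v"
  shows "(\<integral>\<^sup>+\<omega>. ennreal (running_max (\<lambda>k. \<Sum>j<k. \<xi> j \<omega> $ i * \<phi> j \<omega>) n) \<partial>M) \<le> ennreal (1 + 4 * (real n * v))"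
proof -
  define S where "S = (\<lambda>\<omega> k. \<Sum>j<k. \<xi> j \<omega> $ i * \<phi> j \<omega>)"
  have \<xi>_meas: "\<And>j. j < n \<Longrightarrow> \<xi> j \<in> borel_measurable M" using ind by (auto simp: indep_vars_def)
  have past_M: "Z \<in> borel_measurable M" if "Z \<in> borel_measurable (past \<xi> j)" "j \<le> n" for Z :: "'a \<Rightarrow> real" and j
    by (rule measurable_past_imp[OF \<xi>_meas that(1)]) (use that(2) in simp)
  have S_past: "(\<lambda>\<omega>. S \<omega> k) \<in> borel_measurable (past \<xi> k)" if "k \<le> n" for k
    unfolding S_def
  proof (intro borel_measurable_sum borel_measurable_times)
    fix j assume "j \<in> {..<k}"
    then show "(\<lambda>\<omega>. \<xi> j \<omega> $ i) \<in> borel_measurable (past \<xi> k)"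
      by (intro measurable_compose[of "\<xi> j" _ borel "\<lambda>v. v $ i"] measurable_past_component) auto
    show "\<phi> j \<in> borel_measurable (past \<xi> k)"
      using \<open>j \<in> {..<k}\<close> that by (intro past_mono[OF \<phi>(1)]) auto
  qed
  \<comment> \<open>This trades first moments for second moments; it is the origin of the summand 1
    in the final constant.\<close>
  have le_sq: "\<bar>x\<bar> \<le> 1 + x\<^sup>2" for x :: real
  proof (cases "\<bar>x\<bar> \<le> 1")
    case False
    then have "\<bar>x\<bar> * 1 \<le> \<bar>x\<bar> * \<bar>x\<bar>" by (intro mult_left_mono) auto
    then show ?thesis by (simp add: power2_eq_square)
  qed (use zero_le_power2[of x] in linarith)
  have S_sq: "integrable M (\<lambda>\<omega>. (S \<omega> k)\<^sup>2) \<and> expectation (\<lambda>\<omega>. (S \<omega> k)\<^sup>2) \<le> real k * v" if "k \<le> n" for k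
    using that
  proof (induction k)
    case 0
    then show ?case by (simp add: S_def)
  next
    case (Suc k)
    then have k: "k < n" "k \<le> n" and IH: "integrable M (\<lambda>\<omega>. (S \<omega> k)\<^sup>2)" "expectation (\<lambda>\<omega>. (S \<omega> k)\<^sup>2) \<le> real k * v"
      by auto
    have S_int: "integrable M (\<lambda>\<omega>. S \<omega> k)"
      by (rule Bochner_Integration.integrable_bound[of _ "\<lambda>\<omega>. 1 + (S \<omega> k)\<^sup>2"])
        (use IH(1) past_M[OF S_past] k le_sq in auto)
    have Z_past: "(\<lambda>\<omega>. 2 * S \<omega> k * \<phi> k \<omega>) \<in> borel_measurable (past \<xi> k)"
      using S_past[of k] \<phi>(1)[of k] k by measurable
    have Z_int: "integrable M (\<lambda>\<omega>. 2 * S \<omega> k * \<phi> k \<omega>)"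
      by (rule Bochner_Integration.integrable_bound[of _ "\<lambda>\<omega>. 2 * S \<omega> k"])
        (use S_int past_M[OF Z_past] k \<phi>(2) in \<open>auto simp: abs_mult mult_left_le\<close>)
    note cross = expectation_past_mult[OF ind k(1) Z_past Z_int int(1)[OF k(1)]]
    have \<phi>_sq: "(\<phi> k \<omega>)\<^sup>2 \<le> 1" for \<omega> using \<phi>(2) by (simp add: abs_square_le_1)
    have Q_int: "integrable M (\<lambda>\<omega>. (\<xi> k \<omega> $ i * \<phi> k \<omega>)\<^sup>2)"
      by (rule Bochner_Integration.integrable_bound[OF sq(1)[OF k(1)]])
        (use borel_measurable_integrable[OF int(1)[OF k(1)]] past_M[OF \<phi>(1)[OF k(1)]] k \<phi>_sq
          in \<open>auto simp: power_mult_distrib mult_left_le\<close>)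
    have "expectation (\<lambda>\<omega>. (\<xi> k \<omega> $ i * \<phi> k \<omega>)\<^sup>2) \<le> expectation (\<lambda>\<omega>. (\<xi> k \<omega> $ i)\<^sup>2)"
      using Q_int sq(1)[OF k(1)] \<phi>_sq by (intro integral_mono) (auto simp: power_mult_distrib mult_left_le)
    also have "\<dots> \<le> v" by (rule sq(2)[OF k(1)])
    finally have Q: "expectation (\<lambda>\<omega>. (\<xi> k \<omega> $ i * \<phi> k \<omega>)\<^sup>2) \<le> v" .
    have eq: "(\<lambda>\<omega>. (S \<omega> (Suc k))\<^sup>2) = (\<lambda>\<omega>. (S \<omega> k)\<^sup>2 + 2 * S \<omega> k * \<phi> k \<omega> * (\<xi> k \<omega> $ i) + (\<xi> k \<omega> $ i * \<phi> k \<omega>)\<^sup>2)"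
      by (auto simp: S_def power2_sum)
    show ?case
      unfolding eq using IH Q_int Q cross int(2)[OF k(1)]
      by (simp add: distrib_right)
  qed
  have S_int: "integrable M (\<lambda>\<omega>. S \<omega> k)" if "k \<le> n" for k
    by (rule Bochner_Integration.integrable_bound[of _ "\<lambda>\<omega>. 1 + (S \<omega> k)\<^sup>2"])
      (use S_sq past_M[OF S_past] that le_sq in auto)
  have max_past: "(\<lambda>\<omega>. running_max (S \<omega>) k) \<in> borel_measurable (past \<xi> k)" if "k \<le> n" for k
    by (intro measurable_running_max) (use that in \<open>auto intro: past_mono[OF S_past]\<close>)
  have max_int: "integrable M (\<lambda>\<omega>. running_max (S \<omega>) k)" if "k \<le> n" for k
    by (rule Bochner_Integration.integrable_bound[of _ "\<lambda>\<omega>. \<Sum>j\<le>k. \<bar>S \<omega> j\<bar>"])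
      (use S_int past_M[OF max_past] that running_max_le_sum running_max_nonneg in \<open>auto simp: abs_of_nonneg sum_nonneg\<close>)
  \<comment> \<open>All factors of \<open>\<xi> k \<omega> $ i\<close> in the correction term. They
    involve only indices below \<open>k\<close>, and a first moment of the maximum is enough, since
    independence makes the product with \<open>\<xi> k\<close> integrable.\<close>
  define Z where "Z = (\<lambda>k \<omega>. running_max (S \<omega>) k * (sgn (S \<omega> k) * \<phi> k \<omega>))"
  have Z_past: "Z k \<in> borel_measurable (past \<xi> k)" if "k < n" for k
  proof -
    have [measurable]: "(\<lambda>\<omega>. running_max (S \<omega>) k) \<in> borel_measurable (past \<xi> k)"
      "(\<lambda>\<omega>. S \<omega> k) \<in> borel_measurable (past \<xi> k)" "\<phi> k \<in> borel_measurable (past \<xi> k)"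
      using max_past[of k] S_past[of k] \<phi>(1)[OF that] that by simp_all
    show ?thesis unfolding Z_def sgn_if by measurable
  qed
  have Z_int: "integrable M (Z k)" if "k < n" for k
  proof (rule Bochner_Integration.integrable_bound[OF max_int[of k]])
    have "\<bar>sgn (S \<omega> k) * \<phi> k \<omega>\<bar> \<le> 1" for \<omega>
      using \<phi>(2)[of k \<omega>] by (auto simp: abs_mult sgn_if)
    then show "AE \<omega> in M. norm (Z k \<omega>) \<le> norm (running_max (S \<omega>) k)"
      unfolding Z_def real_norm_def abs_mult[of "running_max _ _"] by (intro AE_I2 mult_left_le) auto
  qed (use that past_M[OF Z_past] in auto)
  note cross = expectation_past_mult[OF ind _ Z_past Z_int int(1)]
  define D where "D = (\<lambda>\<omega>. 1 + (4 * (S \<omega> n)\<^sup>2 - 4 * (\<Sum>k<n. Z k \<omega> * (\<xi> k \<omega> $ i))))"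
  have D: "running_max (S \<omega>) n \<le> D \<omega>" for \<omega>
  proof -
    have "running_max (S \<omega>) n \<le> 1 + (running_max (S \<omega>) n)\<^sup>2"
      using le_sq running_max_nonneg by (metis abs_of_nonneg)
    also have "\<dots> \<le> D \<omega>"
      using running_max_sq_le[of "S \<omega>" n] by (simp add: D_def Z_def S_def mult_ac)
    finally show ?thesis .
  qed
  have D_int: "integrable M D"
    unfolding D_def using S_sq[of n] cross(1)
    by (intro Bochner_Integration.integrable_add Bochner_Integration.integrable_diff
        integrable_mult_right Bochner_Integration.integrable_sum) auto
  have T_int: "integrable M (\<lambda>\<omega>. \<Sum>k<n. Z k \<omega> * (\<xi> k \<omega> $ i))"
    using cross(1) by (intro Bochner_Integration.integrable_sum) auto
  have "expectation (\<lambda>\<omega>. \<Sum>k<n. Z k \<omega> * (\<xi> k \<omega> $ i)) = (\<Sum>k<n. expectation (\<lambda>\<omega>. Z k \<omega> * (\<xi> k \<omega> $ i)))"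
    using cross(1) by (intro Bochner_Integration.integral_sum) auto
  also have "\<dots> = 0" using cross(2) int(2) by simp
  finally have "expectation D = 1 + 4 * expectation (\<lambda>\<omega>. (S \<omega> n)\<^sup>2)"
    unfolding D_def using S_sq[of n] T_int by (simp add: prob_space)
  also have "\<dots> \<le> 1 + 4 * (real n * v)" using S_sq[of n] by simp
  finally have ED: "expectation D \<le> 1 + 4 * (real n * v)" .
  have "(\<integral>\<^sup>+\<omega>. ennreal (running_max (S \<omega>) n) \<partial>M) \<le> (\<integral>\<^sup>+\<omega>. ennreal (D \<omega>) \<partial>M)"
    by (intro nn_integral_mono ennreal_leI D)
  also have "\<dots> = ennreal (expectation D)"
    by (intro nn_integral_eq_integral D_int AE_I2 order_trans[OF running_max_nonneg D])
  also have "\<dots> \<le> ennreal (1 + 4 * (real n * v))" by (intro ennreal_leI ED)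
  finally show ?thesis by (simp add: S_def)
qed

end

section \<open>Gaussian increments\<close>

lemma Basis_real_vec: "(Basis :: (real ^ 'n::finite) set) = range (\<lambda>i. axis i 1)"
  by (auto simp: Basis_vec_def)

lemma nn_integral_lborel_vec_prod:
  fixes f :: "'n::finite \<Rightarrow> real \<Rightarrow> ennreal"
  assumes [measurable]: "\<And>i. f i \<in> borel_measurable borel"
  shows "(\<integral>\<^sup>+x. (\<Prod>i\<in>UNIV. f i (x $ i)) \<partial>lborel) = (\<Prod>i\<in>UNIV. \<integral>\<^sup>+x. f i x \<partial>lborel)"
proof -
  \<comment> \<open>The product formula is indexed by \<open>Basis\<close>; \<open>the_inv\<close>
    recovers the coordinate from its unit vector.\<close>
  define h where "h = (\<lambda>b :: real ^ 'n. f (the_inv (\<lambda>i. axis i 1) b))"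
  have inj: "inj (\<lambda>i :: 'n. axis i (1::real))"
    by (auto simp: inj_on_def axis_eq_axis)
  have h_axis: "h (axis i 1) = f i" for i
    unfolding h_def using the_inv_f_f[OF inj] by simp
  have "(\<integral>\<^sup>+x. (\<Prod>b\<in>Basis. h b (x \<bullet> b)) \<partial>lborel) = (\<Prod>b\<in>Basis. \<integral>\<^sup>+x. h b x \<partial>lborel)"
    by (rule nn_integral_lborel_prod) (auto simp: h_def)
  then show ?thesis
    unfolding Basis_real_vec by (simp add: prod.reindex[OF inj] h_axis inner_axis)
qed

context prob_space begin

lemma distributed_normal_component:
  fixes X :: "'a \<Rightarrow> real ^ 'n::finite"
  assumes X: "distributed M lborel X (\<lambda>x. ennreal (\<Prod>i\<in>UNIV. normal_density 0 s (x $ i)))" and "s > 0"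
  shows "distributed M lborel (\<lambda>\<omega>. X \<omega> $ i) (normal_density 0 s)"
proof -
  have X_meas: "X \<in> borel_measurable M"
    using distributed_measurable[OF X] by simp
  have Xi_meas: "(\<lambda>\<omega>. X \<omega> $ i) \<in> borel_measurable M"
    by (rule measurable_compose[OF X_meas]) simp
  have one: "(\<integral>\<^sup>+x. ennreal (normal_density 0 s x) \<partial>lborel) = 1"
    using prob_space.emeasure_space_1[OF prob_space_normal_density[OF \<open>s > 0\<close>, of 0]]
    by (simp add: emeasure_density)
  have "distr M lborel (\<lambda>\<omega>. X \<omega> $ i) = density lborel (\<lambda>x. ennreal (normal_density 0 s x))"
  proof (rule measure_eqI)
    fix A assume "A \<in> sets (distr M lborel (\<lambda>\<omega>. X \<omega> $ i))"
    then have A[measurable]: "A \<in> sets borel" by simp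
    \<comment> \<open>The indicator is absorbed into coordinate \<open>i\<close>; each other
      coordinate then integrates to 1.\<close>
    define f where "f = (\<lambda>j x. ennreal (normal_density 0 s x) * (if j = i then indicator A x else 1))"
    have f_meas: "f j \<in> borel_measurable borel" for j
      unfolding f_def by measurable
    have "emeasure (distr M lborel (\<lambda>\<omega>. X \<omega> $ i)) A
        = (\<integral>\<^sup>+x. indicator A x \<partial>distr M lborel (\<lambda>\<omega>. X \<omega> $ i))"
      by simp
    also have "\<dots> = (\<integral>\<^sup>+\<omega>. indicator A (X \<omega> $ i) \<partial>M)"
      by (intro nn_integral_distr) (simp_all add: Xi_meas)
    also have "\<dots> = (\<integral>\<^sup>+x. ennreal (\<Prod>j\<in>UNIV. normal_density 0 s (x $ j)) * indicator A (x $ i) \<partial>lborel)"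
      by (rule distributed_nn_integral[OF X, symmetric]) measurable
    also have "\<dots> = (\<integral>\<^sup>+x. (\<Prod>j\<in>UNIV. f j (x $ j)) \<partial>lborel)"
      by (intro nn_integral_cong) (simp add: f_def prod.distrib prod.delta prod_ennreal)
    also have "\<dots> = (\<Prod>j\<in>UNIV. \<integral>\<^sup>+x. f j x \<partial>lborel)"
      by (rule nn_integral_lborel_vec_prod[OF f_meas])
    also have "\<dots> = (\<Prod>j\<in>UNIV. if j = i then \<integral>\<^sup>+x. f i x \<partial>lborel else 1)"
      by (intro prod.cong) (auto simp: f_def one)
    also have "\<dots> = emeasure (density lborel (\<lambda>x. ennreal (normal_density 0 s x))) A"
      using A by (simp add: prod.delta f_def emeasure_density)
    finally show "emeasure (distr M lborel (\<lambda>\<omega>. X \<omega> $ i)) A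
       = emeasure (density lborel (\<lambda>x. ennreal (normal_density 0 s x))) A" .
  qed simp
  then show ?thesis
    unfolding distributed_def using Xi_meas by simp
qed

lemma normal_component_moments:
  fixes X :: "'a \<Rightarrow> real ^ 'n::finite"
  assumes X: "distributed M lborel X (\<lambda>x. ennreal (\<Prod>i\<in>UNIV. normal_density 0 s (x $ i)))" and s: "s > 0"
  shows "integrable M (\<lambda>\<omega>. X \<omega> $ i)" "expectation (\<lambda>\<omega>. X \<omega> $ i) = 0"
    "integrable M (\<lambda>\<omega>. (X \<omega> $ i)\<^sup>2)" "expectation (\<lambda>\<omega>. (X \<omega> $ i)\<^sup>2) = s\<^sup>2"
proof -
  note D = distributed_normal_component[OF X s, of i]
  show "integrable M (\<lambda>\<omega>. X \<omega> $ i)"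
    using distributed_integrable_var[OF D] integrable_normal_moment_nz_1[OF s] by simp
  show E: "expectation (\<lambda>\<omega>. X \<omega> $ i) = 0"
    by (rule normal_distributed_expectation[OF s D])
  show "integrable M (\<lambda>\<omega>. (X \<omega> $ i)\<^sup>2)"
    using distributed_integrable[OF D, of "\<lambda>x. x\<^sup>2"] integrable_normal_moment[OF s, of 0 2] by simp
  show "expectation (\<lambda>\<omega>. (X \<omega> $ i)\<^sup>2) = s\<^sup>2"
    using normal_distributed_variance[OF s D] by (simp add: E)
qed

lemma linear_image_moments:
  fixes X :: "'a \<Rightarrow> real ^ 'r::finite" and \<sigma> :: "real ^ 'r ^ 'd::finite"
  assumes X: "distributed M lborel X (\<lambda>x. ennreal (\<Prod>i\<in>UNIV. normal_density 0 s (x $ i)))" and s: "s > 0"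
  defines "K \<equiv> (onorm ((*v) \<sigma>))\<^sup>2 * real CARD('r)"
  shows "integrable M (\<lambda>\<omega>. (\<sigma> *v X \<omega>) $ i)" "expectation (\<lambda>\<omega>. (\<sigma> *v X \<omega>) $ i) = 0"
    "integrable M (\<lambda>\<omega>. ((\<sigma> *v X \<omega>) $ i)\<^sup>2)" "expectation (\<lambda>\<omega>. ((\<sigma> *v X \<omega>) $ i)\<^sup>2) \<le> K * s\<^sup>2"
    "integrable M (\<lambda>\<omega>. (norm (\<sigma> *v X \<omega>))\<^sup>2)" "expectation (\<lambda>\<omega>. (norm (\<sigma> *v X \<omega>))\<^sup>2) \<le> K * s\<^sup>2"
proof -
  note mom = normal_component_moments[OF X s]
  have X_meas[measurable]: "X \<in> borel_measurable M"
    using distributed_measurable[OF X] by simp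
  have meas: "(\<lambda>\<omega>. \<sigma> *v X \<omega>) \<in> borel_measurable M"
    by (intro measurable_compose[OF X_meas] borel_measurable_continuous_onI linear_continuous_on
        matrix_vector_mul_bounded_linear)
  show "integrable M (\<lambda>\<omega>. (\<sigma> *v X \<omega>) $ i)" "expectation (\<lambda>\<omega>. (\<sigma> *v X \<omega>) $ i) = 0"
    using mom(1,2) by (simp_all add: matrix_vector_mult_def)
  have le: "(norm (\<sigma> *v v))\<^sup>2 \<le> (onorm ((*v) \<sigma>))\<^sup>2 * (\<Sum>j\<in>UNIV. (v $ j)\<^sup>2)" for v
  proof -
    have "norm (\<sigma> *v v) \<le> onorm ((*v) \<sigma>) * norm v"
      by (intro onorm matrix_vector_mul_bounded_linear)
    then have "(norm (\<sigma> *v v))\<^sup>2 \<le> (onorm ((*v) \<sigma>) * norm v)\<^sup>2"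
      by (intro power_mono) auto
    then show ?thesis
      by (simp add: power_mult_distrib norm_vec_def L2_set_def sum_nonneg)
  qed
  have dom: "integrable M (\<lambda>\<omega>. (onorm ((*v) \<sigma>))\<^sup>2 * (\<Sum>j\<in>UNIV. (X \<omega> $ j)\<^sup>2))"
    using mom(3) by simp
  show int: "integrable M (\<lambda>\<omega>. (norm (\<sigma> *v X \<omega>))\<^sup>2)"
    using le meas by (intro Bochner_Integration.integrable_bound[OF dom]) (auto simp: sum_nonneg)
  have "expectation (\<lambda>\<omega>. (norm (\<sigma> *v X \<omega>))\<^sup>2)
      \<le> expectation (\<lambda>\<omega>. (onorm ((*v) \<sigma>))\<^sup>2 * (\<Sum>j\<in>UNIV. (X \<omega> $ j)\<^sup>2))"
    by (intro integral_mono int dom le)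
  also have "\<dots> = K * s\<^sup>2"
    using mom(3,4) by (simp add: K_def)
  finally show E: "expectation (\<lambda>\<omega>. (norm (\<sigma> *v X \<omega>))\<^sup>2) \<le> K * s\<^sup>2" .
  have comp: "((\<sigma> *v X \<omega>) $ i)\<^sup>2 \<le> (norm (\<sigma> *v X \<omega>))\<^sup>2" for \<omega>
    by (intro iffD1[OF abs_le_square_iff]) (simp add: component_le_norm_cart)
  have meas_i: "(\<lambda>\<omega>. ((\<sigma> *v X \<omega>) $ i)\<^sup>2) \<in> borel_measurable M"
    by (intro borel_measurable_power measurable_compose[OF meas]) simp
  show int_i: "integrable M (\<lambda>\<omega>. ((\<sigma> *v X \<omega>) $ i)\<^sup>2)"
    using comp meas_i by (intro Bochner_Integration.integrable_bound[OF int]) auto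
  have "expectation (\<lambda>\<omega>. ((\<sigma> *v X \<omega>) $ i)\<^sup>2) \<le> expectation (\<lambda>\<omega>. (norm (\<sigma> *v X \<omega>))\<^sup>2)"
    by (intro integral_mono int int_i comp)
  with E show "expectation (\<lambda>\<omega>. ((\<sigma> *v X \<omega>) $ i)\<^sup>2) \<le> K * s\<^sup>2" by linarith
qed

end

section \<open>Poisson random measures and the jump part\<close>

context prob_space begin

text \<open>For finite intensity the Poisson weights satisfy (k + 1) p (k + 1) = r p k, so their
  mean is again r.\<close>

lemma poisson_mean_le:
  assumes N: "poisson_random_measure \<mu> N" and A: "A \<in> sets \<mu>"
  shows "(\<integral>\<^sup>+\<omega>. emeasure (N \<omega>) A \<partial>M) \<le> emeasure \<mu> A"
proof (cases "emeasure \<mu> A = \<infinity>")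
  case False
  then have fin: "emeasure \<mu> A < \<infinity>" by (simp add: top.not_eq_extremum)
  define r where "r = measure \<mu> A"
  define p where "p = (\<lambda>k. r ^ k / fact k * exp (- r))"
  define E where "E = (\<lambda>k::nat. {\<omega> \<in> space M. emeasure (N \<omega>) A = of_nat k})"
  have [measurable]: "(\<lambda>\<omega>. emeasure (N \<omega>) A) \<in> borel_measurable M"
    using N A by (auto simp: poisson_random_measure_def)
  have E_sets[measurable]: "E k \<in> events" for k
    unfolding E_def by measurable
  have p: "prob (E k) = p k" for k
    using N A fin by (auto simp: poisson_random_measure_def E_def p_def r_def)
  have "r \<ge> 0" by (simp add: r_def)
  have p_eq: "p = (\<lambda>k. r ^ k /\<^sub>R fact k * exp (- r))"
    by (auto simp: p_def divide_inverse mult_ac)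
  have p_sums: "p sums 1"
    using sums_mult2[OF exp_converges[of r], of "exp (- r)"] by (simp add: p_eq flip: exp_add)
  have "disjoint_family E" by (auto simp: disjoint_family_on_def E_def)
  then have "(\<lambda>k. prob (E k)) sums prob (\<Union>k. E k)"
    by (intro finite_measure_UNION) auto
  then have "prob (\<Union>k. E k) = 1"
    using p_sums sums_unique2 unfolding p by blast
  \<comment> \<open>The weights of the finite values already sum to 1, which rules out the value
    \<infinity> almost surely.\<close>
  then have AE: "AE \<omega> in M. \<omega> \<in> (\<Union>k. E k)"
    by (subst AE_in_set_eq_1) auto
  have "(\<lambda>k. real (Suc k) * p (Suc k)) = (\<lambda>k. r * p k)"
    by (auto simp: p_def field_simps simp del: of_nat_Suc)
  then have "(\<lambda>k. real (Suc k) * p (Suc k)) sums r"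
    using sums_mult[OF p_sums, of r] by simp
  then have mean: "(\<lambda>k. real k * p k) sums r"
    using sums_Suc[of "\<lambda>k. real k * p k"] by simp
  have "(\<integral>\<^sup>+\<omega>. emeasure (N \<omega>) A \<partial>M) = (\<integral>\<^sup>+\<omega>. (\<Sum>k. ennreal (real k) * indicator (E k) \<omega>) \<partial>M)"
  proof (rule nn_integral_cong_AE, use AE in eventually_elim)
    case (elim \<omega>)
    then obtain k where k: "\<omega> \<in> E k" by auto
    have "(\<Sum>j. ennreal (real j) * indicator (E j) \<omega>) = (\<Sum>j\<in>{k}. ennreal (real j) * indicator (E j) \<omega>)"
      using k by (intro suminf_finite) (auto simp: E_def split: split_indicator)
    also have "\<dots> = emeasure (N \<omega>) A"
      using k by (simp add: E_def ennreal_of_nat_eq_real_of_nat)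
    finally show ?case by simp
  qed
  also have "\<dots> = (\<Sum>k. \<integral>\<^sup>+\<omega>. ennreal (real k) * indicator (E k) \<omega> \<partial>M)"
    by (intro nn_integral_suminf) measurable
  also have "\<dots> = (\<Sum>k. ennreal (real k * p k))"
    by (simp add: nn_integral_cmult emeasure_eq_measure p ennreal_mult')
  also have "\<dots> = ennreal r"
    using mean \<open>r \<ge> 0\<close> by (intro suminf_ennreal_eq) (auto simp: p_def)
  also have "\<dots> = emeasure \<mu> A"
    using fin by (simp add: r_def emeasure_eq_ennreal_measure)
  finally show ?thesis by simp
qed simp

text \<open>One half of Campbell's formula, by induction over nonnegative measurable functions.
  Measurability in \<omega> is part of the claim because the steps for sums, multiples and suprema
  use it for the smaller functions.\<close>

lemma campbell_le:
  assumes N: "poisson_random_measure \<mu> N" and g: "g \<in> borel_measurable \<mu>"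
  shows "(\<lambda>\<omega>. \<integral>\<^sup>+p. g p \<partial>N \<omega>) \<in> borel_measurable M \<and>
    (\<integral>\<^sup>+\<omega>. (\<integral>\<^sup>+p. g p \<partial>N \<omega>) \<partial>M) \<le> (\<integral>\<^sup>+p. g p \<partial>\<mu>)"
proof -
  have sets_N: "sets (N \<omega>) = sets \<mu>" if "\<omega> \<in> space M" for \<omega>
    using N that by (auto simp: poisson_random_measure_def)
  have meas_N: "f \<in> borel_measurable (N \<omega>)" if "f \<in> borel_measurable \<mu>" "\<omega> \<in> space M"
    for f :: "_ \<Rightarrow> ennreal" and \<omega>
    using that measurable_cong_sets[OF sets_N[OF that(2)] refl] by blast
  show ?thesis
    using g
  proof (induction rule: borel_measurable_induct)
    case (cong f g)
    have "(\<integral>\<^sup>+p. f p \<partial>N \<omega>) = (\<integral>\<^sup>+p. g p \<partial>N \<omega>)" if "\<omega> \<in> space M" for \<omega>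
      using cong(3) sets_eq_imp_space_eq[OF sets_N[OF that]] by (intro nn_integral_cong) auto
    moreover have "(\<integral>\<^sup>+p. f p \<partial>\<mu>) = (\<integral>\<^sup>+p. g p \<partial>\<mu>)"
      using cong(3) by (intro nn_integral_cong) auto
    ultimately show ?case
      using cong(4) by (simp cong: measurable_cong nn_integral_cong)
  next
    case (set A)
    have "(\<integral>\<^sup>+p. indicator A p \<partial>N \<omega>) = emeasure (N \<omega>) A" if "\<omega> \<in> space M" for \<omega>
      using set sets_N[OF that] by simp
    moreover have "(\<lambda>\<omega>. emeasure (N \<omega>) A) \<in> borel_measurable M"
      using N set by (auto simp: poisson_random_measure_def)
    ultimately show ?case
      using poisson_mean_le[OF N set] set by (simp cong: measurable_cong nn_integral_cong)
  next
    case (mult f c)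
    have eq: "(\<integral>\<^sup>+p. c * f p \<partial>N \<omega>) = c * (\<integral>\<^sup>+p. f p \<partial>N \<omega>)" if "\<omega> \<in> space M" for \<omega>
      using mult(2) that by (intro nn_integral_cmult meas_N)
    have "(\<integral>\<^sup>+\<omega>. (\<integral>\<^sup>+p. c * f p \<partial>N \<omega>) \<partial>M) = c * (\<integral>\<^sup>+\<omega>. (\<integral>\<^sup>+p. f p \<partial>N \<omega>) \<partial>M)"
      using mult by (simp add: eq nn_integral_cmult cong: nn_integral_cong)
    also have "\<dots> \<le> (\<integral>\<^sup>+p. c * f p \<partial>\<mu>)"
      using mult by (simp add: nn_integral_cmult mult_left_mono)
    finally have "(\<integral>\<^sup>+\<omega>. (\<integral>\<^sup>+p. c * f p \<partial>N \<omega>) \<partial>M) \<le> (\<integral>\<^sup>+p. c * f p \<partial>\<mu>)" .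
    moreover have "(\<lambda>\<omega>. c * (\<integral>\<^sup>+p. f p \<partial>N \<omega>)) \<in> borel_measurable M"
      using mult by (intro borel_measurable_times_ennreal) auto
    ultimately show ?case
      by (simp add: eq cong: measurable_cong)
  next
    case (add u v)
    have eq: "(\<integral>\<^sup>+p. v p + u p \<partial>N \<omega>) = (\<integral>\<^sup>+p. v p \<partial>N \<omega>) + (\<integral>\<^sup>+p. u p \<partial>N \<omega>)" if "\<omega> \<in> space M" for \<omega>
      using add that by (intro nn_integral_add meas_N)
    have "(\<integral>\<^sup>+\<omega>. (\<integral>\<^sup>+p. v p + u p \<partial>N \<omega>) \<partial>M)
        = (\<integral>\<^sup>+\<omega>. (\<integral>\<^sup>+p. v p \<partial>N \<omega>) \<partial>M) + (\<integral>\<^sup>+\<omega>. (\<integral>\<^sup>+p. u p \<partial>N \<omega>) \<partial>M)"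
      using add by (simp add: eq nn_integral_add cong: nn_integral_cong)
    also have "\<dots> \<le> (\<integral>\<^sup>+p. v p \<partial>\<mu>) + (\<integral>\<^sup>+p. u p \<partial>\<mu>)"
      using add by (intro add_mono) auto
    also have "\<dots> = (\<integral>\<^sup>+p. v p + u p \<partial>\<mu>)"
      using add by (intro nn_integral_add[symmetric]) auto
    finally have "(\<integral>\<^sup>+\<omega>. (\<integral>\<^sup>+p. v p + u p \<partial>N \<omega>) \<partial>M) \<le> (\<integral>\<^sup>+p. v p + u p \<partial>\<mu>)" .
    moreover have "(\<lambda>\<omega>. (\<integral>\<^sup>+p. v p \<partial>N \<omega>) + (\<integral>\<^sup>+p. u p \<partial>N \<omega>)) \<in> borel_measurable M"
      using add by (intro borel_measurable_add) auto
    ultimately show ?case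
      by (simp add: eq cong: measurable_cong)
  next
    case (seq U)
    have sup_eq: "(\<integral>\<^sup>+p. (SUP i. U i) p \<partial>m) = (SUP i. \<integral>\<^sup>+p. U i p \<partial>m)"
      if "\<And>i. U i \<in> borel_measurable m" for m
    proof -
      have "(SUP i. U i) p = (SUP i. U i p)" for p by (rule SUP_apply)
      then show ?thesis
        using nn_integral_monotone_convergence_SUP[OF \<open>incseq U\<close> that] by simp
    qed
    have eq: "(\<integral>\<^sup>+p. (SUP i. U i) p \<partial>N \<omega>) = (SUP i. \<integral>\<^sup>+p. U i p \<partial>N \<omega>)" if "\<omega> \<in> space M" for \<omega>
      using seq(1) that by (intro sup_eq meas_N)
    have inc: "incseq (\<lambda>i \<omega>. \<integral>\<^sup>+p. U i p \<partial>N \<omega>)"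
      using \<open>incseq U\<close> by (auto simp: incseq_def le_fun_def intro!: nn_integral_mono)
    have "(\<integral>\<^sup>+\<omega>. (\<integral>\<^sup>+p. (SUP i. U i) p \<partial>N \<omega>) \<partial>M) = (\<integral>\<^sup>+\<omega>. (SUP i. \<integral>\<^sup>+p. U i p \<partial>N \<omega>) \<partial>M)"
      by (intro nn_integral_cong eq)
    also have "\<dots> = (SUP i. \<integral>\<^sup>+\<omega>. (\<integral>\<^sup>+p. U i p \<partial>N \<omega>) \<partial>M)"
      using seq.IH by (intro nn_integral_monotone_convergence_SUP inc) auto
    also have "\<dots> \<le> (\<integral>\<^sup>+p. (SUP i. U i) p \<partial>\<mu>)"
      unfolding sup_eq[OF seq(1)] using seq.IH by (intro SUP_mono) auto
    finally have "(\<integral>\<^sup>+\<omega>. (\<integral>\<^sup>+p. (SUP i. U i) p \<partial>N \<omega>) \<partial>M) \<le> (\<integral>\<^sup>+p. (SUP i. U i) p \<partial>\<mu>)" .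
    moreover have "(\<lambda>\<omega>. SUP i. \<integral>\<^sup>+p. U i p \<partial>N \<omega>) \<in> borel_measurable M"
      using seq.IH by (intro borel_measurable_SUP) auto
    ultimately show ?case
      by (simp only: eq cong: measurable_cong)
  qed
qed

end

text \<open>Markov's inequality makes the sets where the norm is at least 1 / (m + 1) finite in
  measure; with the null set \<open>{0}\<close> they cover the space. This is what Tonelli needs for
  \<open>jump_intensity\<close>.\<close>

lemma sigma_finite_first_moment:
  fixes \<nu> :: "'b::{real_normed_vector, second_countable_topology} measure"
  assumes "sets \<nu> = sets borel" "emeasure \<nu> {0} = 0" "(\<integral>\<^sup>+z. ennreal (norm z) \<partial>\<nu>) < \<infinity>"
  shows "sigma_finite_measure \<nu>"
proof
  let ?A = "\<lambda>m::nat. {z \<in> space \<nu>. 1 \<le> ennreal (real (Suc m)) * ennreal (norm z)}"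
  have [measurable]: "(\<lambda>z. ennreal (norm z)) \<in> borel_measurable \<nu>"
    by (simp add: measurable_cong_sets[OF assms(1) refl])
  have fin: "emeasure \<nu> (?A m) < \<infinity>" for m
  proof -
    have "emeasure \<nu> (?A m) \<le> emeasure \<nu> ({z \<in> space \<nu>. 1 \<le> ennreal (real (Suc m)) * ennreal (norm z)} \<inter> space \<nu>)"
      by (intro emeasure_mono) auto
    also have "\<dots> \<le> ennreal (real (Suc m)) * (\<integral>\<^sup>+z. ennreal (norm z) * indicator (space \<nu>) z \<partial>\<nu>)"
      by (rule order_trans[OF _ nn_integral_Markov_inequality]) (auto intro!: emeasure_mono)
    also have "(\<integral>\<^sup>+z. ennreal (norm z) * indicator (space \<nu>) z \<partial>\<nu>) = (\<integral>\<^sup>+z. ennreal (norm z) \<partial>\<nu>)"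
      by (intro nn_integral_cong) auto
    also have "ennreal (real (Suc m)) * (\<integral>\<^sup>+z. ennreal (norm z) \<partial>\<nu>) < \<infinity>"
      using assms(3) by (simp add: ennreal_mult_less_top del: of_nat_Suc)
    finally show ?thesis .
  qed
  have space: "space \<nu> = UNIV" using sets_eq_imp_space_eq[OF assms(1)] by simp
  have cover: "\<Union> (insert {0} (range ?A)) = space \<nu>"
  proof -
    have "z \<in> \<Union> (range ?A)" if "z \<noteq> 0" for z
    proof -
      obtain m where "inverse (real (Suc m)) < norm z"
        using reals_Archimedean[of "norm z"] \<open>z \<noteq> 0\<close> unfolding zero_less_norm_iff by blast
      then have "1 \<le> real (Suc m) * norm z" by (simp add: field_simps)
      then have "1 \<le> ennreal (real (Suc m)) * ennreal (norm z)"
        by (metis ennreal_1 ennreal_leI ennreal_mult' of_nat_0_le_iff)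
      then have "z \<in> ?A m" by (simp add: space)
      then show ?thesis by (rule UN_I[OF UNIV_I])
    qed
    then have "z \<in> {0} \<union> \<Union> (range ?A)" for z by (cases "z = 0") simp_all
    then have "{0} \<union> \<Union> (range ?A) = UNIV" by (rule UNIV_eq_I[symmetric])
    then show ?thesis unfolding Union_insert space .
  qed
  have sets: "insert {0} (range ?A) \<subseteq> sets \<nu>"
  proof -
    have "?A m \<in> sets \<nu>" for m
      by (rule borel_measurable_le[OF borel_measurable_const borel_measurable_times_ennreal[OF borel_measurable_const]]) fact
    moreover have "{0} \<in> sets \<nu>" using assms(1) by simp
    ultimately show ?thesis by blast
  qed
  have finite: "\<forall>a\<in>insert {0} (range ?A). emeasure \<nu> a \<noteq> \<infinity>"
  proof
    fix a assume "a \<in> insert {0} (range ?A)"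
    then consider "a = {0}" | m where "a = ?A m" by blast
    then show "emeasure \<nu> a \<noteq> \<infinity>"
    proof cases
      case (2 m)
      then show ?thesis using fin[of m] by (metis less_irrefl)
    qed (use assms(2) in simp)
  qed
  have "countable (insert {0} (range ?A))" by simp
  with sets cover finite
  show "\<exists>A. countable A \<and> A \<subseteq> sets \<nu> \<and> \<Union> A = space \<nu> \<and> (\<forall>a\<in>A. emeasure \<nu> a \<noteq> \<infinity>)"
    by meson
qed

text \<open>The time window has length 1, so Tonelli reduces the integral to the first moment of the
  jump measure.\<close>

lemma jump_intensity_moment:
  fixes \<nu> :: "(real ^ 'd::finite) measure"
  assumes \<nu>: "levy_measure \<nu>" "(\<integral>\<^sup>+z. ennreal (norm z) \<partial>\<nu>) < \<infinity>"
  shows "(\<lambda>p. ennreal (norm (snd p)) * indicator ({0<..1} \<times> UNIV) p) \<in> borel_measurable (jump_intensity \<nu>)" (is ?meas)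
    and "(\<integral>\<^sup>+p. ennreal (norm (snd p)) * indicator ({0<..1} \<times> UNIV) p \<partial>jump_intensity \<nu>) < \<infinity>" (is ?fin)
    and "\<And>u D. u \<ge> 0 \<Longrightarrow> D \<in> sets borel \<Longrightarrow> {u<..v} \<times> D \<in> sets (jump_intensity \<nu>)"
    and "snd \<in> borel_measurable (jump_intensity \<nu>)"
proof -
  have sets_\<nu>: "sets \<nu> = sets borel" and "emeasure \<nu> {0} = 0"
    using \<nu> by (auto simp: levy_measure_def)
  interpret sigma_finite_measure \<nu>
    by (rule sigma_finite_first_moment) fact+
  let ?R = "restrict_space lborel {0::real..}"
  show rect: "{u<..v} \<times> D \<in> sets (jump_intensity \<nu>)" if "u \<ge> 0" "D \<in> sets borel" for u v D
    unfolding jump_intensity_def using that sets_\<nu>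
    by (intro pair_measureI) (auto simp: sets_restrict_space_iff)
  have snd_\<nu>: "snd \<in> measurable (jump_intensity \<nu>) \<nu>"
    unfolding jump_intensity_def by measurable
  then show snd: "snd \<in> borel_measurable (jump_intensity \<nu>)"
    using measurable_cong_sets[OF refl sets_\<nu>] by blast
  show meas: ?meas
    using rect[of 0 UNIV 1] snd by measurable
  have "(\<integral>\<^sup>+p. ennreal (norm (snd p)) * indicator ({0<..1} \<times> UNIV) p \<partial>jump_intensity \<nu>)
     = (\<integral>\<^sup>+t. \<integral>\<^sup>+z. ennreal (norm z) * indicator {0<..1} t \<partial>\<nu> \<partial>?R)"
    using meas unfolding jump_intensity_def
    by (subst nn_integral_fst[symmetric]) (auto intro!: nn_integral_cong split: split_indicator)
  also have "\<dots> = (\<integral>\<^sup>+t. (\<integral>\<^sup>+z. ennreal (norm z) \<partial>\<nu>) * indicator {0<..1} t \<partial>?R)"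
    by (intro nn_integral_cong nn_integral_multc) (simp add: measurable_cong_sets[OF sets_\<nu> refl])
  also have "\<dots> = (\<integral>\<^sup>+t. (\<integral>\<^sup>+z. ennreal (norm z) \<partial>\<nu>) * indicator {0<..1::real} t \<partial>lborel)"
    by (subst nn_integral_restrict_space) (auto intro!: nn_integral_cong split: split_indicator)
  also have "\<dots> = (\<integral>\<^sup>+z. ennreal (norm z) \<partial>\<nu>)"
    by (subst nn_integral_cmult) auto
  finally show ?fin using \<nu>(2) by simp
qed

text \<open>Both increments are integrals over \<open>{s<..t} \<times> D\<close>. Variation is
  expressed by a real function whose increments dominate, which adds up easily and avoids total
  variation.\<close>

lemma set_integral_increment_bound:
  fixes m :: "(real \<times> (real ^ 'd::finite)) measure"
  assumes int: "set_integrable m ({0<..1} \<times> UNIV) snd"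
    and rect: "\<And>u v. u \<ge> 0 \<Longrightarrow> {u<..v} \<times> D \<in> sets m"
    and st: "0 \<le> s" "s \<le> t" "t \<le> (1::real)"
  shows "norm ((LINT p:{0<..t} \<times> D|m. snd p) - (LINT p:{0<..s} \<times> D|m. snd p))
     \<le> (LINT p:{0<..t} \<times> D|m. norm (snd p)) - (LINT p:{0<..s} \<times> D|m. norm (snd p))"
proof -
  have un: "{0<..t} \<times> D = {0<..s} \<times> D \<union> {s<..t} \<times> D" and disj: "{0<..s} \<times> D \<inter> {s<..t} \<times> D = {}"
    using st by auto
  have sub: "set_integrable m ({0<..s} \<times> D) snd" "set_integrable m ({s<..t} \<times> D) snd"
    using st rect by (auto intro!: set_integrable_subset[OF int])
  have subn: "set_integrable m ({0<..s} \<times> D) (\<lambda>p. norm (snd p))" "set_integrable m ({s<..t} \<times> D) (\<lambda>p. norm (snd p))"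
    using set_integrable_norm[OF sub(1)] set_integrable_norm[OF sub(2)] by auto
  have "norm (LINT p:{s<..t} \<times> D|m. snd p) \<le> (LINT p:{s<..t} \<times> D|m. norm (snd p))"
    by (rule set_integral_norm_bound[OF sub(2)])
  then show ?thesis
    unfolding un using set_integral_Un[OF disj sub] set_integral_Un[OF disj subn] by simp
qed

text \<open>Everything in \<open>levy_ito\<close> that has finite variation, hence also the linear
  drift.\<close>

definition jump_part ::
    "real ^ 'd::finite \<Rightarrow> (real ^ 'd) measure \<Rightarrow> ('w \<Rightarrow> (real \<times> (real ^ 'd)) measure)
      \<Rightarrow> real \<Rightarrow> 'w \<Rightarrow> real ^ 'd" where
  "jump_part a \<nu> N t \<omega> = t *\<^sub>R a
     + compensated_integral (jump_intensity \<nu>) (N \<omega>) ({0<..t} \<times> {z. norm z \<le> 1}) snd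
     + (LINT p:{0<..t} \<times> {z. norm z > 1}|N \<omega>. snd p)"

lemma levy_ito_eq: "levy_ito a \<sigma> \<nu> B N t \<omega> = \<sigma> *v B t \<omega> + jump_part a \<nu> N t \<omega>"
  by (simp add: levy_ito_def jump_part_def algebra_simps)

lemma jump_part_0: "jump_part a \<nu> N 0 \<omega> = 0"
  by (simp add: jump_part_def compensated_integral_def set_lebesgue_integral_def)

text \<open>By Campbell's formula the jump sizes up to time 1 have finite expected sum, so almost
  every path sums them absolutely. The majorant \<open>H\<close> is chosen for each path, so it
  needs no measurability.\<close>

lemma (in prob_space) AE_jump_part_bounded_variation:
  fixes \<nu> :: "(real ^ 'd::finite) measure" and a :: "real ^ 'd"
  assumes \<nu>: "levy_measure \<nu>" "(\<integral>\<^sup>+z. ennreal (norm z) \<partial>\<nu>) < \<infinity>"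
    and N: "poisson_random_measure (jump_intensity \<nu>) N"
  shows "AE \<omega> in M. \<exists>H. \<forall>s t. 0 \<le> s \<longrightarrow> s \<le> t \<longrightarrow> t \<le> 1 \<longrightarrow>
    norm (jump_part a \<nu> N t \<omega> - jump_part a \<nu> N s \<omega>) \<le> H t - H s"
proof -
  let ?g = "\<lambda>p. ennreal (norm (snd p)) * indicator ({0<..1} \<times> UNIV) p :: ennreal"
  note \<mu> = jump_intensity_moment[OF \<nu>]
  have "(\<lambda>\<omega>. \<integral>\<^sup>+p. ?g p \<partial>N \<omega>) \<in> borel_measurable M"
    and "(\<integral>\<^sup>+\<omega>. (\<integral>\<^sup>+p. ?g p \<partial>N \<omega>) \<partial>M) \<noteq> \<infinity>"
    using campbell_le[OF N \<mu>(1)] \<mu>(2) by (auto simp: top_unique)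
  then have "AE \<omega> in M. (\<integral>\<^sup>+p. ?g p \<partial>N \<omega>) \<noteq> \<infinity>"
    by (rule nn_integral_PInf_AE)
  with AE_space show ?thesis
  proof eventually_elim
    case (elim \<omega>)
    have sets: "sets (N \<omega>) = sets (jump_intensity \<nu>)"
      using N elim(1) by (auto simp: poisson_random_measure_def)
    \<comment> \<open>Kept general in \<open>m\<close> because it serves both the random measure and
      its intensity.\<close>
    have int: "set_integrable m ({0<..1} \<times> UNIV) snd"
      if "sets m = sets (jump_intensity \<nu>)" "(\<integral>\<^sup>+p. ?g p \<partial>m) < \<infinity>" for m :: "(real \<times> (real ^ 'd)) measure"
      unfolding set_integrable_def
    proof (rule integrableI_bounded)
      have "snd \<in> borel_measurable m" "{0<..1} \<times> UNIV \<in> sets m"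
        using \<mu>(3)[of 0 UNIV 1] \<mu>(4) that(1) measurable_cong_sets[OF that(1) refl] by auto
      then show "(\<lambda>p. indicat_real ({0<..1} \<times> UNIV) p *\<^sub>R snd p) \<in> borel_measurable m"
        by measurable
      have "(\<integral>\<^sup>+p. ennreal (norm (indicat_real ({0<..1} \<times> UNIV) p *\<^sub>R snd p)) \<partial>m) = (\<integral>\<^sup>+p. ?g p \<partial>m)"
        by (intro nn_integral_cong) (auto split: split_indicator)
      with that show "(\<integral>\<^sup>+p. ennreal (norm (indicat_real ({0<..1} \<times> UNIV) p *\<^sub>R snd p)) \<partial>m) < \<infinity>" by simp
    qed
    have intN: "set_integrable (N \<omega>) ({0<..1} \<times> UNIV) snd"
      using elim(2) by (intro int sets) (simp add: top.not_eq_extremum)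
    have int\<mu>: "set_integrable (jump_intensity \<nu>) ({0<..1} \<times> UNIV) snd"
      using \<mu>(2) by (intro int) simp_all
    let ?K = "\<lambda>m D t. LINT p:{0<..t} \<times> D|m. norm (snd p)"
    define I where "I = (\<lambda>(m :: (real \<times> (real ^ 'd)) measure) D t. LINT p:{0<..t} \<times> D|m. snd p)"
    let ?S = "{z :: real ^ 'd. norm z \<le> 1}" and ?B = "{z :: real ^ 'd. norm z > 1}"
    have SB: "?S \<in> sets borel" "?B \<in> sets borel" by measurable
    \<comment> \<open>The variations of the drift, the small jumps, their compensator and the large
      jumps.\<close>
    define H where "H = (\<lambda>t. t * norm a + ?K (N \<omega>) ?S t + ?K (jump_intensity \<nu>) ?S t + ?K (N \<omega>) ?B t)"
    show ?case
    proof (intro exI[of _ H] allI impI)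
      fix s t :: real assume st: "0 \<le> s" "s \<le> t" "t \<le> 1"
      have 1: "norm (I (N \<omega>) D t - I (N \<omega>) D s) \<le> ?K (N \<omega>) D t - ?K (N \<omega>) D s"
        if "D \<in> sets borel" for D
        unfolding I_def using that by (intro set_integral_increment_bound intN st) (simp add: sets \<mu>(3))
      have 2: "norm (I (jump_intensity \<nu>) ?S t - I (jump_intensity \<nu>) ?S s)
         \<le> ?K (jump_intensity \<nu>) ?S t - ?K (jump_intensity \<nu>) ?S s"
        unfolding I_def using SB by (intro set_integral_increment_bound int\<mu> st) (simp add: \<mu>(3))
      have eq: "jump_part a \<nu> N t \<omega> - jump_part a \<nu> N s \<omega> = (t - s) *\<^sub>R a
         + (I (N \<omega>) ?S t - I (N \<omega>) ?S s)
         - (I (jump_intensity \<nu>) ?S t - I (jump_intensity \<nu>) ?S s)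
         + (I (N \<omega>) ?B t - I (N \<omega>) ?B s)"
      proof -
        have "jump_part a \<nu> N u \<omega> = u *\<^sub>R a + (I (N \<omega>) ?S u - I (jump_intensity \<nu>) ?S u) + I (N \<omega>) ?B u" for u
          by (simp add: jump_part_def compensated_integral_def I_def)
        then show ?thesis by (simp add: scaleR_left_diff_distrib)
      qed
      have "norm (jump_part a \<nu> N t \<omega> - jump_part a \<nu> N s \<omega>) \<le> norm ((t - s) *\<^sub>R a) + norm (I (N \<omega>) ?S t - I (N \<omega>) ?S s)
         + norm (I (jump_intensity \<nu>) ?S t - I (jump_intensity \<nu>) ?S s)
         + norm (I (N \<omega>) ?B t - I (N \<omega>) ?B s)"
        unfolding eq
        by (intro order_trans[OF norm_triangle_ineq] order_trans[OF norm_triangle_ineq4] add_mono order_refl)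
      also have "\<dots> \<le> H t - H s"
      proof -
        have "norm ((t - s) *\<^sub>R a) = t * norm a - s * norm a"
          using st by (simp add: left_diff_distrib)
        with 1[OF SB(1)] 1[OF SB(2)] 2 show ?thesis unfolding H_def by linarith
      qed
      finally show "norm (jump_part a \<nu> N t \<omega> - jump_part a \<nu> N s \<omega>) \<le> H t - H s" .
    qed
  qed
qed

section \<open>Noise uniformly in the drift\<close>

text \<open>The majorant is summed in \<open>ennreal\<close>, so no summability has to be known for
  individual paths; only its expectation will be shown finite.\<close>

lemma sums_abs_le_suminf_ennreal:
  assumes "a sums (s::real)" and le: "\<And>m. \<bar>a m\<bar> \<le> A m"
  shows "ennreal \<bar>s\<bar> \<le> (\<Sum>m. ennreal (A m))"
proof (rule LIMSEQ_le_const2)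
  show "(\<lambda>N. ennreal \<bar>\<Sum>m<N. a m\<bar>) \<longlonglongrightarrow> ennreal \<bar>s\<bar>"
    using assms(1) unfolding sums_def by (intro tendsto_ennrealI tendsto_rabs)
  have A: "0 \<le> A m" for m using le[of m] by linarith
  have "ennreal \<bar>\<Sum>m<N. a m\<bar> \<le> (\<Sum>m. ennreal (A m))" for N
  proof -
    have "\<bar>\<Sum>m<N. a m\<bar> \<le> (\<Sum>m<N. A m)"
      by (intro order_trans[OF sum_abs] sum_mono le)
    then have "ennreal \<bar>\<Sum>m<N. a m\<bar> \<le> (\<Sum>m<N. ennreal (A m))"
      using A by (simp add: ennreal_leI)
    also have "\<dots> \<le> (\<Sum>m. ennreal (A m))"
      by (intro sum_le_suminf) auto
    finally show ?thesis .
  qed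
  then show "\<exists>N. \<forall>n\<ge>N. ennreal \<bar>\<Sum>m<n. a m\<bar> \<le> (\<Sum>m. ennreal (A m))" by blast
qed

text \<open>Truncation bounds the monomials by 1 on every path, so the moment estimates hold
  unconditionally; where \<bar>\<epsilon> W\<bar> is at most 1 it changes nothing.\<close>

definition clip :: "real ^ 'd::finite \<Rightarrow> real ^ 'd" where
  "clip v = (\<chi> q. max (-1) (min 1 (v $ q)))"

lemma abs_clip_le_1: "\<bar>clip v $ q\<bar> \<le> 1"
  by (simp add: clip_def abs_le_iff)

lemma clip_eq: "(\<And>q. \<bar>v $ q\<bar> \<le> 1) \<Longrightarrow> clip v = v"
proof -
  assume v: "\<And>q. \<bar>v $ q\<bar> \<le> 1"
  have "max (-1) (min 1 (v $ q)) = v $ q" for q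
    using v[of q] by linarith
  then show ?thesis by (simp add: clip_def vec_eq_iff)
qed

lemma measurable_list_monomial_clip:
  fixes u :: "'a \<Rightarrow> real ^ 'd::finite"
  assumes "u \<in> borel_measurable N"
  shows "(\<lambda>\<omega>. list_monomial js (clip (u \<omega>))) \<in> borel_measurable N"
proof (induction js)
  case (Cons j js)
  have "(\<lambda>\<omega>. u \<omega> $ j) \<in> borel_measurable N"
    by (rule measurable_compose[OF assms]) simp
  then have "(\<lambda>\<omega>. clip (u \<omega>) $ j) \<in> borel_measurable N"
    unfolding clip_def by simp
  then show ?case using Cons by simp
qed simp

text \<open>Increment \<open>j\<close> ends at observation \<open>Suc j\<close>, so lag
  \<open>v\<close> reads the path at \<open>Suc j - v\<close>. For \<open>v \<ge> 1\<close> this is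
  at most \<open>j\<close>: the multiplier is known before the increment. The cut-off at
  \<open>m\<close> discards the increments that precede the contrast sum.\<close>

definition noise_transform ::
    "real \<Rightarrow> nat \<Rightarrow> nat \<Rightarrow> (nat \<Rightarrow> real ^ 'd::finite) \<Rightarrow> 'd \<Rightarrow> 'd list \<Rightarrow> nat \<Rightarrow> real" where
  "noise_transform e v m w i js k = (\<Sum>j<k. (w (Suc j) - w j) $ i *
     (if j < m then 0 else list_monomial js (clip (e *\<^sub>R w (Suc j - v)))))"

text \<open>A majorant of all Taylor terms at once. It contains no trace of the drift, hence none of
  the parameter.\<close>

definition noise :: "real \<Rightarrow> nat \<Rightarrow> nat \<Rightarrow> nat \<Rightarrow> (nat \<Rightarrow> real ^ 'd::finite) \<Rightarrow> ennreal" where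
  "noise e v m n w = (\<Sum>r. ennreal (1 / fact r) *
     (\<Sum>js | length js = r. \<Sum>i\<in>UNIV. ennreal (running_max (noise_transform e v m w i js) n)))"

text \<open>Taylor expansion of \<open>f\<close> at the smoother part \<open>y\<close> of the path separates the parameter from the
  noise: all functions \<open>f\<close> with the same derivative bounds are controlled by the one quantity
  \<open>noise\<close>, which is what makes the estimate uniform in the parameter.\<close>

lemma abs_sum_inner_le_noise:
  fixes f :: "real ^ 'd::finite \<Rightarrow> real ^ 'd" and w y :: "nat \<Rightarrow> real ^ 'd"
  assumes smooth: "smooth_on UNIV f"
    and bnd: "\<And>js z. z \<in> cball 0 R \<Longrightarrow> norm (iter_partial js f z) \<le> K"
    and y: "\<And>j. j \<le> n \<Longrightarrow> y j \<in> cball 0 R" "\<And>j. j \<le> n \<Longrightarrow> y j + e *\<^sub>R w j \<in> cball 0 R"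
    and w: "\<And>j q. j \<le> n \<Longrightarrow> \<bar>e * w j $ q\<bar> \<le> 1"
    and h: "\<And>j. j < n \<Longrightarrow> norm (y (Suc j) - y j) \<le> h (Suc j) - h j" "h n - h 0 \<le> V"
    and v: "v \<ge> 1"
  shows "ennreal \<bar>\<Sum>j<n. if j < m then 0 else
      inner (w (Suc j) - w j) (f (y (Suc j - v) + e *\<^sub>R w (Suc j - v)))\<bar>
    \<le> ennreal (K * (1 + real CARD('d) * V)) * noise e v m n w"
proof -
  define p where "p = (\<lambda>j. Suc j - v)"
  have p_le: "p j \<le> n" if "j < n" for j using that v by (auto simp: p_def)
  have K: "0 \<le> K" if "n > 0"
    using bnd[OF y(1)[of 0], of "[]"] norm_ge_zero order_trans by blast
  have h_mono: "h i \<le> h j" if "i \<le> j" "j \<le> n" for i j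
    using that
  proof (induction j)
    case (Suc j)
    show ?case
    proof (cases "i = Suc j")
      case False
      then have "h i \<le> h j" using Suc by auto
      moreover have "h j \<le> h (Suc j)"
        using h(1)[of j] Suc.prems norm_ge_zero[of "y (Suc j) - y j"] by linarith
      ultimately show ?thesis by linarith
    qed simp
  qed simp
  define c where "c = (\<lambda>js i k. iter_partial js f (y (p k)) $ i)"
  have c_bnd: "\<bar>c js i k\<bar> \<le> K" if "k < n" for js i k
    unfolding c_def using component_le_norm_cart bnd[OF y(1)[OF p_le[OF that]]] order_trans by blast
  have c_var: "(\<Sum>k<n - 1. \<bar>c js i (Suc k) - c js i k\<bar>) \<le> K * real CARD('d) * V" if "n > 0" for js i
  proof -
    have "\<bar>c js i (Suc k) - c js i k\<bar> \<le> K * real CARD('d) * (h (p (Suc k)) - h (p k))" if k: "k < n - 1" for k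
    proof -
      have "\<bar>c js i (Suc k) - c js i k\<bar> \<le> norm (iter_partial js f (y (p (Suc k))) - iter_partial js f (y (p k)))"
        unfolding c_def using component_le_norm_cart[of "iter_partial js f (y (p (Suc k))) - iter_partial js f (y (p k))" i] by simp
      also have "\<dots> \<le> K * real CARD('d) * norm (y (p (Suc k)) - y (p k))"
      proof (rule lipschitz_of_partial_deriv_bound[OF convex_cball[of 0 R]])
        show "y (p (Suc k)) \<in> cball 0 R" "y (p k) \<in> cball 0 R"
          using y(1) p_le k by auto
        show "iter_partial js f differentiable (at z)" for z
          using smooth by (auto simp: smooth_on_def)
        show "norm (partial_deriv j (iter_partial js f) z) \<le> K" if "z \<in> cball 0 R" for j z
          \<comment> \<open>A bound common to all orders also bounds the next derivative, so every
            Taylor coefficient is Lipschitz with the same constant.\<close>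
          using bnd[OF that, of "j # js"] by simp
      qed
      also have "norm (y (p (Suc k)) - y (p k)) \<le> h (p (Suc k)) - h (p k)"
      \<comment> \<open>The index stands still while the subtraction is cut off at 0 and advances by
        exactly one afterwards.\<close>
      proof (cases "p (Suc k) = p k")
        case False
        then have "p (Suc k) = Suc (p k)" "p k < n" using k v by (auto simp: p_def)
        then show ?thesis using h(1)[of "p k"] by simp
      qed simp
      finally show ?thesis using K[OF \<open>n > 0\<close>] by (simp add: mult_left_mono)
    qed
    then have "(\<Sum>k<n - 1. \<bar>c js i (Suc k) - c js i k\<bar>)
        \<le> (\<Sum>k<n - 1. K * real CARD('d) * (h (p (Suc k)) - h (p k)))"
      by (intro sum_mono) auto
    also have "\<dots> = K * real CARD('d) * (h (p (n - 1)) - h (p 0))"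
      using sum_lessThan_telescope[of "\<lambda>k. h (p k)" "n - 1"]
      by (simp only: sum_distrib_left[symmetric])
    also have "\<dots> \<le> K * real CARD('d) * V"
    proof (intro mult_left_mono)
      have "h (p (n - 1)) \<le> h n" "h 0 \<le> h (p 0)"
        using p_le that by (auto intro!: h_mono)
      then show "h (p (n - 1)) - h (p 0) \<le> V" using h(2) by linarith
    qed (use K that in auto)
    finally show ?thesis .
  qed
  let ?S = "noise_transform e v m w"
  define B where "B = K * (1 + real CARD('d) * V)"
  have S_step: "?S i js (Suc j) - ?S i js j = (w (Suc j) - w j) $ i *
     (if j < m then 0 else list_monomial js (clip (e *\<^sub>R w (p j))))" for i js j
    by (simp add: noise_transform_def p_def)
  have abel: "\<bar>\<Sum>j<n. (?S i js (Suc j) - ?S i js j) * c js i j\<bar> \<le> running_max (?S i js) n * B" for i js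
  proof (cases "n > 0")
    case True
    show ?thesis
      unfolding B_def using abel_sum_bound[of "?S i js" n "running_max (?S i js) n" "c js i" K "K * real CARD('d) * V"]
        abs_le_running_max[of _ n "?S i js"] c_bnd c_var[OF True] K[OF True] running_max_nonneg[of "?S i js" n]
      by (simp add: noise_transform_def distrib_left mult.assoc)
  qed (simp add: noise_transform_def)
  define a where "a = (\<lambda>r. (\<Sum>js | length js = r. \<Sum>i\<in>UNIV. \<Sum>j<n. (?S i js (Suc j) - ?S i js j) * c js i j) / fact r)"
  have "(\<lambda>r. \<Sum>i\<in>UNIV. \<Sum>j<n. (if j < m then 0 else (w (Suc j) - w j) $ i) *
      ((\<Sum>js | length js = r. list_monomial js (e *\<^sub>R w (p j)) * (iter_partial js f (y (p j)) $ i)) / fact r))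
    sums (\<Sum>i\<in>UNIV. \<Sum>j<n. (if j < m then 0 else (w (Suc j) - w j) $ i) * f (y (p j) + e *\<^sub>R w (p j)) $ i)"
  proof (intro sums_sum sums_mult taylor_sums[OF smooth])
    fix i j js and t :: real assume j: "j \<in> {..<n}" and t: "0 \<le> t" "t \<le> 1"
    have mem: "y (p j) \<in> cball 0 R" "y (p j) + e *\<^sub>R w (p j) \<in> cball 0 R"
      using y p_le j by auto
    \<comment> \<open>The whole segment of expansion must stay in the ball where the derivatives are
      controlled; both end points lie there.\<close>
    have "(1 - t) *\<^sub>R y (p j) + t *\<^sub>R (y (p j) + e *\<^sub>R w (p j)) \<in> cball 0 R"
      using convexD[OF convex_cball[of 0 R] mem, of "1 - t" t] t by auto
    then have "y (p j) + t *\<^sub>R (e *\<^sub>R w (p j)) \<in> cball 0 R"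
      by (simp add: algebra_simps)
    then show "norm (iter_partial js f (y (p j) + t *\<^sub>R e *\<^sub>R w (p j))) \<le> K" by (rule bnd)
  next
    fix j q assume "j \<in> {..<n}"
    then show "\<bar>(e *\<^sub>R w (p j)) $ q\<bar> \<le> 1" using w p_le by simp
  qed
  also have "(\<lambda>r. \<Sum>i\<in>UNIV. \<Sum>j<n. (if j < m then 0 else (w (Suc j) - w j) $ i) *
      ((\<Sum>js | length js = r. list_monomial js (e *\<^sub>R w (p j)) * (iter_partial js f (y (p j)) $ i)) / fact r)) = a"
  proof
    fix r
    have clip: "clip (e *\<^sub>R w (p j)) = e *\<^sub>R w (p j)" if "j < n" for j
      using w p_le[OF that] by (intro clip_eq) simp
    have term_eq: "(if j < m then 0 else (w (Suc j) - w j) $ i) *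
        ((\<Sum>js | length js = r. list_monomial js (e *\<^sub>R w (p j)) * (iter_partial js f (y (p j)) $ i)) / fact r)
      = (\<Sum>js | length js = r. (?S i js (Suc j) - ?S i js j) * c js i j) / fact r" if "j < n" for i j
      using clip[OF that] by (simp add: S_step c_def sum_distrib_left mult.assoc)
    have "(\<Sum>i\<in>UNIV. \<Sum>j<n. (if j < m then 0 else (w (Suc j) - w j) $ i) *
        ((\<Sum>js | length js = r. list_monomial js (e *\<^sub>R w (p j)) * (iter_partial js f (y (p j)) $ i)) / fact r))
      = (\<Sum>i\<in>UNIV. \<Sum>j<n. (\<Sum>js | length js = r. (?S i js (Suc j) - ?S i js j) * c js i j) / fact r)"
      by (intro sum.cong refl term_eq) simp
    also have "\<dots> = (\<Sum>i\<in>UNIV. \<Sum>js | length js = r. \<Sum>j<n. (?S i js (Suc j) - ?S i js j) * c js i j) / fact r"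
      by (simp add: sum_divide_distrib[symmetric] sum.swap[of _ _ "{..<n}"])
    also have "\<dots> = a r"
      unfolding a_def by (subst sum.swap) (rule refl)
    finally show "(\<Sum>i\<in>UNIV. \<Sum>j<n. (if j < m then 0 else (w (Suc j) - w j) $ i) *
        ((\<Sum>js | length js = r. list_monomial js (e *\<^sub>R w (p j)) * (iter_partial js f (y (p j)) $ i)) / fact r)) = a r" .
  qed
  also have "(\<Sum>i\<in>UNIV. \<Sum>j<n. (if j < m then 0 else (w (Suc j) - w j) $ i) * f (y (p j) + e *\<^sub>R w (p j)) $ i)
     = (\<Sum>j<n. if j < m then 0 else inner (w (Suc j) - w j) (f (y (Suc j - v) + e *\<^sub>R w (Suc j - v))))"
    by (subst sum.swap) (auto simp: inner_vec_def p_def intro!: sum.cong)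
  finally have sums: "a sums (\<Sum>j<n. if j < m then 0 else inner (w (Suc j) - w j) (f (y (Suc j - v) + e *\<^sub>R w (Suc j - v))))" .
  have "\<bar>a r\<bar> \<le> B * ((1 / fact r) * (\<Sum>js :: 'd list | length js = r. \<Sum>i\<in>UNIV. running_max (?S i js) n))" for r
  proof -
    have "\<bar>a r\<bar> \<le> (\<Sum>js :: 'd list | length js = r. \<Sum>i\<in>UNIV. running_max (?S i js) n * B) / fact r"
    proof -
      have "\<bar>a r\<bar> = \<bar>\<Sum>js | length js = r. \<Sum>i\<in>UNIV. \<Sum>j<n. (?S i js (Suc j) - ?S i js j) * c js i j\<bar> / fact r"
        by (simp add: a_def)
      also have "\<dots> \<le> (\<Sum>js :: 'd list | length js = r. \<Sum>i\<in>UNIV. running_max (?S i js) n * B) / fact r"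
        by (intro divide_right_mono order_trans[OF sum_abs] sum_mono abel) auto
      finally show ?thesis .
    qed
    then show ?thesis by (simp add: sum_distrib_left sum_divide_distrib mult_ac)
  qed
  from sums_abs_le_suminf_ennreal[OF sums this]
  have "ennreal \<bar>\<Sum>j<n. if j < m then 0 else inner (w (Suc j) - w j) (f (y (Suc j - v) + e *\<^sub>R w (Suc j - v)))\<bar>
    \<le> (\<Sum>r. ennreal (B * ((1 / fact r) * (\<Sum>js :: 'd list | length js = r. \<Sum>i\<in>UNIV. running_max (?S i js) n))))" .
  also have "\<dots> = (\<Sum>r. ennreal B * (ennreal (1 / fact r) *
      (\<Sum>js :: 'd list | length js = r. \<Sum>i\<in>UNIV. ennreal (running_max (?S i js) n))))"
  proof (intro suminf_cong)
    fix r
    let ?m = "\<Sum>js :: 'd list | length js = r. \<Sum>i\<in>UNIV. running_max (?S i js) n"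
    have m: "0 \<le> ?m" by (intro sum_nonneg running_max_nonneg)
    have "(\<Sum>js :: 'd list | length js = r. \<Sum>i\<in>UNIV. ennreal (running_max (?S i js) n)) = ennreal ?m"
      by (simp add: sum_nonneg running_max_nonneg)
    moreover have "ennreal (B * ((1 / fact r) * ?m)) = ennreal B * (ennreal (1 / fact r) * ennreal ?m)"
      using m by (simp only: ennreal_mult'' mult_nonneg_nonneg divide_nonneg_nonneg zero_le_one fact_ge_zero)
    ultimately show "ennreal (B * ((1 / fact r) * ?m)) = ennreal B * (ennreal (1 / fact r) *
      (\<Sum>js :: 'd list | length js = r. \<Sum>i\<in>UNIV. ennreal (running_max (?S i js) n)))" by simp
  qed
  also have "\<dots> = ennreal B * noise e v m n w"
    unfolding noise_def by (rule ennreal_suminf_cmult)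
  finally show ?thesis by (simp add: B_def)
qed

context prob_space begin

text \<open>Each running maximum has expectation at most \<open>1 + 4 * (n * u)\<close>; there are d
  ^ (r + 1) of them at order \<open>r\<close>, so the weights sum to
  \<open>d * exp d\<close>.\<close>

lemma expectation_noise_le:
  fixes \<xi> :: "nat \<Rightarrow> 'a \<Rightarrow> real ^ 'd::finite"
  assumes ind: "indep_vars (\<lambda>_. borel) \<xi> {..<n}"
    and int: "\<And>j i. j < n \<Longrightarrow> integrable M (\<lambda>\<omega>. \<xi> j \<omega> $ i)" "\<And>j i. j < n \<Longrightarrow> expectation (\<lambda>\<omega>. \<xi> j \<omega> $ i) = 0"
    and sq: "\<And>j i. j < n \<Longrightarrow> integrable M (\<lambda>\<omega>. (\<xi> j \<omega> $ i)\<^sup>2)"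
       "\<And>j i. j < n \<Longrightarrow> expectation (\<lambda>\<omega>. (\<xi> j \<omega> $ i)\<^sup>2) \<le> u"
    and v: "v \<ge> 1" and u: "u \<ge> 0"
  shows "(\<lambda>\<omega>. noise e v m n (\<lambda>j. \<Sum>i<j. \<xi> i \<omega>)) \<in> borel_measurable M" (is ?meas)
    and "(\<integral>\<^sup>+\<omega>. noise e v m n (\<lambda>j. \<Sum>i<j. \<xi> i \<omega>) \<partial>M)
      \<le> ennreal (exp (real CARD('d)) * (real CARD('d) * (1 + 4 * (real n * u))))" (is ?le)
proof -
  \<comment> \<open>Predictable because \<open>Suc j - v \<le> j\<close>, which is where
    \<open>v \<ge> 1\<close> enters.\<close>
  define \<phi> where "\<phi> = (\<lambda>js j \<omega>. if j < m then 0 else list_monomial js (clip (e *\<^sub>R (\<Sum>i<Suc j - v. \<xi> i \<omega>))))"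
  have eq: "noise_transform e v m (\<lambda>j. \<Sum>i<j. \<xi> i \<omega>) i js = (\<lambda>k. \<Sum>j<k. \<xi> j \<omega> $ i * \<phi> js j \<omega>)" for \<omega> i js
    by (rule ext) (simp add: noise_transform_def \<phi>_def)
  have \<phi>_past: "\<phi> js j \<in> borel_measurable (past \<xi> j)" for js j
  proof (cases "j < m")
    case False
    have "(\<lambda>\<omega>. e *\<^sub>R (\<Sum>i<Suc j - v. \<xi> i \<omega>)) \<in> borel_measurable (past \<xi> j)"
      using v by (intro borel_measurable_scaleR borel_measurable_const borel_measurable_sum measurable_past_component) auto
    from measurable_list_monomial_clip[OF this] False show ?thesis by (simp add: \<phi>_def)
  qed (simp add: \<phi>_def)
  have \<phi>_le: "\<bar>\<phi> js j \<omega>\<bar> \<le> 1" for js j \<omega>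
    by (simp add: \<phi>_def abs_list_monomial_le_1 abs_clip_le_1)
  have \<phi>_meas: "\<phi> js j \<in> borel_measurable M" if "j < n" for js j
    using ind that by (intro measurable_past_imp[OF _ \<phi>_past]) (auto simp: indep_vars_def)
  have max_meas: "(\<lambda>\<omega>. running_max (\<lambda>k. \<Sum>j<k. \<xi> j \<omega> $ i * \<phi> js j \<omega>) n) \<in> borel_measurable M" for i js
    by (intro measurable_running_max borel_measurable_sum borel_measurable_times \<phi>_meas
        borel_measurable_integrable[OF int(1)]) auto
  note max_meas[measurable]
  show ?meas
    unfolding noise_def eq by measurable
  let ?d = "real CARD('d)" and ?c = "1 + 4 * (real n * u)"
  have c: "0 \<le> ?c" using u by simp
  have max_le: "(\<integral>\<^sup>+\<omega>. ennreal (running_max (\<lambda>k. \<Sum>j<k. \<xi> j \<omega> $ i * \<phi> js j \<omega>) n) \<partial>M) \<le> ennreal ?c" for i js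
    by (rule expectation_running_max_transform_le[OF ind \<phi>_past \<phi>_le int sq])
  have "(\<integral>\<^sup>+\<omega>. noise e v m n (\<lambda>j. \<Sum>i<j. \<xi> i \<omega>) \<partial>M) = (\<Sum>r. ennreal (1 / fact r) *
     (\<Sum>js | length js = r. \<Sum>i\<in>UNIV. \<integral>\<^sup>+\<omega>. ennreal (running_max (\<lambda>k. \<Sum>j<k. \<xi> j \<omega> $ i * \<phi> js j \<omega>) n) \<partial>M))"
    unfolding noise_def eq
    by (subst nn_integral_suminf) (simp_all add: nn_integral_cmult nn_integral_sum)
  also have "\<dots> \<le> (\<Sum>r. ennreal (1 / fact r) * (\<Sum>js :: 'd list | length js = r. \<Sum>i\<in>(UNIV :: 'd set). ennreal ?c))"
    by (intro suminf_le mult_left_mono sum_mono max_le) auto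
  also have "\<dots> = (\<Sum>r. ennreal ((?d ^ r /\<^sub>R fact r) * (?d * ?c)))"
  proof (intro suminf_cong)
    fix r
    have "(\<Sum>js :: 'd list | length js = r. \<Sum>i\<in>(UNIV :: 'd set). ennreal ?c)
        = ennreal (\<Sum>js :: 'd list | length js = r. \<Sum>i\<in>(UNIV :: 'd set). ?c)"
      using c by (simp only: sum_ennreal sum_nonneg)
    also have "(\<Sum>js :: 'd list | length js = r. \<Sum>i\<in>(UNIV :: 'd set). ?c) = ?d ^ r * (?d * ?c)"
      by (simp add: card_lists_length)
    finally show "ennreal (1 / fact r) * (\<Sum>js :: 'd list | length js = r. \<Sum>i\<in>(UNIV :: 'd set). ennreal ?c)
        = ennreal ((?d ^ r /\<^sub>R fact r) * (?d * ?c))"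
      by (simp add: ennreal_mult'[symmetric] divide_inverse mult_ac)
  qed
  also have "\<dots> = ennreal (exp ?d * (?d * ?c))"
    using c by (intro suminf_ennreal_eq sums_mult2 exp_converges) auto
  finally show ?le .
qed

end

section \<open>The pathwise estimate\<close>

text \<open>As the coefficients sum to 1, \<open>z\<close> can be subtracted from each value; their
  total variation gives the factor \<open>2 ^ l\<close>.\<close>

lemma norm_adams_moulton_diff_le:
  fixes b :: "'x \<Rightarrow> 't \<Rightarrow> 'b::real_normed_vector"
  assumes "\<And>v. v \<le> l \<Longrightarrow> norm (b (Y (k - v)) \<theta> - z) \<le> B"
  shows "norm (adams_moulton l b Y k \<theta> - z) \<le> 2 ^ l * B"
proof -
  have "z = (\<Sum>v=0..l. am_coeff l v) *\<^sub>R z" by (simp add: sum_am_coeff)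
  then have "adams_moulton l b Y k \<theta> - z = (\<Sum>v=0..l. am_coeff l v *\<^sub>R (b (Y (k - v)) \<theta> - z))"
    unfolding adams_moulton_def by (simp add: scaleR_left.sum scaleR_right_diff_distrib sum_subtractf)
  also have "norm \<dots> \<le> (\<Sum>v=0..l. \<bar>am_coeff l v\<bar> * B)"
    using assms by (intro sum_norm_le) (auto intro!: mult_left_mono)
  also have "\<dots> = (\<Sum>v=0..l. \<bar>am_coeff l v\<bar>) * B"
    by (simp add: sum_distrib_right)
  also have "\<dots> \<le> 2 ^ l * B"
    using order_trans[OF norm_ge_zero assms[of 0]] by (intro mult_right_mono sum_abs_am_coeff_le) auto
  finally show ?thesis .
qed

text \<open>The basic inequality of least squares: expanding the squares cancels the residuals at
  \<open>\<theta>\<^sub>0\<close> and leaves the cross term. The weight of the contrast cancels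
  too.\<close>

lemma contrast_le_imp:
  fixes b :: "'x::real_inner \<Rightarrow> 't \<Rightarrow> 'x"
  assumes le: "contrast b n e l Y \<theta> \<le> contrast b n e l Y \<theta>\<^sub>0" and e: "e > 0" and n: "n \<ge> 1"
  defines "g \<equiv> \<lambda>k. adams_moulton l b Y k \<theta> - adams_moulton l b Y k \<theta>\<^sub>0"
    and "u \<equiv> \<lambda>k. Y k - Y (k - 1) - (1 / real n) *\<^sub>R adams_moulton l b Y k \<theta>\<^sub>0"
  shows "(\<Sum>k = max l 1..n. (norm (g k))\<^sup>2) / real n \<le> 2 * (\<Sum>k = max l 1..n. inner (u k) (g k))"
proof -
  have n0: "real n > 0" using n by simp
  have shift: "Y k - Y (k - 1) - (1 / real n) *\<^sub>R adams_moulton l b Y k \<theta> = u k - (1 / real n) *\<^sub>R g k" for k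
    by (simp add: u_def g_def algebra_simps)
  have "(\<Sum>k = max l 1..n. (norm (u k - (1 / real n) *\<^sub>R g k))\<^sup>2) / (e\<^sup>2 / real n)
      \<le> (\<Sum>k = max l 1..n. (norm (u k))\<^sup>2) / (e\<^sup>2 / real n)"
    using le unfolding contrast_def shift sum_divide_distrib by (simp add: u_def)
  then have "(\<Sum>k = max l 1..n. (norm (u k - (1 / real n) *\<^sub>R g k))\<^sup>2) \<le> (\<Sum>k = max l 1..n. (norm (u k))\<^sup>2)"
    using e n0 by (subst (asm) divide_le_cancel) (auto simp: divide_less_0_iff)
  moreover have "(norm (u k - (1 / real n) *\<^sub>R g k))\<^sup>2
      = (norm (u k))\<^sup>2 - 2 * inner (u k) (g k) / real n + (norm (g k))\<^sup>2 / (real n)\<^sup>2" for k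
    using n0 by (simp add: power2_norm_eq_inner inner_diff_left inner_diff_right inner_commute[of "g k" "u k"])
      (simp add: power2_eq_square diff_divide_distrib)
  ultimately have "(\<Sum>k = max l 1..n. (norm (g k))\<^sup>2) / (real n)\<^sup>2
      \<le> 2 * (\<Sum>k = max l 1..n. inner (u k) (g k)) / real n"
    by (simp add: sum.distrib sum_subtractf flip: sum_divide_distrib sum_distrib_left)
  then have "real n * ((\<Sum>k = max l 1..n. (norm (g k))\<^sup>2) / (real n)\<^sup>2)
      \<le> real n * (2 * (\<Sum>k = max l 1..n. inner (u k) (g k)) / real n)"
    using n0 by (intro mult_left_mono) auto
  then show ?thesis using n0 by (simp add: power2_eq_square)
qed

text \<open>Passes from observations to increments numbered from 0, with leading zeros, so that sums
  over all increments below \<open>n\<close> apply.\<close>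

lemma sum_from_max_eq:
  fixes F :: "nat \<Rightarrow> 'b::comm_monoid_add"
  shows "(\<Sum>k = max l 1..n. F k) = (\<Sum>j<n. if j < max l 1 - 1 then 0 else F (Suc j))"
proof -
  have "(\<Sum>j<n. if j < max l 1 - 1 then 0 else F (Suc j)) = (\<Sum>j\<in>{max l 1 - 1..<n}. F (Suc j))"
    by (intro sum.mono_neutral_cong_right) auto
  also have "\<dots> = (\<Sum>k = max l 1..n. F k)"
    by (rule sum.reindex_bij_witness[of _ "\<lambda>k. k - 1" Suc]) auto
  finally show ?thesis by simp
qed

text \<open>The deterministic core, for a single path. The smallness parameters are
  \<open>\<delta>\<close> for the distance to the limit path, \<open>\<eta>\<close> for the
  quadrature, \<open>\<zeta>\<close> for the jumps, \<open>e * Wm\<close> for the Brownian part,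
  \<open>\<tau>1\<close> for the Taylor noise and \<open>\<tau>2\<close> for the quadratic
  variation.\<close>

lemma mean_square_error_le:
  fixes b :: "real ^ 'd::finite \<Rightarrow> 't \<Rightarrow> real ^ 'd" and X W J x :: "real \<Rightarrow> real ^ 'd" and H :: "real \<Rightarrow> real"
  assumes n: "n \<ge> 1" and l: "l \<le> n" and e: "e > 0" and C: "C > 0"
    and lip: "\<And>y z \<theta>. \<theta> \<in> \<Theta> \<Longrightarrow> norm (b y \<theta> - b z \<theta>) \<le> C * norm (y - z)"
    and smooth: "\<And>\<theta>. \<theta> \<in> \<Theta> \<Longrightarrow> smooth_on UNIV (\<lambda>y. b y \<theta>)"
    and K: "\<And>js \<theta> z. \<theta> \<in> \<Theta> \<Longrightarrow> z \<in> cball 0 R \<Longrightarrow> norm (iter_partial js (\<lambda>y. b y \<theta>) z) \<le> K"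
    and \<theta>: "\<theta>\<^sub>0 \<in> \<Theta>" "\<theta> \<in> \<Theta>"
    and X: "\<And>t. t \<in> {0..1} \<Longrightarrow> X t = x\<^sub>0 + (LINT s:{0..t}|lborel. b (X s) \<theta>\<^sub>0) + e *\<^sub>R (W t + J t)"
    and int: "set_integrable lborel {0..1} (\<lambda>s. b (X s) \<theta>\<^sub>0)"
    and dev: "\<And>t. t \<in> {0..1} \<Longrightarrow> norm (X t - x t) \<le> \<delta>"
    and R: "\<And>t. t \<in> {0..1} \<Longrightarrow> norm (x t) \<le> R\<^sub>0" "R\<^sub>0 + \<delta> + 1 \<le> R"
    and D: "\<And>s t. s \<in> {0..1} \<Longrightarrow> t \<in> {0..1} \<Longrightarrow> norm (x s - x t) \<le> D * \<bar>s - t\<bar>"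
      "\<And>t. t \<in> {0..1} \<Longrightarrow> norm (b (x t) \<theta>\<^sub>0) \<le> D"
    and J: "\<And>s t. 0 \<le> s \<Longrightarrow> s \<le> t \<Longrightarrow> t \<le> 1 \<Longrightarrow> norm (J t - J s) \<le> H t - H s"
      "e * (H 1 - H 0) \<le> \<zeta>"
    and W: "\<And>t. t \<in> {0..1} \<Longrightarrow> norm (W t) \<le> Wm" "e * Wm \<le> 1"
    and V: "D + C * \<delta> + \<zeta> \<le> V"
    and \<tau>1: "ennreal e * (\<Sum>v=0..l. ennreal \<bar>am_coeff l v\<bar> *
        noise e (max v 1) (max l 1 - 1) n (\<lambda>j. W (real j / real n))) \<le> ennreal \<tau>1" "0 \<le> \<tau>1"
    and \<tau>2: "e\<^sup>2 * (\<Sum>j<n. (norm (W (real (Suc j) / real n) - W (real j / real n)))\<^sup>2) \<le> \<tau>2"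
    and min: "contrast b n e l (\<lambda>k. X (real k / real n)) \<theta> \<le> contrast b n e l (\<lambda>k. X (real k / real n)) \<theta>\<^sub>0"
    and F: "\<And>t. t \<in> {0..1} \<Longrightarrow> norm (b (x t) \<theta> - b (x t) \<theta>\<^sub>0) \<le> F"
    and \<eta>: "\<eta> = 2 ^ l * (C * (\<delta> + D * real l / real n))"
  shows "(\<Sum>k=1..n. (norm (b (x (real k / real n)) \<theta> - b (x (real k / real n)) \<theta>\<^sub>0))\<^sup>2) / real n
    \<le> 2 * (2 * ((C * \<delta> + C * D / real n + \<eta>) * (F + 2 * \<eta>)) + 2 * (\<zeta> * (F + 2 * \<eta>))
        + 4 * (K * (1 + real CARD('d) * V) * \<tau>1) + 4 * C * (2 * (e * Wm) * V + \<tau>2))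
      + 8 * \<eta>\<^sup>2 + real l / real n * F\<^sup>2"
proof -
  have n0: "real n > 0" using n by simp
  define m where "m = max l 1 - 1"
  define t where "t = (\<lambda>k. real k / real n)"
  have t01: "t k \<in> {0..1}" if "k \<le> n" for k using that n0 by (simp add: t_def)
  have t01_pred: "t (k - 1) \<in> {0..1}" if "k \<le> n" for k using t01[of "k - 1"] that by simp
  have t_Suc: "t (Suc j) - t j = 1 / real n" for j by (simp add: t_def diff_divide_distrib[symmetric])
  have t_mono: "t j \<le> t k" if "j \<le> k" for j k using that by (simp add: t_def divide_right_mono)
  have D0: "0 \<le> D" using order_trans[OF norm_ge_zero D(2)[of 0]] by simp
  have \<delta>0: "0 \<le> \<delta>" using order_trans[OF norm_ge_zero dev[of 0]] by simp
  have Wm0: "0 \<le> Wm" using order_trans[OF norm_ge_zero W(1)[of 0]] by simp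
  have F0: "0 \<le> F" using order_trans[OF norm_ge_zero F[of 0]] by simp
  have \<eta>0: "0 \<le> \<eta>" unfolding \<eta> using C \<delta>0 D0 by simp
  have H01: "0 \<le> H 1 - H 0" using order_trans[OF norm_ge_zero J(1)[of 0 1]] by simp
  have \<zeta>0: "0 \<le> \<zeta>" using J(2) e H01 mult_nonneg_nonneg[of e "H 1 - H 0"] by linarith
  have V0: "0 \<le> V" using V D0 C \<delta>0 \<zeta>0 mult_nonneg_nonneg[of C \<delta>] by linarith
  have K0: "0 \<le> K"
  proof -
    have "x 0 \<in> cball 0 R" using R(1)[of 0] R(2) \<delta>0 by simp
    from K[OF \<theta>(1) this, of "[]"] show ?thesis using norm_ge_zero order_trans by blast
  qed

  have bX: "norm (b (X s) \<theta>\<^sub>0 - b (x s) \<theta>\<^sub>0) \<le> C * \<delta>" if "s \<in> {0..1}" for s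
    by (rule order_trans[OF lip[OF \<theta>(1)]]) (use dev[OF that] C in simp)
  define IX where "IX = (\<lambda>t. LINT s:{0..t}|lborel. b (X s) \<theta>\<^sub>0)"
  have IX_eq: "IX t = integral {0..t} (\<lambda>s. b (X s) \<theta>\<^sub>0)" if "t \<in> {0..1}" for t
    unfolding IX_def using that
    by (intro set_borel_integral_eq_integral set_integrable_subset[OF int]) auto
  have int_HK: "(\<lambda>s. b (X s) \<theta>\<^sub>0) integrable_on {0..1}"
    by (rule set_borel_integral_eq_integral[OF int])
  \<comment> \<open>Used with \<open>z = 0\<close> for the variation of the drift part, and with
    \<open>z\<close> the quadrature value for the residual of one step.\<close>
  have IX_diff: "norm (IX v - IX u - (v - u) *\<^sub>R z) \<le> B * (v - u)"
    if "0 \<le> u" "u \<le> v" "v \<le> 1" "\<And>s. s \<in> {u..v} \<Longrightarrow> norm (b (X s) \<theta>\<^sub>0 - z) \<le> B" for u v z B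
  proof -
    have sub: "(\<lambda>s. b (X s) \<theta>\<^sub>0) integrable_on {u..v}" "(\<lambda>s. b (X s) \<theta>\<^sub>0) integrable_on {0..v}"
      using that by (auto intro: integrable_on_subinterval[OF int_HK])
    have "IX v - IX u = integral {u..v} (\<lambda>s. b (X s) \<theta>\<^sub>0)"
      using Henstock_Kurzweil_Integration.integral_combine[OF that(1,2) sub(2)] that by (simp add: IX_eq algebra_simps)
    then have "IX v - IX u - (v - u) *\<^sub>R z = integral {u..v} (\<lambda>s. b (X s) \<theta>\<^sub>0 - z)"
      using that(2) Henstock_Kurzweil_Integration.integral_diff[OF sub(1) integrable_const_ivl[of z]] by simp
    also have "norm \<dots> \<le> integral {u..v} (\<lambda>s. B)"
      using that(4) sub(1) by (intro integral_norm_bound_integral integrable_diff) auto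
    finally show ?thesis using that(2) by (simp add: mult.commute)
  qed
  \<comment> \<open>The path without its Brownian part has finite variation, dominated by
    \<open>h\<close>; the Taylor expansions are centred on it.\<close>
  define Y where "Y = (\<lambda>t. X t - e *\<^sub>R W t)"
  define h where "h = (\<lambda>t. (D + C * \<delta>) * t + e * H t)"
  have Y_diff: "norm (Y v - Y u) \<le> h v - h u" if uv: "0 \<le> u" "u \<le> v" "v \<le> 1" for u v
  proof -
    have "Y v - Y u = (IX v - IX u - (v - u) *\<^sub>R 0) + e *\<^sub>R (J v - J u)"
      using X[of u] X[of v] uv by (simp add: Y_def IX_def algebra_simps)
    also have "norm \<dots> \<le> (D + C * \<delta>) * (v - u) + e * (H v - H u)"
    proof (intro norm_triangle_mono IX_diff uv)
      fix s assume "s \<in> {u..v}"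
      then have s: "s \<in> {0..1}" using uv by auto
      have "norm (b (X s) \<theta>\<^sub>0) \<le> norm (b (X s) \<theta>\<^sub>0 - b (x s) \<theta>\<^sub>0) + norm (b (x s) \<theta>\<^sub>0)"
        using norm_triangle_sub[of "b (X s) \<theta>\<^sub>0" "b (x s) \<theta>\<^sub>0"] by linarith
      then show "norm (b (X s) \<theta>\<^sub>0 - 0) \<le> D + C * \<delta>" using bX[OF s] D(2)[OF s] by simp
    qed (use J(1)[OF uv] e in simp)
    finally show ?thesis by (simp add: h_def algebra_simps)
  qed
  have h_V: "h 1 - h 0 \<le> V" using V J(2) by (simp add: h_def algebra_simps)

  let ?w = "\<lambda>j. W (t j)"
  have eW: "norm (e *\<^sub>R W s) \<le> 1" if "s \<in> {0..1}" for s
  proof -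
    have "norm (e *\<^sub>R W s) \<le> e * Wm" using W(1)[OF that] e by simp
    then show ?thesis using W(2) by linarith
  qed
  have X_ball: "norm (X s) \<le> R\<^sub>0 + \<delta>" if "s \<in> {0..1}" for s
    using norm_triangle_sub[of "X s" "x s"] dev[OF that] R(1)[OF that] by linarith
  \<comment> \<open>The Brownian cross term at lag \<open>v\<close> for a single parameter; the
    estimate will be applied at \<open>\<theta>\<close> and at
    \<open>\<theta>\<^sub>0\<close>.\<close>
  define s where "s = (\<lambda>\<theta> v. \<Sum>j<n. if j < m then 0 else inner (?w (Suc j) - ?w j) (b (X (t (Suc j - v))) \<theta>))"
  have noise_v: "ennreal \<bar>s \<theta>' v\<bar> \<le> ennreal (K * (1 + real CARD('d) * V)) * noise e v m n ?w"
    if \<theta>': "\<theta>' \<in> \<Theta>" and v: "v \<ge> 1" for \<theta>' v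
  proof -
    have "s \<theta>' v = (\<Sum>j<n. if j < m then 0 else
        inner (?w (Suc j) - ?w j) (b (Y (t (Suc j - v)) + e *\<^sub>R ?w (Suc j - v)) \<theta>'))"
      unfolding s_def by (intro sum.cong refl) (auto simp: Y_def)
    also have "ennreal \<bar>\<dots>\<bar> \<le> ennreal (K * (1 + real CARD('d) * V)) * noise e v m n ?w"
    proof (rule abs_sum_inner_le_noise[where f = "\<lambda>y. b y \<theta>'" and y = "\<lambda>j. Y (t j)" and h = "\<lambda>j. h (t j)" and R = R,
          OF smooth[OF \<theta>'] K[OF \<theta>'] _ _ _ _ _ v])
      fix j assume j: "j \<le> n"
      have "norm (Y (t j)) \<le> R\<^sub>0 + \<delta> + 1"
        unfolding Y_def using X_ball[OF t01[OF j]] eW[OF t01[OF j]]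
        by (intro order_trans[OF norm_triangle_ineq4]) linarith
      then show "Y (t j) \<in> cball 0 R" using R(2) by simp
      show "Y (t j) + e *\<^sub>R ?w j \<in> cball 0 R" using X_ball[OF t01[OF j]] R(2) by (simp add: Y_def)
      show "\<bar>e * ?w j $ q\<bar> \<le> 1" for q
        using component_le_norm_cart[of "e *\<^sub>R ?w j" q] eW[OF t01[OF j]] by simp
    next
      fix j assume "j < n"
      then show "norm (Y (t (Suc j)) - Y (t j)) \<le> h (t (Suc j)) - h (t j)"
        using t01[of j] t01[of "Suc j"] t_mono[of j "Suc j"] by (intro Y_diff) auto
    next
      show "h (t n) - h (t 0) \<le> V" using h_V n0 by (simp add: t_def)
    qed
    finally show ?thesis .
  qed
  define B where "B = K * (1 + real CARD('d) * V)"
  have B0: "0 \<le> B" using K0 V0 by (simp add: B_def)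
  have noise_total: "e * (\<Sum>v=0..l. \<bar>am_coeff l v\<bar> * \<bar>s \<theta>' (max v 1)\<bar>) \<le> B * \<tau>1" if \<theta>': "\<theta>' \<in> \<Theta>" for \<theta>'
  proof -
    have "ennreal (e * (\<Sum>v=0..l. \<bar>am_coeff l v\<bar> * \<bar>s \<theta>' (max v 1)\<bar>))
        = ennreal e * (\<Sum>v=0..l. ennreal \<bar>am_coeff l v\<bar> * ennreal \<bar>s \<theta>' (max v 1)\<bar>)"
      using e by (simp add: ennreal_mult' sum_nonneg flip: sum_ennreal)
    also have "\<dots> \<le> ennreal e * (\<Sum>v=0..l. ennreal \<bar>am_coeff l v\<bar> * (ennreal B * noise e (max v 1) m n ?w))"
      using noise_v[OF \<theta>'] by (intro mult_left_mono sum_mono) (auto simp: B_def)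
    also have "\<dots> = ennreal B * (ennreal e * (\<Sum>v=0..l. ennreal \<bar>am_coeff l v\<bar> * noise e (max v 1) m n ?w))"
      by (simp add: sum_distrib_left mult_ac)
    also have "\<dots> \<le> ennreal B * ennreal \<tau>1"
      using \<tau>1(1) by (intro mult_left_mono) (simp_all add: m_def t_def)
    also have "\<dots> = ennreal (B * \<tau>1)" using B0 by (simp add: ennreal_mult')
    finally show ?thesis using B0 \<tau>1(2) by (subst (asm) ennreal_le_iff) auto
  qed

  let ?A = "\<lambda>k \<theta>. adams_moulton l b (\<lambda>k. X (real k / real n)) k \<theta>"
  define g where "g = (\<lambda>k. ?A k \<theta> - ?A k \<theta>\<^sub>0)"
  define f where "f = (\<lambda>k. b (x (t k)) \<theta> - b (x (t k)) \<theta>\<^sub>0)"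
  have A_err: "norm (?A k \<theta>' - b (x (t k)) \<theta>') \<le> \<eta>" if k: "l \<le> k" "k \<le> n" and \<theta>': "\<theta>' \<in> \<Theta>" for k \<theta>'
    unfolding \<eta>
  proof (rule norm_adams_moulton_diff_le)
    fix v assume v: "v \<le> l"
    have kv: "k - v \<le> n" using k by simp
    have "norm (X (t (k - v)) - x (t k)) \<le> norm (X (t (k - v)) - x (t (k - v))) + norm (x (t (k - v)) - x (t k))"
      by (rule norm_diff_triangle_ineq[of "X (t (k - v))" "x (t (k - v))" "x (t (k - v))" "x (t k)", simplified])
    also have "\<dots> \<le> \<delta> + D * \<bar>t (k - v) - t k\<bar>"
      using dev[OF t01[OF kv]] D(1)[OF t01[OF kv] t01[OF k(2)]] by linarith
    also have "\<bar>t (k - v) - t k\<bar> = real v / real n"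
      using v k by (simp add: t_def of_nat_diff diff_divide_distrib[symmetric])
    also have "\<delta> + D * (real v / real n) \<le> \<delta> + D * real l / real n"
      using v D0 by (simp add: mult_left_mono divide_right_mono)
    finally have "C * norm (X (t (k - v)) - x (t k)) \<le> C * (\<delta> + D * real l / real n)"
      using C by simp
    then show "norm (b (X (real (k - v) / real n)) \<theta>' - b (x (t k)) \<theta>') \<le> C * (\<delta> + D * real l / real n)"
      using lip[OF \<theta>', of "X (t (k - v))" "x (t k)"] unfolding t_def by linarith
  qed
  have gf: "norm (g k - f k) \<le> 2 * \<eta>" if "l \<le> k" "k \<le> n" for k
  proof -
    have "g k - f k = (?A k \<theta> - b (x (t k)) \<theta>) - (?A k \<theta>\<^sub>0 - b (x (t k)) \<theta>\<^sub>0)"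
      by (simp add: g_def f_def)
    then show ?thesis
      using norm_triangle_ineq4[of "?A k \<theta> - b (x (t k)) \<theta>" "?A k \<theta>\<^sub>0 - b (x (t k)) \<theta>\<^sub>0"]
        A_err[OF that \<theta>(1)] A_err[OF that \<theta>(2)] by simp
  qed
  have f_bnd: "norm (f k) \<le> F" if "k \<le> n" for k unfolding f_def by (rule F[OF t01[OF that]])
  have g_bnd: "norm (g k) \<le> F + 2 * \<eta>" if "l \<le> k" "k \<le> n" for k
    using norm_triangle_sub[of "g k" "f k"] gf[OF that] f_bnd[OF that(2)] by linarith

  \<comment> \<open>The part of the residual at \<open>\<theta>\<^sub>0\<close> due to the drift
    alone; the jumps and the Brownian increments make up the rest.\<close>
  define \<rho> where "\<rho> = (\<lambda>k. IX (t k) - IX (t (k - 1)) - (1 / real n) *\<^sub>R ?A k \<theta>\<^sub>0)"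
  have \<rho>_bnd: "norm (\<rho> k) \<le> (C * \<delta> + C * D / real n + \<eta>) * (1 / real n)" if k: "max l 1 \<le> k" "k \<le> n" for k
  proof -
    have step: "t k - t (k - 1) = 1 / real n" using t_Suc[of "k - 1"] k by simp
    have "norm (IX (t k) - IX (t (k - 1)) - (t k - t (k - 1)) *\<^sub>R ?A k \<theta>\<^sub>0)
      \<le> (C * \<delta> + C * D / real n + \<eta>) * (t k - t (k - 1))"
    proof (rule IX_diff)
      show "0 \<le> t (k - 1)" "t (k - 1) \<le> t k" "t k \<le> 1"
        using t01_pred[of k] t01[of k] t_mono[of "k - 1" k] k by auto
      fix r assume r: "r \<in> {t (k - 1)..t k}"
      then have r01: "r \<in> {0..1}" using t01_pred[of k] t01[of k] k by auto
      have "norm (b (x r) \<theta>\<^sub>0 - b (x (t k)) \<theta>\<^sub>0) \<le> C * (D * (1 / real n))"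
      proof (rule order_trans[OF lip[OF \<theta>(1)]], intro mult_left_mono)
        have "\<bar>r - t k\<bar> \<le> 1 / real n" using r step by auto
        then show "norm (x r - x (t k)) \<le> D * (1 / real n)"
          using D(1)[OF r01 t01[OF k(2)]] D0 mult_left_mono[of "\<bar>r - t k\<bar>" "1 / real n" D] by linarith
      qed (use C in simp)
      moreover have "b (X r) \<theta>\<^sub>0 - ?A k \<theta>\<^sub>0 = (b (X r) \<theta>\<^sub>0 - b (x r) \<theta>\<^sub>0)
          + (b (x r) \<theta>\<^sub>0 - b (x (t k)) \<theta>\<^sub>0) - (?A k \<theta>\<^sub>0 - b (x (t k)) \<theta>\<^sub>0)" by simp
      moreover have "norm (?A k \<theta>\<^sub>0 - b (x (t k)) \<theta>\<^sub>0) \<le> \<eta>" using k by (intro A_err \<theta>) auto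
      ultimately show "norm (b (X r) \<theta>\<^sub>0 - ?A k \<theta>\<^sub>0) \<le> C * \<delta> + C * D / real n + \<eta>"
        using bX[OF r01] norm_triangle_ineq4[of "(b (X r) \<theta>\<^sub>0 - b (x r) \<theta>\<^sub>0) + (b (x r) \<theta>\<^sub>0 - b (x (t k)) \<theta>\<^sub>0)"
            "?A k \<theta>\<^sub>0 - b (x (t k)) \<theta>\<^sub>0"]
          norm_triangle_ineq[of "b (X r) \<theta>\<^sub>0 - b (x r) \<theta>\<^sub>0" "b (x r) \<theta>\<^sub>0 - b (x (t k)) \<theta>\<^sub>0"]
        by simp
    qed
    then show ?thesis by (simp only: step \<rho>_def)
  qed
  define u where "u = (\<lambda>k. X (t k) - X (t (k - 1)) - (1 / real n) *\<^sub>R ?A k \<theta>\<^sub>0)"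
  have u_eq: "u k = \<rho> k + e *\<^sub>R (J (t k) - J (t (k - 1))) + e *\<^sub>R (?w k - ?w (k - 1))" if "k \<le> n" for k
    using X[OF t01[OF that]] X[OF t01, of "k - 1"] that by (simp add: u_def \<rho>_def IX_def algebra_simps)
  let ?I = "{max l 1..n}"
  have card_I: "real (card ?I) \<le> real n" by auto
  have main: "(\<Sum>k\<in>?I. (norm (g k))\<^sup>2) / real n \<le> 2 * (\<Sum>k\<in>?I. inner (u k) (g k))"
    using contrast_le_imp[OF min e n] by (simp add: g_def u_def t_def)
  have part1: "(\<Sum>k\<in>?I. inner (\<rho> k) (g k)) \<le> (C * \<delta> + C * D / real n + \<eta>) * (F + 2 * \<eta>)"
  proof -
    have c0: "0 \<le> C * \<delta> + C * D / real n + \<eta>" using C \<delta>0 D0 \<eta>0 by simp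
    have "(\<Sum>k\<in>?I. inner (\<rho> k) (g k)) \<le> (\<Sum>k\<in>?I. ((C * \<delta> + C * D / real n + \<eta>) * (1 / real n)) * (F + 2 * \<eta>))"
    proof (intro sum_mono)
      fix k assume k: "k \<in> ?I"
      have "inner (\<rho> k) (g k) \<le> norm (\<rho> k) * norm (g k)" by (rule norm_cauchy_schwarz)
      also have "\<dots> \<le> ((C * \<delta> + C * D / real n + \<eta>) * (1 / real n)) * (F + 2 * \<eta>)"
        using k c0 by (intro mult_mono \<rho>_bnd g_bnd) auto
      finally show "inner (\<rho> k) (g k) \<le> ((C * \<delta> + C * D / real n + \<eta>) * (1 / real n)) * (F + 2 * \<eta>)" .
    qed
    also have "\<dots> = (C * \<delta> + C * D / real n + \<eta>) * (F + 2 * \<eta>) * (real (card ?I) / real n)"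
      by (simp only: sum_constant) simp
    also have "\<dots> \<le> (C * \<delta> + C * D / real n + \<eta>) * (F + 2 * \<eta>) * 1"
      using c0 F0 \<eta>0 n0 card_I by (intro mult_left_mono mult_nonneg_nonneg) auto
    finally show ?thesis by simp
  qed
  have part2: "(\<Sum>k\<in>?I. inner (e *\<^sub>R (J (t k) - J (t (k - 1)))) (g k)) \<le> \<zeta> * (F + 2 * \<eta>)"
  proof -
    have "(\<Sum>k\<in>?I. inner (e *\<^sub>R (J (t k) - J (t (k - 1)))) (g k))
       \<le> (\<Sum>k\<in>?I. e * (H (t k) - H (t (k - 1))) * (F + 2 * \<eta>))"
    proof (intro sum_mono)
      fix k assume k: "k \<in> ?I"
      have Jk: "norm (J (t k) - J (t (k - 1))) \<le> H (t k) - H (t (k - 1))"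
        using t01_pred[of k] t01[of k] t_mono[of "k - 1" k] k by (intro J) auto
      have "inner (e *\<^sub>R (J (t k) - J (t (k - 1)))) (g k) \<le> norm (e *\<^sub>R (J (t k) - J (t (k - 1)))) * norm (g k)"
        by (rule norm_cauchy_schwarz)
      also have "\<dots> \<le> e * (H (t k) - H (t (k - 1))) * (F + 2 * \<eta>)"
        using k Jk e order_trans[OF norm_ge_zero Jk] by (intro mult_mono g_bnd) auto
      finally show "inner (e *\<^sub>R (J (t k) - J (t (k - 1)))) (g k) \<le> e * (H (t k) - H (t (k - 1))) * (F + 2 * \<eta>)" .
    qed
    \<comment> \<open>The terms are nonnegative, and only the full range telescopes to
      \<open>H 1 - H 0\<close>.\<close>
    also have "\<dots> \<le> (\<Sum>k\<in>{1..n}. e * (H (t k) - H (t (k - 1))) * (F + 2 * \<eta>))"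
    proof (rule sum_mono2)
      fix k assume "k \<in> {1..n} - ?I"
      then have "norm (J (t k) - J (t (k - 1))) \<le> H (t k) - H (t (k - 1))"
        using t01_pred[of k] t01[of k] t_mono[of "k - 1" k] by (intro J) auto
      then have "0 \<le> H (t k) - H (t (k - 1))" by (rule order_trans[OF norm_ge_zero])
      then show "0 \<le> e * (H (t k) - H (t (k - 1))) * (F + 2 * \<eta>)"
        using e F0 \<eta>0 by (intro mult_nonneg_nonneg) auto
    qed auto
    also have "\<dots> = (\<Sum>k\<in>{1..n}. H (t k) - H (t (k - 1))) * (e * (F + 2 * \<eta>))"
      unfolding sum_distrib_right by (intro sum.cong refl) (simp only: mult_ac)
    also have "(\<Sum>k\<in>{1..n}. H (t k) - H (t (k - 1))) = (\<Sum>j<n. H (t (Suc j)) - H (t j))"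
      by (rule sum.reindex_bij_witness[of _ Suc "\<lambda>k. k - 1"]) auto
    also have "\<dots> = H 1 - H 0"
      using sum_lessThan_telescope[of "\<lambda>j. H (t j)" n] n0 by (simp add: t_def)
    also have "(H 1 - H 0) * (e * (F + 2 * \<eta>)) = e * (H 1 - H 0) * (F + 2 * \<eta>)" by simp
    also have "\<dots> \<le> \<zeta> * (F + 2 * \<eta>)"
      using J(2) F0 \<eta>0 by (intro mult_right_mono) auto
    finally show ?thesis .
  qed
  have part3: "(\<Sum>k\<in>?I. inner (e *\<^sub>R (?w k - ?w (k - 1))) (g k)) \<le> 2 * (B * \<tau>1) + 2 * C * (2 * (e * Wm) * V + \<tau>2)"
  proof -
    define G where "G = (\<lambda>k. b (X (t k)) \<theta> - b (X (t k)) \<theta>\<^sub>0)"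
    define r where "r = (\<lambda>v. \<Sum>k\<in>?I. inner (?w k - ?w (k - 1)) (G (k - v)))"
    have g_G: "g k = (\<Sum>v=0..l. am_coeff l v *\<^sub>R G (k - v))" for k
      by (simp add: g_def G_def adams_moulton_def t_def scaleR_right_diff_distrib sum_subtractf)
    have r_s: "r v = s \<theta> v - s \<theta>\<^sub>0 v" for v
      unfolding r_def sum_from_max_eq s_def sum_subtractf[symmetric] m_def
    proof (intro sum.cong refl)
      fix j
      show "(if j < max l 1 - 1 then 0 else inner (?w (Suc j) - ?w (Suc j - 1)) (G (Suc j - v)))
        = (if j < max l 1 - 1 then 0 else inner (?w (Suc j) - ?w j) (b (X (t (Suc j - v))) \<theta>))
          - (if j < max l 1 - 1 then 0 else inner (?w (Suc j) - ?w j) (b (X (t (Suc j - v))) \<theta>\<^sub>0))"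
        by (cases "j < max l 1 - 1") (simp_all only: if_True if_False diff_self diff_Suc_1 G_def inner_diff_right)
    qed
    \<comment> \<open>The cost of replacing lag 0, whose integrand anticipates the increment, by lag
      1. The factor \<open>2 * C\<close> counts the Lipschitz constants of both drifts.\<close>
    define E where "E = (\<Sum>j<n. norm (?w (Suc j) - ?w j) * (2 * C * norm (X (t (Suc j)) - X (t j))))"
    have r0: "\<bar>r 0\<bar> \<le> \<bar>r 1\<bar> + E"
    proof -
      have "r 0 - r 1 = (\<Sum>k\<in>?I. inner (?w k - ?w (k - 1)) (G k - G (k - 1)))"
        by (simp add: r_def inner_diff_right sum_subtractf)
      also have "\<dots> = (\<Sum>j<n. if j < m then 0 else inner (?w (Suc j) - ?w j) (G (Suc j) - G j))"
        unfolding sum_from_max_eq m_def by (simp only: diff_Suc_1)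
      also have "\<bar>\<dots>\<bar> \<le> E"
        unfolding E_def
      proof (intro order_trans[OF sum_abs] sum_mono)
        fix j
        have "norm (G (Suc j) - G j) \<le> norm (b (X (t (Suc j))) \<theta> - b (X (t j)) \<theta>) + norm (b (X (t (Suc j))) \<theta>\<^sub>0 - b (X (t j)) \<theta>\<^sub>0)"
          unfolding G_def by (rule order_trans[OF eq_refl norm_triangle_ineq4]) (simp add: algebra_simps)
        also have "\<dots> \<le> 2 * C * norm (X (t (Suc j)) - X (t j))"
          using lip[OF \<theta>(1), of "X (t (Suc j))" "X (t j)"] lip[OF \<theta>(2), of "X (t (Suc j))" "X (t j)"] by linarith
        finally have "norm (?w (Suc j) - ?w j) * norm (G (Suc j) - G j) \<le> norm (?w (Suc j) - ?w j) * (2 * C * norm (X (t (Suc j)) - X (t j)))"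
          by (intro mult_left_mono) auto
        then show "\<bar>if j < m then 0 else inner (?w (Suc j) - ?w j) (G (Suc j) - G j)\<bar>
            \<le> norm (?w (Suc j) - ?w j) * (2 * C * norm (X (t (Suc j)) - X (t j)))"
          using Cauchy_Schwarz_ineq2[of "?w (Suc j) - ?w j" "G (Suc j) - G j"] C by auto
      qed
      finally show ?thesis by linarith
    qed
    have E0: "0 \<le> E" unfolding E_def using C by (intro sum_nonneg) auto
    have E_bnd: "e * E \<le> 2 * C * (2 * (e * Wm) * V + \<tau>2)"
    proof -
      \<comment> \<open>An increment of \<open>X\<close> splits into one of \<open>Y\<close> and one
        of \<open>e W\<close>. The first meets a Brownian increment of size at most
        \<open>2 * Wm\<close>, the second produces the quadratic variation.\<close>
      have "e * E \<le> (\<Sum>j<n. 2 * C * (2 * (e * Wm) * (h (t (Suc j)) - h (t j)) + e\<^sup>2 * (norm (?w (Suc j) - ?w j))\<^sup>2))"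
        unfolding E_def sum_distrib_left
      proof (intro sum_mono)
        fix j assume j: "j \<in> {..<n}"
        have tj: "t j \<in> {0..1}" "t (Suc j) \<in> {0..1}" using t01[of j] t01[of "Suc j"] j by auto
        define \<Delta> where "\<Delta> = norm (?w (Suc j) - ?w j)"
        have \<Delta>: "0 \<le> \<Delta>" "\<Delta> \<le> 2 * Wm"
          using norm_triangle_ineq4[of "?w (Suc j)" "?w j"] W(1)[OF tj(1)] W(1)[OF tj(2)] by (auto simp: \<Delta>_def)
        have Yj: "norm (Y (t (Suc j)) - Y (t j)) \<le> h (t (Suc j)) - h (t j)"
          using tj t_mono[of j "Suc j"] by (intro Y_diff) auto
        have "X (t (Suc j)) - X (t j) = (Y (t (Suc j)) - Y (t j)) + e *\<^sub>R (?w (Suc j) - ?w j)"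
          by (simp add: Y_def algebra_simps)
        then have "norm (X (t (Suc j)) - X (t j)) \<le> (h (t (Suc j)) - h (t j)) + e * \<Delta>"
          using norm_triangle_ineq[of "Y (t (Suc j)) - Y (t j)" "e *\<^sub>R (?w (Suc j) - ?w j)"] Yj e by (simp add: \<Delta>_def)
        then have "e * (\<Delta> * (2 * C * norm (X (t (Suc j)) - X (t j)))) \<le> e * (\<Delta> * (2 * C * ((h (t (Suc j)) - h (t j)) + e * \<Delta>)))"
          using e C \<Delta> by (intro mult_left_mono) auto
        also have "\<dots> = 2 * C * (e * \<Delta> * (h (t (Suc j)) - h (t j)) + e\<^sup>2 * \<Delta>\<^sup>2)"
          by (simp add: power2_eq_square algebra_simps)
        also have "\<dots> \<le> 2 * C * (2 * (e * Wm) * (h (t (Suc j)) - h (t j)) + e\<^sup>2 * \<Delta>\<^sup>2)"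
        proof -
          have "e * \<Delta> * (h (t (Suc j)) - h (t j)) \<le> 2 * (e * Wm) * (h (t (Suc j)) - h (t j))"
            using e \<Delta> order_trans[OF norm_ge_zero Yj] by (intro mult_right_mono) auto
          then show ?thesis using C by simp
        qed
        finally show "e * (norm (?w (Suc j) - ?w j) * (2 * C * norm (X (t (Suc j)) - X (t j))))
          \<le> 2 * C * (2 * (e * Wm) * (h (t (Suc j)) - h (t j)) + e\<^sup>2 * (norm (?w (Suc j) - ?w j))\<^sup>2)"
          by (simp add: \<Delta>_def)
      qed
      also have "\<dots> = 2 * C * (2 * (e * Wm) * (\<Sum>j<n. h (t (Suc j)) - h (t j)) + e\<^sup>2 * (\<Sum>j<n. (norm (?w (Suc j) - ?w j))\<^sup>2))"
        by (simp only: sum_distrib_left[symmetric] sum.distrib)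
      also have "(\<Sum>j<n. h (t (Suc j)) - h (t j)) = h 1 - h 0"
        using sum_lessThan_telescope[of "\<lambda>j. h (t j)" n] n0 by (simp add: t_def)
      also have "2 * C * (2 * (e * Wm) * (h 1 - h 0) + e\<^sup>2 * (\<Sum>j<n. (norm (?w (Suc j) - ?w j))\<^sup>2))
          \<le> 2 * C * (2 * (e * Wm) * V + \<tau>2)"
        using C e Wm0 h_V \<tau>2 by (intro mult_left_mono add_mono) (auto simp: t_def)
      finally show ?thesis .
    qed
    have "(\<Sum>k\<in>?I. inner (e *\<^sub>R (?w k - ?w (k - 1))) (g k)) = e * (\<Sum>v=0..l. am_coeff l v * r v)"
    proof -
      have "(\<Sum>k\<in>?I. inner (e *\<^sub>R (?w k - ?w (k - 1))) (g k))
         = (\<Sum>k\<in>?I. \<Sum>v=0..l. e * (am_coeff l v * inner (?w k - ?w (k - 1)) (G (k - v))))"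
        by (simp add: g_G inner_sum_right sum_distrib_left mult_ac)
      also have "\<dots> = (\<Sum>v=0..l. \<Sum>k\<in>?I. e * (am_coeff l v * inner (?w k - ?w (k - 1)) (G (k - v))))"
        by (rule sum.swap)
      finally show ?thesis by (simp add: r_def sum_distrib_left)
    qed
    also have "\<dots> \<le> e * (\<Sum>v=0..l. \<bar>am_coeff l v\<bar> * \<bar>s \<theta> (max v 1)\<bar> + \<bar>am_coeff l v\<bar> * \<bar>s \<theta>\<^sub>0 (max v 1)\<bar>
        + (if v = 0 then E else 0))"
    proof (intro mult_left_mono sum_mono)
      fix v assume v: "v \<in> {0..l}"
      have "am_coeff l v * r v \<le> \<bar>am_coeff l v\<bar> * \<bar>r v\<bar>" by (metis abs_ge_self abs_mult)
      also have "\<dots> \<le> \<bar>am_coeff l v\<bar> * \<bar>r (max v 1)\<bar> + (if v = 0 then E else 0)"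
      proof (cases "v = 0")
        case True
        have "\<bar>am_coeff l 0\<bar> * \<bar>r 0\<bar> \<le> \<bar>am_coeff l 0\<bar> * (\<bar>r 1\<bar> + E)"
          by (intro mult_left_mono r0) auto
        \<comment> \<open>The binomial bound at lag 0 is 1, so \<open>E\<close> enters without a
          power of 2.\<close>
        also have "\<dots> \<le> \<bar>am_coeff l 0\<bar> * \<bar>r 1\<bar> + E"
          using am_coeff_abs_le[of 0 l] mult_right_mono[of "\<bar>am_coeff l 0\<bar>" 1 E] E0 by (simp add: distrib_left)
        finally show ?thesis using True by simp
      next
        case False
        then have "max v 1 = v" by simp
        then show ?thesis using False by simp
      qed
      also have "\<dots> \<le> \<bar>am_coeff l v\<bar> * (\<bar>s \<theta> (max v 1)\<bar> + \<bar>s \<theta>\<^sub>0 (max v 1)\<bar>) + (if v = 0 then E else 0)"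
        unfolding r_s by (intro add_mono mult_left_mono) auto
      finally show "am_coeff l v * r v \<le> \<bar>am_coeff l v\<bar> * \<bar>s \<theta> (max v 1)\<bar>
          + \<bar>am_coeff l v\<bar> * \<bar>s \<theta>\<^sub>0 (max v 1)\<bar> + (if v = 0 then E else 0)"
        by (simp add: distrib_left)
    qed (use e in simp)
    also have "\<dots> = e * (\<Sum>v=0..l. \<bar>am_coeff l v\<bar> * \<bar>s \<theta> (max v 1)\<bar>)
        + e * (\<Sum>v=0..l. \<bar>am_coeff l v\<bar> * \<bar>s \<theta>\<^sub>0 (max v 1)\<bar>) + e * E"
      by (simp add: sum.distrib distrib_left sum.delta)
    also have "\<dots> \<le> B * \<tau>1 + B * \<tau>1 + 2 * C * (2 * (e * Wm) * V + \<tau>2)"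
      by (intro add_mono noise_total \<theta> E_bnd)
    finally show ?thesis by simp
  qed
  define Z where "Z = 2 * ((C * \<delta> + C * D / real n + \<eta>) * (F + 2 * \<eta>)) + 2 * (\<zeta> * (F + 2 * \<eta>))
        + 4 * (B * \<tau>1) + 4 * C * (2 * (e * Wm) * V + \<tau>2)"
  have "(\<Sum>k\<in>?I. inner (u k) (g k)) = (\<Sum>k\<in>?I. inner (\<rho> k) (g k))
      + (\<Sum>k\<in>?I. inner (e *\<^sub>R (J (t k) - J (t (k - 1)))) (g k)) + (\<Sum>k\<in>?I. inner (e *\<^sub>R (?w k - ?w (k - 1))) (g k))"
    unfolding sum.distrib[symmetric] by (intro sum.cong refl) (simp add: u_eq inner_add_left)
  with main part1 part2 part3 have gZ: "(\<Sum>k\<in>?I. (norm (g k))\<^sup>2) / real n \<le> Z"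
    unfolding Z_def by linarith
  \<comment> \<open>Returns from the quadrature to the drift along the limit path; each of the two
    parameters contributes one \<open>\<eta>\<close> to the difference.\<close>
  have f_g: "(norm (f k))\<^sup>2 \<le> 2 * (norm (g k))\<^sup>2 + 8 * \<eta>\<^sup>2" if "k \<in> ?I" for k
  proof -
    have "norm (f k) \<le> norm (g k) + 2 * \<eta>"
      using gf[of k] norm_triangle_sub[of "f k" "g k"] that by (simp add: norm_minus_commute)
    then have "(norm (f k))\<^sup>2 \<le> (norm (g k) + 2 * \<eta>)\<^sup>2" by (intro power_mono) auto
    also have "\<dots> \<le> 2 * (norm (g k))\<^sup>2 + 2 * (2 * \<eta>)\<^sup>2"
      using zero_le_power2[of "norm (g k) - 2 * \<eta>"] unfolding power2_sum power2_diff by linarith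
    finally show ?thesis by (simp add: power_mult_distrib)
  qed
  \<comment> \<open>The contrast says nothing about indices below \<open>max l 1\<close>. There are
    fewer than \<open>l\<close> of them if any, each worth at most \<open>F\<^sup>2\<close>, which
    is the term with \<open>l / n\<close>.\<close>
  have "(\<Sum>k=1..n. (norm (f k))\<^sup>2) \<le> (\<Sum>k\<in>?I. (norm (f k))\<^sup>2) + (\<Sum>k\<in>{1..<max l 1}. (norm (f k))\<^sup>2)"
    by (subst sum.union_disjoint[symmetric]) (auto intro!: sum_mono2)
  also have "\<dots> \<le> (\<Sum>k\<in>?I. 2 * (norm (g k))\<^sup>2 + 8 * \<eta>\<^sup>2) + (\<Sum>k\<in>{1..<max l 1}. F\<^sup>2)"
  proof (intro add_mono sum_mono f_g power_mono f_bnd)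
    fix k assume "k \<in> {1..<max l 1}"
    then show "k \<le> n" using l by (auto simp: max_def split: if_splits)
  qed auto
  also have "\<dots> \<le> 2 * (\<Sum>k\<in>?I. (norm (g k))\<^sup>2) + real n * (8 * \<eta>\<^sup>2) + real l * F\<^sup>2"
  proof -
    have "(\<Sum>k\<in>?I. 8 * \<eta>\<^sup>2) \<le> real n * (8 * \<eta>\<^sup>2)"
      using card_I by (simp only: sum_constant) (intro mult_right_mono, auto)
    moreover have "(\<Sum>k\<in>{1..<max l 1}. F\<^sup>2) \<le> real l * F\<^sup>2"
      by (simp only: sum_constant) (intro mult_right_mono, auto)
    ultimately show ?thesis by (simp add: sum.distrib sum_distrib_left)
  qed
  finally have "(\<Sum>k=1..n. (norm (f k))\<^sup>2) / real n
      \<le> (2 * (\<Sum>k\<in>?I. (norm (g k))\<^sup>2) + real n * (8 * \<eta>\<^sup>2) + real l * F\<^sup>2) / real n"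
    using n0 by (intro divide_right_mono) auto
  also have "\<dots> = 2 * ((\<Sum>k\<in>?I. (norm (g k))\<^sup>2) / real n) + 8 * \<eta>\<^sup>2 + real l / real n * F\<^sup>2"
    using n0 by (simp add: add_divide_distrib)
  also have "\<dots> \<le> 2 * Z + 8 * \<eta>\<^sup>2 + real l / real n * F\<^sup>2"
    using gZ by simp
  finally show ?thesis
    by (simp add: f_def Z_def B_def t_def)
qed

section \<open>Identifiability\<close>

lemma riemann_sum_error_le:
  fixes \<phi> :: "real \<Rightarrow> real"
  assumes lip: "\<And>s t. s \<in> {0..1} \<Longrightarrow> t \<in> {0..1} \<Longrightarrow> \<bar>\<phi> s - \<phi> t\<bar> \<le> c * \<bar>s - t\<bar>" and c: "c \<ge> 0" and n: "n \<ge> 1"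
  shows "integral {0..1} \<phi> \<le> (\<Sum>k=1..n. \<phi> (real k / real n)) / real n + c / real n"
proof -
  have n0: "real n > 0" using n by simp
  have "c-lipschitz_on {0..1} \<phi>"
    using lip c by (intro lipschitz_onI) (auto simp: dist_real_def)
  then have int: "\<phi> integrable_on {0..1}"
    by (intro integrable_continuous_interval lipschitz_on_continuous_on)
  have step: "integral {real k / real n..real (Suc k) / real n} \<phi> \<le> (\<phi> (real (Suc k) / real n) + c / real n) / real n"
    if k: "k < n" for k
  proof -
    let ?a = "real k / real n" and ?b = "real (Suc k) / real n"
    have ab: "0 \<le> ?a" "?a \<le> ?b" "?b \<le> 1" "?b - ?a = 1 / real n"
      using k n0 by (auto simp: divide_right_mono diff_divide_distrib[symmetric])
    have "integral {?a..?b} \<phi> \<le> integral {?a..?b} (\<lambda>_. \<phi> ?b + c / real n)"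
    proof (rule integral_le)
      show "\<phi> integrable_on {?a..?b}"
        using ab by (intro integrable_on_subinterval[OF int]) auto
      fix s assume s: "s \<in> {?a..?b}"
      then have "\<bar>s - ?b\<bar> \<le> 1 / real n" using ab by auto
      then have "c * \<bar>s - ?b\<bar> \<le> c / real n" using mult_left_mono[of "\<bar>s - ?b\<bar>" "1 / real n" c] c by simp
      moreover have "\<bar>\<phi> s - \<phi> ?b\<bar> \<le> c * \<bar>s - ?b\<bar>"
      proof (intro lip)
        show "s \<in> {0..1}" "?b \<in> {0..1}"
          unfolding atLeastAtMost_iff using s[unfolded atLeastAtMost_iff] ab(1-3) by (intro conjI; linarith)+
      qed
      ultimately show "\<phi> s \<le> \<phi> ?b + c / real n" by linarith
    qed (rule integrable_const_ivl)
    then show ?thesis using ab(2,4) by (simp only: integral_const_real) (simp add: mult.commute)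
  qed
  have "integral {0..real m / real n} \<phi> \<le> (\<Sum>k<m. (\<phi> (real (Suc k) / real n) + c / real n) / real n)"
    if "m \<le> n" for m
    using that
  proof (induction m)
    case (Suc m)
    have "0 \<le> real m / real n" "real m / real n \<le> real (Suc m) / real n" "real (Suc m) / real n \<le> 1"
      using Suc.prems n0 by (simp_all add: divide_right_mono del: of_nat_Suc)
    note combine = Henstock_Kurzweil_Integration.integral_combine[OF this(1,2) integrable_on_subinterval[OF int]]
    have "{0..real (Suc m) / real n} \<subseteq> {0..1}"
      using \<open>real (Suc m) / real n \<le> 1\<close> by (simp only: atLeastatMost_subset_iff order_refl simp_thms)
    from combine[OF this] Suc step[of m] Suc_le_lessD[OF Suc.prems]
    show ?case unfolding sum.lessThan_Suc by linarith
  qed simp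
  from this[of n] n0 have "integral {0..1} \<phi> \<le> (\<Sum>k<n. (\<phi> (real (Suc k) / real n) + c / real n) / real n)"
    by simp
  also have "\<dots> = (\<Sum>k<n. \<phi> (real (Suc k) / real n)) / real n + c / real n"
    using n0 by (simp add: sum_divide_distrib add_divide_distrib sum.distrib del: of_nat_Suc)
  also have "(\<Sum>k<n. \<phi> (real (Suc k) / real n)) = (\<Sum>k=1..n. \<phi> (real k / real n))"
    by (rule sum.reindex_bij_witness[of _ "\<lambda>k. k - 1" Suc]) auto
  finally show ?thesis .
qed

text \<open>The integral is continuous in the parameter and attains its minimum on \<open>S\<close>.
  That minimum is not 0, since a nonnegative continuous integrand with zero integral vanishes
  everywhere.\<close>

lemma integral_separation:
  fixes G :: "real \<Rightarrow> 't::heine_borel \<Rightarrow> real"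
  assumes "compact S" and cont: "continuous_on ({0..1} \<times> S) (\<lambda>(t, \<theta>). G t \<theta>)"
    and nonneg: "\<And>t \<theta>. t \<in> {0..1} \<Longrightarrow> \<theta> \<in> S \<Longrightarrow> 0 \<le> G t \<theta>"
    and pos: "\<And>\<theta>. \<theta> \<in> S \<Longrightarrow> \<exists>t\<in>{0..1}. G t \<theta> \<noteq> 0"
  shows "\<exists>\<kappa>>0. \<forall>\<theta>\<in>S. \<kappa> \<le> integral {0..1} (\<lambda>t. G t \<theta>)"
proof (cases "S = {}")
  case False
  have cont': "continuous_on (S \<times> cbox 0 1) (\<lambda>(\<theta>, t). G t \<theta>)"
  proof -
    have "continuous_on (S \<times> cbox 0 1) ((\<lambda>(t, \<theta>). G t \<theta>) \<circ> prod.swap)"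
      by (intro continuous_on_compose continuous_on_swap continuous_on_subset[OF cont]) auto
    then show ?thesis by (simp add: o_def split_beta)
  qed
  have "continuous_on S (\<lambda>\<theta>. integral (cbox 0 1) (\<lambda>t. G t \<theta>))"
    by (rule integral_continuous_on_param) (use cont' in \<open>simp add: split_beta\<close>)
  then obtain \<theta>\<^sub>m where \<theta>\<^sub>m: "\<theta>\<^sub>m \<in> S" "\<And>\<theta>. \<theta> \<in> S \<Longrightarrow> integral (cbox 0 1) (\<lambda>t. G t \<theta>\<^sub>m) \<le> integral (cbox 0 1) (\<lambda>t. G t \<theta>)"
    using continuous_attains_inf[OF \<open>compact S\<close> False] by blast
  have contm: "continuous_on {0..1} (\<lambda>t. G t \<theta>\<^sub>m)"
    using \<theta>\<^sub>m(1) by (intro continuous_on_compose2[OF cont, of _ "\<lambda>t. (t, \<theta>\<^sub>m)", simplified] continuous_intros) auto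
  have "integral {0..1} (\<lambda>t. G t \<theta>\<^sub>m) \<noteq> 0"
  proof
    assume "integral {0..1} (\<lambda>t. G t \<theta>\<^sub>m) = 0"
    then have "\<forall>t\<in>{0..1}. G t \<theta>\<^sub>m = 0"
      using integral_eq_0_iff[OF contm] nonneg \<theta>\<^sub>m(1) by auto
    with pos[OF \<theta>\<^sub>m(1)] show False by blast
  qed
  moreover have "0 \<le> integral {0..1} (\<lambda>t. G t \<theta>\<^sub>m)"
    using nonneg \<theta>\<^sub>m(1) by (intro integral_nonneg integrable_continuous_interval contm) auto
  ultimately have "0 < integral {0..1} (\<lambda>t. G t \<theta>\<^sub>m)" by linarith
  then show ?thesis using \<theta>\<^sub>m(2) by (auto simp: cbox_interval)
qed (auto intro: exI[of _ 1])

text \<open>\<open>T i\<close> need only be small in probability and the remainder only negligible pathwise, so no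
  measurability of suprema over the path is ever needed.\<close>

lemma (in prob_space) prob_tendsto_0_split:
  assumes A: "\<And>i. A i \<in> events" and T: "\<And>i. T i \<in> events" and lim: "(\<lambda>i. prob (T i)) \<longlonglongrightarrow> 0"
    and AE: "AE \<omega> in M. eventually (\<lambda>i. \<omega> \<in> A i \<longrightarrow> \<omega> \<in> T i) sequentially"
  shows "(\<lambda>i. prob (A i)) \<longlonglongrightarrow> 0"
proof -
  have D: "A i - T i \<in> events" for i using A T by auto
  \<comment> \<open>On almost every path the indicator is eventually 0, so dominated convergence
    applies even though the index from which this holds is random.\<close>
  have "(\<lambda>i. expectation (indicat_real (A i - T i))) \<longlonglongrightarrow> expectation (\<lambda>_. 0 :: real)"
  proof (rule integral_dominated_convergence[where w = "\<lambda>_. 1"])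
    show "AE \<omega> in M. (\<lambda>i. indicat_real (A i - T i) \<omega>) \<longlonglongrightarrow> 0"
      using AE
    proof eventually_elim
      case (elim \<omega>)
      then have "eventually (\<lambda>i. indicat_real (A i - T i) \<omega> = 0) sequentially"
        by eventually_elim (auto simp: indicator_def)
      then show ?case by (rule tendsto_eventually)
    qed
  qed (use D in \<open>auto split: split_indicator\<close>)
  then have "(\<lambda>i. prob (A i - T i)) \<longlonglongrightarrow> 0" using D by simp
  from tendsto_add[OF this lim] have "(\<lambda>i. prob (A i - T i) + prob (T i)) \<longlonglongrightarrow> 0" by simp
  moreover have "eventually (\<lambda>i. prob (A i) \<le> prob (A i - T i) + prob (T i)) sequentially"
  proof (intro always_eventually allI)
    fix i
    have "prob (A i) \<le> prob ((A i - T i) \<union> T i)" using A T by (intro finite_measure_mono) auto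
    also have "\<dots> \<le> prob (A i - T i) + prob (T i)" using D T by (intro measure_Un_le)
    finally show "prob (A i) \<le> prob (A i - T i) + prob (T i)" .
  qed
  ultimately show ?thesis
    by (intro tendsto_sandwich[where f = "\<lambda>_. 0" and g = "\<lambda>i. prob (A i)", OF _ _ tendsto_const]) auto
qed

section \<open>Consistency\<close>

context prob_space begin

text \<open>Markov's inequality with a strict event, so that its complement directly supplies
  \<open>Z \<omega> \<le> ennreal \<tau>\<close>.\<close>

lemma prob_gt_le:
  assumes Z: "Z \<in> borel_measurable M" and le: "(\<integral>\<^sup>+\<omega>. Z \<omega> \<partial>M) \<le> ennreal E" and "\<tau> > 0" "0 \<le> E"
  shows "prob {\<omega> \<in> space M. ennreal \<tau> < Z \<omega>} \<le> E / \<tau>"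
proof -
  let ?S = "{\<omega> \<in> space M. ennreal \<tau> < Z \<omega>}"
  have S: "?S \<in> events" using Z by measurable
  have "ennreal (\<tau> * prob ?S) = ennreal \<tau> * emeasure M ?S"
    using \<open>\<tau> > 0\<close> by (simp add: emeasure_eq_measure ennreal_mult')
  also have "\<dots> = (\<integral>\<^sup>+\<omega>. ennreal \<tau> * indicator ?S \<omega> \<partial>M)"
    using S by (simp add: nn_integral_cmult_indicator)
  also have "\<dots> \<le> (\<integral>\<^sup>+\<omega>. Z \<omega> \<partial>M)"
    by (intro nn_integral_mono) (auto split: split_indicator)
  also note le
  finally have "\<tau> * prob ?S \<le> E" using \<open>0 \<le> E\<close> by (simp add: ennreal_le_iff)
  then show ?thesis using \<open>\<tau> > 0\<close> by (simp add: field_simps)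
qed

lemma brownian_increments:
  fixes B :: "real \<Rightarrow> 'a \<Rightarrow> real ^ 'r::finite" and \<sigma> :: "real ^ 'r ^ 'd::finite"
  assumes B: "standard_brownian_motion B" and n: "n \<ge> 1"
  defines "\<xi> \<equiv> \<lambda>j \<omega>. \<sigma> *v (B (real (Suc j) / real n) \<omega> - B (real j / real n) \<omega>)"
    and "K \<equiv> (onorm ((*v) \<sigma>))\<^sup>2 * real CARD('r)"
  shows "indep_vars (\<lambda>_. borel) \<xi> {..<m}"
    and "integrable M (\<lambda>\<omega>. \<xi> j \<omega> $ i)" "expectation (\<lambda>\<omega>. \<xi> j \<omega> $ i) = 0"
    and "integrable M (\<lambda>\<omega>. (\<xi> j \<omega> $ i)\<^sup>2)" "expectation (\<lambda>\<omega>. (\<xi> j \<omega> $ i)\<^sup>2) \<le> K / real n"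
    and "integrable M (\<lambda>\<omega>. (norm (\<xi> j \<omega>))\<^sup>2)" "expectation (\<lambda>\<omega>. (norm (\<xi> j \<omega>))\<^sup>2) \<le> K / real n"
proof -
  have n0: "real n > 0" using n by simp
  have "mono (\<lambda>k. real k / real n)" using n0 by (auto simp: mono_def divide_right_mono)
  then have "indep_vars (\<lambda>_. borel) (\<lambda>k \<omega>. B (real (Suc k) / real n) \<omega> - B (real k / real n) \<omega>) {..<m}"
    using B unfolding standard_brownian_motion_def by (elim conjE allE[of _ "\<lambda>k. real k / real n"]) auto
  then show "indep_vars (\<lambda>_. borel) \<xi> {..<m}"
    unfolding \<xi>_def
    by (rule indep_vars_compose2)
      (intro borel_measurable_continuous_onI linear_continuous_on matrix_vector_mul_bounded_linear)
  have lt: "real j / real n < real (Suc j) / real n" using n0 by (simp add: divide_strict_right_mono)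
  have diff: "real (Suc j) / real n - real j / real n = 1 / real n"
    by (simp add: diff_divide_distrib[symmetric])
  have "distributed M lborel (\<lambda>\<omega>. B (real (Suc j) / real n) \<omega> - B (real j / real n) \<omega>)
      (\<lambda>x. ennreal (\<Prod>i\<in>UNIV. normal_density 0 (sqrt (1 / real n)) (x $ i)))"
    using B lt unfolding standard_brownian_motion_def diff[symmetric] by auto
  note mom = linear_image_moments[OF this, of \<sigma>]
  have s: "sqrt (1 / real n) > 0" "(sqrt (1 / real n))\<^sup>2 = 1 / real n" using n0 by simp_all
  show "integrable M (\<lambda>\<omega>. \<xi> j \<omega> $ i)" "expectation (\<lambda>\<omega>. \<xi> j \<omega> $ i) = 0"
    "integrable M (\<lambda>\<omega>. (\<xi> j \<omega> $ i)\<^sup>2)" "integrable M (\<lambda>\<omega>. (norm (\<xi> j \<omega>))\<^sup>2)"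
    unfolding \<xi>_def using mom(1-3,5) s(1) by auto
  show "expectation (\<lambda>\<omega>. (\<xi> j \<omega> $ i)\<^sup>2) \<le> K / real n" "expectation (\<lambda>\<omega>. (norm (\<xi> j \<omega>))\<^sup>2) \<le> K / real n"
    unfolding \<xi>_def K_def using mom(4)[OF s(1)] mom(6)[OF s(1)] s(2) by simp_all
qed

text \<open>Variances of order 1 / n summed over n increments leave bounds free of n. The
  coefficients contribute \<open>2 ^ l\<close> to the first quantity only.\<close>

lemma expectation_total_noise_le:
  fixes B :: "real \<Rightarrow> 'a \<Rightarrow> real ^ 'r::finite" and \<sigma> :: "real ^ 'r ^ 'd::finite" and l m n :: nat
  assumes B: "standard_brownian_motion B" and n: "n \<ge> 1" and e: "e > 0"
  defines "\<xi> \<equiv> \<lambda>j \<omega>. \<sigma> *v (B (real (Suc j) / real n) \<omega> - B (real j / real n) \<omega>)"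
    and "K \<equiv> (onorm ((*v) \<sigma>))\<^sup>2 * real CARD('r)"
  defines "Z \<equiv> \<lambda>\<omega>. ennreal e * (\<Sum>v=0..l. ennreal \<bar>am_coeff l v\<bar> * noise e (max v 1) m n (\<lambda>j. \<Sum>i<j. \<xi> i \<omega>))"
    and "Q \<equiv> \<lambda>\<omega>. ennreal (e\<^sup>2 * (\<Sum>j<n. (norm (\<xi> j \<omega>))\<^sup>2))"
  shows "Z \<in> borel_measurable M" "Q \<in> borel_measurable M"
    and "(\<integral>\<^sup>+\<omega>. Z \<omega> \<partial>M) \<le> ennreal (exp (real CARD('d)) * (real CARD('d) * (1 + 4 * K)) * (2 ^ l * e))"
    and "(\<integral>\<^sup>+\<omega>. Q \<omega> \<partial>M) \<le> ennreal (K * e\<^sup>2)"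
proof -
  have n0: "real n > 0" using n by simp
  have K: "0 \<le> K" by (simp add: K_def)
  have \<xi>_eq: "\<sigma> *v (B (real (Suc j) / real n) \<omega> - B (real j / real n) \<omega>) = \<xi> j \<omega>" for j \<omega>
    by (simp add: \<xi>_def)
  note inc = brownian_increments[OF B n, of \<sigma>, folded \<xi>_def K_def, unfolded \<xi>_eq]
  let ?c = "exp (real CARD('d)) * (real CARD('d) * (1 + 4 * K))"
  have c: "0 \<le> ?c" using K by simp
  have noise: "(\<lambda>\<omega>. noise e (max v 1) m n (\<lambda>j. \<Sum>i<j. \<xi> i \<omega>)) \<in> borel_measurable M"
    "(\<integral>\<^sup>+\<omega>. noise e (max v 1) m n (\<lambda>j. \<Sum>i<j. \<xi> i \<omega>) \<partial>M) \<le> ennreal ?c" for v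
    using expectation_noise_le[OF inc(1,2,3,4,5), where v = "max v 1" and e = e and m = m and n = n] K n0 by simp_all
  show "Z \<in> borel_measurable M" unfolding Z_def using noise(1) by measurable
  have "(\<integral>\<^sup>+\<omega>. Z \<omega> \<partial>M) = ennreal e * (\<Sum>v=0..l. ennreal \<bar>am_coeff l v\<bar> *
      (\<integral>\<^sup>+\<omega>. noise e (max v 1) m n (\<lambda>j. \<Sum>i<j. \<xi> i \<omega>) \<partial>M))"
    unfolding Z_def using noise(1) by (simp add: nn_integral_cmult nn_integral_sum)
  also have "\<dots> \<le> ennreal e * (\<Sum>v=0..l. ennreal \<bar>am_coeff l v\<bar> * ennreal ?c)"
    by (intro mult_left_mono sum_mono noise(2)) auto
  also have "\<dots> = ennreal (e * ((\<Sum>v=0..l. \<bar>am_coeff l v\<bar>) * ?c))"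
    using e c by (simp add: ennreal_mult'' ennreal_mult' sum_nonneg flip: sum_distrib_right sum_ennreal)
  also have "\<dots> \<le> ennreal (e * (2 ^ l * ?c))"
    using e c by (intro ennreal_leI mult_left_mono mult_right_mono sum_abs_am_coeff_le) auto
  finally show "(\<integral>\<^sup>+\<omega>. Z \<omega> \<partial>M) \<le> ennreal (?c * (2 ^ l * e))" by (simp add: mult_ac)
  have int: "integrable M (\<lambda>\<omega>. e\<^sup>2 * (\<Sum>j<n. (norm (\<xi> j \<omega>))\<^sup>2))"
    using inc(6) by (intro integrable_mult_right Bochner_Integration.integrable_sum) auto
  show "Q \<in> borel_measurable M"
    unfolding Q_def using borel_measurable_integrable[OF int] by simp
  have "(\<integral>\<^sup>+\<omega>. Q \<omega> \<partial>M) = ennreal (expectation (\<lambda>\<omega>. e\<^sup>2 * (\<Sum>j<n. (norm (\<xi> j \<omega>))\<^sup>2)))"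
    unfolding Q_def by (intro nn_integral_eq_integral int AE_I2 mult_nonneg_nonneg sum_nonneg) auto
  also have "expectation (\<lambda>\<omega>. e\<^sup>2 * (\<Sum>j<n. (norm (\<xi> j \<omega>))\<^sup>2)) = e\<^sup>2 * (\<Sum>j<n. expectation (\<lambda>\<omega>. (norm (\<xi> j \<omega>))\<^sup>2))"
    using inc(6) by simp
  also have "\<dots> \<le> e\<^sup>2 * (\<Sum>j<n. K / real n)"
    by (intro mult_left_mono sum_mono inc(7)) auto
  also have "\<dots> = K * e\<^sup>2" using n0 by simp
  finally show "(\<integral>\<^sup>+\<omega>. Q \<omega> \<partial>M) \<le> ennreal (K * e\<^sup>2)" by (simp add: ennreal_leI)
qed

end

lemma continuous_on_Icc_norm_bound:
  fixes f :: "real \<Rightarrow> 'b::real_normed_vector"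
  assumes "continuous_on {a..b} f"
  obtains K where "\<And>t. t \<in> {a..b} \<Longrightarrow> norm (f t) \<le> K"
proof -
  have "bounded (f ` {a..b})"
    by (intro compact_imp_bounded compact_continuous_image assms compact_Icc)
  then obtain K where "\<forall>y\<in>f ` {a..b}. norm y \<le> K" unfolding bounded_iff by blast
  then show ?thesis by (intro that) blast
qed

text \<open>With c bounding l 2 ^ (2 l) / n, the squares are easy: (l / n)^2 is at most c / n, and
  (2 ^ l l / n)^2 is at most c l / n.\<close>

lemma order_limits:
  fixes l n :: "nat \<Rightarrow> nat"
  assumes n: "\<And>i. n i \<ge> 1" "filterlim n at_top sequentially"
    and bd: "Bseq (\<lambda>i. real (l i) * 2 ^ (2 * l i) / real (n i))"
  shows "(\<lambda>i. 1 / real (n i)) \<longlonglongrightarrow> 0" "(\<lambda>i. real (l i) / real (n i)) \<longlonglongrightarrow> 0"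
    "(\<lambda>i. 2 ^ l i * (real (l i) / real (n i))) \<longlonglongrightarrow> 0"
proof -
  obtain c where c: "c > 0" "\<And>i. real (l i) * 2 ^ (2 * l i) / real (n i) \<le> c"
    using bd unfolding Bseq_def by (auto simp: abs_le_iff)
  have n0: "real (n i) > 0" for i using n(1)[of i] by simp
  have "filterlim (\<lambda>i. real (n i)) at_top sequentially"
    by (rule filterlim_compose[OF filterlim_real_sequentially n(2)])
  then show inv: "(\<lambda>i. 1 / real (n i)) \<longlonglongrightarrow> 0"
    using tendsto_inverse_0_at_top by (auto simp: inverse_eq_divide)
  have sq: "(\<lambda>i. a i) \<longlonglongrightarrow> 0" if "\<And>i. 0 \<le> a i" "\<And>i. (a i)\<^sup>2 \<le> z i" "z \<longlonglongrightarrow> 0" for a z :: "nat \<Rightarrow> real"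
  proof -
    have "(\<lambda>i. (a i)\<^sup>2) \<longlonglongrightarrow> 0"
      by (rule tendsto_sandwich[OF _ _ tendsto_const that(3)]) (use that(2) in auto)
    from tendsto_real_sqrt[OF this] show ?thesis using that(1) by simp
  qed
  show l_lim: "(\<lambda>i. real (l i) / real (n i)) \<longlonglongrightarrow> 0"
  proof (rule sq)
    fix i
    have "real (l i) \<le> 2 ^ (2 * l i)"
    proof -
      have "l i \<le> 2 ^ l i" using less_exp[of "l i"] by linarith
      also have "(2::nat) ^ l i \<le> 2 ^ (2 * l i)" by (intro power_increasing) auto
      finally show ?thesis by (metis of_nat_le_iff of_nat_numeral of_nat_power)
    qed
    then have "real (l i) * real (l i) / real (n i) \<le> real (l i) * 2 ^ (2 * l i) / real (n i)"
      by (intro divide_right_mono mult_left_mono) auto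
    also note c(2)[of i]
    finally have "real (l i) * real (l i) / real (n i) * (1 / real (n i)) \<le> c * (1 / real (n i))"
      by (intro mult_right_mono) auto
    then show "(real (l i) / real (n i))\<^sup>2 \<le> c * (1 / real (n i))"
      by (simp add: power2_eq_square)
  qed (use tendsto_mult_right_zero[OF inv] in auto)
  show "(\<lambda>i. 2 ^ l i * (real (l i) / real (n i))) \<longlonglongrightarrow> 0"
  proof (rule sq)
    fix i
    have "(2 ^ l i * (real (l i) / real (n i)))\<^sup>2 = (real (l i) * 2 ^ (2 * l i) / real (n i)) * (real (l i) / real (n i))"
      by (simp add: power2_eq_square power_mult power_mult_distrib[symmetric] mult_ac)
    also have "\<dots> \<le> c * (real (l i) / real (n i))"
      by (intro mult_right_mono c) auto
    finally show "(2 ^ l i * (real (l i) / real (n i)))\<^sup>2 \<le> c * (real (l i) / real (n i))" .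
  qed (use tendsto_mult_right_zero[OF l_lim] in auto)
qed

theorem theorem3p1:
  fixes M :: "'w measure"
    and \<Theta>\<^sub>0 \<Theta> :: "(real ^ 'p::finite) set" and \<theta>\<^sub>0 :: "real ^ 'p"
    and b :: "real ^ 'd::finite \<Rightarrow> real ^ 'p \<Rightarrow> real ^ 'd"
    and a x\<^sub>0 :: "real ^ 'd" and \<sigma> :: "real ^ 'r::finite ^ 'd"
    and \<nu> :: "(real ^ 'd) measure"
    and B :: "real \<Rightarrow> 'w \<Rightarrow> real ^ 'r"
    and N :: "'w \<Rightarrow> (real \<times> (real ^ 'd)) measure"
    and X :: "real \<Rightarrow> real \<Rightarrow> 'w \<Rightarrow> real ^ 'd"
    and x :: "real \<Rightarrow> real ^ 'd"
    and n l :: "nat \<Rightarrow> nat" and \<epsilon> :: "nat \<Rightarrow> real"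
    and \<theta>hat :: "nat \<Rightarrow> 'w \<Rightarrow> real ^ 'p"
  assumes M: "prob_space M"
    and \<Theta>\<^sub>0: "smooth_domain \<Theta>\<^sub>0" "bounded \<Theta>\<^sub>0" "open \<Theta>\<^sub>0" "convex \<Theta>\<^sub>0"
    and \<Theta>: "\<Theta> = closure \<Theta>\<^sub>0"
    and \<theta>\<^sub>0: "\<theta>\<^sub>0 \<in> \<Theta>\<^sub>0"
    and \<nu>: "levy_measure \<nu>" "(\<integral>\<^sup>+z. ennreal (norm z) \<partial>\<nu>) < \<infinity>"
    and B: "prob_space.standard_brownian_motion M B"
    and N: "prob_space.poisson_random_measure M (jump_intensity \<nu>) N"
    and BN: "prob_space.indep_process_random_measure M B (jump_intensity \<nu>) N"
    and X: "\<And>e. e > 0 \<Longrightarrow>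
          prob_space.solves_sde M (\<lambda>y. b y \<theta>\<^sub>0) e (levy_ito a \<sigma> \<nu> B N) x\<^sub>0 (X e)"
    and x: "x 0 = x\<^sub>0"
           "\<And>t. t \<ge> 0 \<Longrightarrow> (x has_vector_derivative b (x t) \<theta>\<^sub>0) (at t within {0..})"
    and b1: "\<exists>C>0. \<forall>y z. \<forall>\<theta>\<in>\<Theta>. norm (b y \<theta> - b z \<theta>) \<le> C * norm (y - z)"
    and b2: "C_inf_0 \<Theta> b" "\<And>R. R > 0 \<Longrightarrow> C_inf_0_norm (cball 0 R) \<Theta> b < \<infinity>"
    and b3: "\<And>y \<theta>. \<theta> \<in> \<Theta>\<^sub>0 \<Longrightarrow> b y differentiable (at \<theta>)"
            "\<And>j. \<exists>C. \<forall>\<theta>\<in>\<Theta>\<^sub>0. C-lipschitz_on UNIV (\<lambda>y. partial_deriv j (b y) \<theta>)"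
    and b4: "\<And>\<theta>. \<theta> \<in> \<Theta> \<Longrightarrow> \<theta> \<noteq> \<theta>\<^sub>0 \<Longrightarrow> \<exists>t\<in>{0..1}. b (x t) \<theta> \<noteq> b (x t) \<theta>\<^sub>0"
    and n: "\<And>i. n i \<ge> 1" "filterlim n at_top sequentially"
    and \<epsilon>: "\<And>i. \<epsilon> i > 0" "\<epsilon> \<longlonglongrightarrow> 0"
    and l: "\<And>i. l i \<le> n i"
           "(\<lambda>i. 2 ^ l i * \<epsilon> i) \<longlonglongrightarrow> 0"
           "Bseq (\<lambda>i. real (l i) * 2 ^ (2 * l i) / real (n i))"
    and \<theta>hat: "\<And>i. \<theta>hat i \<in> borel_measurable M"
           "\<And>i \<omega>. \<omega> \<in> space M \<Longrightarrow>
              is_arg_min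
                (contrast b (n i) (\<epsilon> i) (l i) (\<lambda>k. X (\<epsilon> i) (real k / real (n i)) \<omega>))
                (\<lambda>\<theta>. \<theta> \<in> \<Theta>) (\<theta>hat i \<omega>)"
  shows "prob_space.tendsto_in_probability M \<theta>hat \<theta>\<^sub>0"
proof -
  interpret prob_space M by (rule M)
  let ?d = "real CARD('d)"
  have compact: "compact \<Theta>" and \<theta>0: "\<theta>\<^sub>0 \<in> \<Theta>"
    using \<Theta>\<^sub>0(2) \<theta>\<^sub>0 closure_subset[of \<Theta>\<^sub>0] unfolding \<Theta> by auto
  obtain C where C: "C > 0" and lip: "\<And>y z \<theta>. \<theta> \<in> \<Theta> \<Longrightarrow> norm (b y \<theta> - b z \<theta>) \<le> C * norm (y - z)"
    using b1 by blast
  have contx: "continuous_on {0..1} x"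
    by (rule continuous_on_subset[OF continuous_on_vector_derivative[OF x(2)]]) auto
  have contb: "continuous_on (UNIV \<times> \<Theta>) (\<lambda>(y, \<theta>). b y \<theta>)"
    using b2(1) unfolding C_inf_0_def by (elim conjE allE[of _ "[]"]) simp
  have smooth: "smooth_on UNIV (\<lambda>y. b y \<theta>)" if "\<theta> \<in> \<Theta>" for \<theta>
    using b2(1) that by (auto simp: C_inf_0_def)
  have contbx: "continuous_on {0..1} (\<lambda>t. b (x t) \<theta>)" if "\<theta> \<in> \<Theta>" for \<theta>
    using that by (intro continuous_on_compose2[OF contb, of _ "\<lambda>t. (x t, \<theta>)", simplified] continuous_intros contx) auto
  obtain D where D: "\<And>t. t \<in> {0..1} \<Longrightarrow> norm (b (x t) \<theta>\<^sub>0) \<le> D"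
    by (rule continuous_on_Icc_norm_bound[OF contbx[OF \<theta>0]]) blast
  have D0: "0 \<le> D" using order_trans[OF norm_ge_zero D[of 0]] by simp
  have x_lip: "norm (x s - x t) \<le> D * \<bar>s - t\<bar>" if st: "s \<in> {0..1}" "t \<in> {0..1}" for s t
  proof -
    have "norm (x s - x t) \<le> D * norm (s - t)"
    proof (rule differentiable_bound[where S = "{0..1}"])
      fix r :: real assume r: "r \<in> {0..1}"
      then show "(x has_derivative (\<lambda>h. h *\<^sub>R b (x r) \<theta>\<^sub>0)) (at r within {0..1})"
        using has_vector_derivative_within_subset[OF x(2)[of r], of "{0..1}"] by (auto simp: has_vector_derivative_def)
      show "onorm (\<lambda>h. h *\<^sub>R b (x r) \<theta>\<^sub>0) \<le> D"
      proof (rule onorm_le)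
        fix h :: real
        show "norm (h *\<^sub>R b (x r) \<theta>\<^sub>0) \<le> D * norm h"
          using mult_right_mono[OF D[OF r] abs_ge_zero[of h]] by (simp add: mult.commute)
      qed
    qed (use st in auto)
    then show ?thesis by simp
  qed
  obtain R\<^sub>0 where R0: "\<And>t. t \<in> {0..1} \<Longrightarrow> norm (x t) \<le> R\<^sub>0"
    by (rule continuous_on_Icc_norm_bound[OF contx]) blast
  \<comment> \<open>One unit of room for the deviation of \<open>X\<close> from \<open>x\<close>,
    and one for removing \<epsilon> W.\<close>
  define R where "R = R\<^sub>0 + 2"
  have R_pos: "R > 0" using order_trans[OF norm_ge_zero R0[of 0]] by (simp add: R_def)
  define K where "K = enn2real (C_inf_0_norm (cball 0 R) \<Theta> b)"
  have K0: "0 \<le> K" by (simp add: K_def)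
  have K: "norm (iter_partial js (\<lambda>y. b y \<theta>) z) \<le> K" if "\<theta> \<in> \<Theta>" "z \<in> cball 0 R" for js \<theta> z
  proof -
    have "ennreal (norm (iter_partial js (\<lambda>y. b y \<theta>) z)) \<le> C_inf_0_norm (cball 0 R) \<Theta> b"
      unfolding C_inf_0_norm_def
      by (intro SUP_upper2[of js] UNIV_I SUP_upper2[of "(z, \<theta>)"]) (use that in auto)
    also have "\<dots> = ennreal K"
      unfolding K_def using b2(2)[OF R_pos] by (simp add: ennreal_enn2real_if)
    finally show ?thesis using K0 by (simp add: ennreal_le_iff)
  qed
  have F: "norm (b (x t) \<theta> - b (x t) \<theta>\<^sub>0) \<le> 2 * K" if "t \<in> {0..1}" "\<theta> \<in> \<Theta>" for t \<theta>
  proof -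
    have "x t \<in> cball 0 R" using R0[OF that(1)] by (simp add: R_def)
    then show ?thesis
      using norm_triangle_ineq4[of "b (x t) \<theta>" "b (x t) \<theta>\<^sub>0"] K[of \<theta> "x t" "[]"] K[of \<theta>\<^sub>0 "x t" "[]"] that \<theta>0 by simp
  qed
  define G where "G = (\<lambda>t \<theta>. (norm (b (x t) \<theta> - b (x t) \<theta>\<^sub>0))\<^sup>2)"
  \<comment> \<open>The Lipschitz constant of \<open>G\<close> in time: \<open>2 * C * D\<close> for
    the norm, times \<open>4 * K\<close> from the difference of squares.\<close>
  define c where "c = 8 * K * C * D"
  have c0: "0 \<le> c" using K0 C D0 by (simp add: c_def)
  have G_lip: "\<bar>G s \<theta> - G t \<theta>\<bar> \<le> c * \<bar>s - t\<bar>" if st: "s \<in> {0..1}" "t \<in> {0..1}" and \<theta>: "\<theta> \<in> \<Theta>" for s t \<theta>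
  proof -
    let ?u = "b (x s) \<theta> - b (x s) \<theta>\<^sub>0" and ?v = "b (x t) \<theta> - b (x t) \<theta>\<^sub>0"
    have eq: "?u - ?v = (b (x s) \<theta> - b (x t) \<theta>) - (b (x s) \<theta>\<^sub>0 - b (x t) \<theta>\<^sub>0)" by simp
    have "norm (?u - ?v) \<le> 2 * C * norm (x s - x t)"
      unfolding eq using norm_triangle_ineq4[of "b (x s) \<theta> - b (x t) \<theta>" "b (x s) \<theta>\<^sub>0 - b (x t) \<theta>\<^sub>0"]
        lip[OF \<theta>, of "x s" "x t"] lip[OF \<theta>0, of "x s" "x t"] by linarith
    also have "\<dots> \<le> 2 * C * (D * \<bar>s - t\<bar>)"
      using x_lip[OF st] C by (intro mult_left_mono) auto
    finally have uv: "\<bar>norm ?u - norm ?v\<bar> \<le> 2 * C * (D * \<bar>s - t\<bar>)"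
      using norm_triangle_ineq3[of ?u ?v] by linarith
    have "\<bar>G s \<theta> - G t \<theta>\<bar> = \<bar>norm ?u - norm ?v\<bar> * (norm ?u + norm ?v)"
      by (simp add: G_def power2_eq_square square_diff_square_factored abs_mult)
    also have "\<dots> \<le> (2 * C * (D * \<bar>s - t\<bar>)) * (2 * K + 2 * K)"
      using C D0 by (intro mult_mono uv add_mono F st \<theta>) auto
    finally show ?thesis by (simp add: c_def mult_ac)
  qed
  define \<kappa>\<^sub>\<sigma> where "\<kappa>\<^sub>\<sigma> = (onorm ((*v) \<sigma>))\<^sup>2 * real CARD('r)"
  \<comment> \<open>Bounds \<open>D + C * \<delta> i + \<zeta> i\<close> as soon as
    \<open>\<delta> i\<close> and \<open>\<zeta> i\<close> are below 1, and does not depend on the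
    path; hence \<tau> below can be deterministic.\<close>
  define V where "V = D + C + 1"
  define \<xi> where "\<xi> = (\<lambda>i j \<omega>. \<sigma> *v (B (real (Suc j) / real (n i)) \<omega> - B (real j / real (n i)) \<omega>))"
  define Z where "Z = (\<lambda>i \<omega>. ennreal (\<epsilon> i) * (\<Sum>v=0..l i. ennreal \<bar>am_coeff (l i) v\<bar> *
     noise (\<epsilon> i) (max v 1) (max (l i) 1 - 1) (n i) (\<lambda>j. \<Sum>k<j. \<xi> i k \<omega>)))"
  define Q where "Q = (\<lambda>i \<omega>. ennreal ((\<epsilon> i)\<^sup>2 * (\<Sum>j<n i. (norm (\<xi> i j \<omega>))\<^sup>2)))"
  define E\<^sub>1 where "E\<^sub>1 = (\<lambda>i. exp ?d * (?d * (1 + 4 * \<kappa>\<^sub>\<sigma>)) * (2 ^ l i * \<epsilon> i))"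
  have noise: "Z i \<in> borel_measurable M" "Q i \<in> borel_measurable M"
    "(\<integral>\<^sup>+\<omega>. Z i \<omega> \<partial>M) \<le> ennreal (E\<^sub>1 i)" "(\<integral>\<^sup>+\<omega>. Q i \<omega> \<partial>M) \<le> ennreal (\<kappa>\<^sub>\<sigma> * (\<epsilon> i)\<^sup>2)" for i
    unfolding Z_def Q_def E\<^sub>1_def \<xi>_def \<kappa>\<^sub>\<sigma>_def
    by (rule expectation_total_noise_le[OF B n(1) \<epsilon>(1)])+
  have \<kappa>\<sigma>0: "0 \<le> \<kappa>\<^sub>\<sigma>" by (simp add: \<kappa>\<^sub>\<sigma>_def)
  note lims = order_limits[OF n l(3)]

  define sde where "sde = (\<lambda>i \<omega>. \<forall>t\<ge>0. set_integrable lborel {0..t} (\<lambda>s. b (X (\<epsilon> i) s \<omega>) \<theta>\<^sub>0) \<and>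
      X (\<epsilon> i) t \<omega> = x\<^sub>0 + (LINT s:{0..t}|lborel. b (X (\<epsilon> i) s \<omega>) \<theta>\<^sub>0) + \<epsilon> i *\<^sub>R levy_ito a \<sigma> \<nu> B N t \<omega>)"
  have AE_sde: "AE \<omega> in M. \<forall>i. sde i \<omega>"
    unfolding AE_all_countable using X[OF \<epsilon>(1)] by (auto simp: sde_def solves_sde_def)
  have AE_B: "AE \<omega> in M. B 0 \<omega> = 0" "AE \<omega> in M. continuous_on {0..} (\<lambda>t. B t \<omega>)"
    using B by (auto simp: standard_brownian_motion_def)
  note AE_J = AE_jump_part_bounded_variation[OF \<nu> N, of a]

  show ?thesis
    unfolding tendsto_in_probability_def
  proof (intro allI impI)
    fix \<delta>' :: real assume \<delta>': "\<delta>' > 0"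
    define S where "S = \<Theta> \<inter> {\<theta>. \<delta>' \<le> dist \<theta> \<theta>\<^sub>0}"
    have "compact S"
      unfolding S_def by (intro compact_Int_closed compact closed_Collect_le continuous_intros)
    have S_\<Theta>: "S \<subseteq> \<Theta>" by (auto simp: S_def)
    have "continuous_on ({0..1} \<times> S) (\<lambda>p. b (x (fst p)) (snd p))"
      using S_\<Theta> by (intro continuous_on_compose2[OF contb, of _ "\<lambda>p. (x (fst p), snd p)", simplified]
        continuous_intros continuous_on_compose2[OF contx]) auto
    moreover have "continuous_on ({0..1} \<times> S) (\<lambda>p. b (x (fst p)) \<theta>\<^sub>0)"
      by (intro continuous_on_compose2[OF contbx[OF \<theta>0]] continuous_intros) auto
    ultimately have contG: "continuous_on ({0..1} \<times> S) (\<lambda>(t, \<theta>). G t \<theta>)"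
      unfolding G_def split_beta by (intro continuous_intros)
    have pos: "\<exists>t\<in>{0..1}. G t \<theta> \<noteq> 0" if "\<theta> \<in> S" for \<theta>
    proof -
      have "\<theta> \<in> \<Theta>" "\<theta> \<noteq> \<theta>\<^sub>0" using that \<delta>' by (auto simp: S_def)
      from b4[OF this] show ?thesis by (auto simp: G_def)
    qed
    obtain \<kappa> where \<kappa>: "\<kappa> > 0" "\<And>\<theta>. \<theta> \<in> S \<Longrightarrow> \<kappa> \<le> integral {0..1} (\<lambda>t. G t \<theta>)"
      using integral_separation[OF \<open>compact S\<close> contG _ pos] by (auto simp: G_def)
    \<comment> \<open>The factor of \<tau> inside the outer bracket of
      \<open>mean_square_error_le\<close>. With the choice of \<tau> below, the random noise uses up
      exactly \<kappa> / 4.\<close>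
    define w where "w = 4 * (K * (1 + ?d * V)) + 4 * C"
    have w: "w > 0" using K0 C D0 by (simp add: w_def V_def add_nonneg_pos)
    define \<tau> where "\<tau> = \<kappa> / (8 * w)"
    have \<tau>: "\<tau> > 0" using \<kappa>(1) w by (simp add: \<tau>_def)
    \<comment> \<open>The bad noise event. Its probability vanishes, while off it the estimator is
      eventually close to \<open>\<theta>\<^sub>0\<close> on almost every path.\<close>
    define T where "T = (\<lambda>i. {\<omega> \<in> space M. ennreal \<tau> < Z i \<omega>} \<union> {\<omega> \<in> space M. ennreal \<tau> < Q i \<omega>})"
    have ev: "{\<omega> \<in> space M. ennreal \<tau> < Z i \<omega>} \<in> events" "{\<omega> \<in> space M. ennreal \<tau> < Q i \<omega>} \<in> events" for i
      by (rule borel_measurable_less[OF borel_measurable_const noise(1)],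
          rule borel_measurable_less[OF borel_measurable_const noise(2)])
    have T_events: "T i \<in> events" for i
      unfolding T_def by (intro sets.Un ev)
    have prob_T: "prob (T i) \<le> E\<^sub>1 i / \<tau> + \<kappa>\<^sub>\<sigma> * (\<epsilon> i)\<^sup>2 / \<tau>" for i
    proof -
      have "prob (T i) \<le> prob {\<omega> \<in> space M. ennreal \<tau> < Z i \<omega>} + prob {\<omega> \<in> space M. ennreal \<tau> < Q i \<omega>}"
        unfolding T_def by (intro measure_Un_le ev)
      also have "\<dots> \<le> E\<^sub>1 i / \<tau> + \<kappa>\<^sub>\<sigma> * (\<epsilon> i)\<^sup>2 / \<tau>"
        using \<kappa>\<sigma>0 less_imp_le[OF \<epsilon>(1)[of i]] by (intro add_mono prob_gt_le noise \<tau>) (auto simp: E\<^sub>1_def)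
      finally show ?thesis .
    qed
    have "(\<lambda>i. E\<^sub>1 i / \<tau> + \<kappa>\<^sub>\<sigma> * (\<epsilon> i)\<^sup>2 / \<tau>) \<longlonglongrightarrow> exp ?d * (?d * (1 + 4 * \<kappa>\<^sub>\<sigma>)) * 0 / \<tau> + \<kappa>\<^sub>\<sigma> * 0\<^sup>2 / \<tau>"
      unfolding E\<^sub>1_def using \<tau> by (intro tendsto_intros l(2) \<epsilon>(2)) auto
    then have lim0: "(\<lambda>i. E\<^sub>1 i / \<tau> + \<kappa>\<^sub>\<sigma> * (\<epsilon> i)\<^sup>2 / \<tau>) \<longlonglongrightarrow> 0" by simp
    have lim_T: "(\<lambda>i. prob (T i)) \<longlonglongrightarrow> 0"
      by (rule tendsto_sandwich[OF always_eventually always_eventually tendsto_const lim0])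
        (use prob_T in simp_all)
    show "(\<lambda>i. prob {\<omega> \<in> space M. \<delta>' < dist (\<theta>hat i \<omega>) \<theta>\<^sub>0}) \<longlonglongrightarrow> 0"
    proof (rule prob_tendsto_0_split[OF _ T_events lim_T])
      show "{\<omega> \<in> space M. \<delta>' < dist (\<theta>hat i \<omega>) \<theta>\<^sub>0} \<in> events" for i
        by (rule borel_measurable_less[OF borel_measurable_const borel_measurable_dist[OF \<theta>hat(1) borel_measurable_const]])
      show "AE \<omega> in M. eventually (\<lambda>i. \<omega> \<in> {\<omega> \<in> space M. \<delta>' < dist (\<theta>hat i \<omega>) \<theta>\<^sub>0} \<longrightarrow> \<omega> \<in> T i) sequentially"
        using AE_sde AE_B AE_J
      proof eventually_elim
        case (elim \<omega>)
        define W where "W = (\<lambda>t. \<sigma> *v B t \<omega>)"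
        define J where "J = (\<lambda>t. jump_part a \<nu> N t \<omega>)"
        obtain H where H: "\<And>s t. 0 \<le> s \<Longrightarrow> s \<le> t \<Longrightarrow> t \<le> 1 \<Longrightarrow> norm (J t - J s) \<le> H t - H s"
          using elim(4) unfolding J_def by blast
        have "continuous_on {0..1} W"
          unfolding W_def
          by (intro bounded_linear.continuous_on[OF matrix_vector_mul_bounded_linear] continuous_on_subset[OF elim(3)]) auto
        then obtain Wm where Wm: "\<And>t. t \<in> {0..1} \<Longrightarrow> norm (W t) \<le> Wm"
          by (rule continuous_on_Icc_norm_bound) blast
        define \<Lambda> where "\<Lambda> = Wm + (H 1 - H 0)"
        have WJ: "norm (W t + J t) \<le> \<Lambda>" if t: "t \<in> {0..1}" for t
        proof -
          have "J 0 = 0" by (simp add: J_def jump_part_0)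
          then have "norm (J t) \<le> H t - H 0" using H[of 0 t] t by simp
          moreover have "H t \<le> H 1" using order_trans[OF norm_ge_zero H[of t 1]] t by simp
          ultimately show ?thesis using norm_triangle_ineq[of "W t" "J t"] Wm[OF t] by (simp add: \<Lambda>_def)
        qed
        define \<delta> where "\<delta> = (\<lambda>i. \<epsilon> i * \<Lambda> * exp C)"
        define \<zeta> where "\<zeta> = (\<lambda>i. \<epsilon> i * (H 1 - H 0))"
        define \<eta> where "\<eta> = (\<lambda>i. 2 ^ l i * (C * (\<delta> i + D * real (l i) / real (n i))))"
        \<comment> \<open>The whole bound without the \<tau> terms, plus the Riemann sum error.
          Every ingredient tends to 0 for the fixed path.\<close>
        define rest where "rest = (\<lambda>i. 2 * (2 * ((C * \<delta> i + C * D * (1 / real (n i)) + \<eta> i) * (2 * K + 2 * \<eta> i))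
            + 2 * (\<zeta> i * (2 * K + 2 * \<eta> i)) + 4 * C * (2 * (\<epsilon> i * Wm) * V))
          + 8 * (\<eta> i)\<^sup>2 + real (l i) / real (n i) * (2 * K)\<^sup>2 + c * (1 / real (n i)))"
        have \<delta>_lim: "\<delta> \<longlonglongrightarrow> 0"
          unfolding \<delta>_def using tendsto_mult_left_zero[OF \<epsilon>(2), of "\<Lambda> * exp C"] by (simp add: mult_ac)
        have \<zeta>_lim: "\<zeta> \<longlonglongrightarrow> 0"
          unfolding \<zeta>_def by (rule tendsto_mult_left_zero[OF \<epsilon>(2)])
        have \<eta>_lim: "\<eta> \<longlonglongrightarrow> 0"
        proof -
          have "(\<lambda>i. (C * \<Lambda> * exp C) * (2 ^ l i * \<epsilon> i) + C * D * (2 ^ l i * (real (l i) / real (n i))))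
              \<longlonglongrightarrow> (C * \<Lambda> * exp C) * 0 + C * D * 0"
            by (intro tendsto_intros l(2) lims(3))
          then show ?thesis by (simp add: \<eta>_def[abs_def] \<delta>_def algebra_simps)
        qed
        have "rest \<longlonglongrightarrow> 2 * (2 * ((C * 0 + C * D * 0 + 0) * (2 * K + 2 * 0))
            + 2 * (0 * (2 * K + 2 * 0)) + 4 * C * (2 * (0 * Wm) * V)) + 8 * 0\<^sup>2 + 0 * (2 * K)\<^sup>2 + c * 0"
          unfolding rest_def by (intro tendsto_intros \<delta>_lim \<zeta>_lim \<eta>_lim lims \<epsilon>(2))
        then have rest_lim: "rest \<longlonglongrightarrow> 0" by simp
        have eW_lim: "(\<lambda>i. \<epsilon> i * Wm) \<longlonglongrightarrow> 0" by (rule tendsto_mult_left_zero[OF \<epsilon>(2)])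
        have small: "eventually (\<lambda>i. \<delta> i < 1) sequentially" "eventually (\<lambda>i. \<zeta> i < 1) sequentially"
          "eventually (\<lambda>i. \<epsilon> i * Wm < 1) sequentially" "eventually (\<lambda>i. rest i < \<kappa> / 2) sequentially"
          by (rule order_tendstoD(2)[OF \<delta>_lim zero_less_one] order_tendstoD(2)[OF \<zeta>_lim zero_less_one]
              order_tendstoD(2)[OF eW_lim zero_less_one] order_tendstoD(2)[OF rest_lim half_gt_zero[OF \<kappa>(1)]])+
        show ?case
          using small
        proof eventually_elim
          case (elim i)
          show ?case
          proof (intro impI, rule ccontr)
            assume A: "\<omega> \<in> {\<omega> \<in> space M. \<delta>' < dist (\<theta>hat i \<omega>) \<theta>\<^sub>0}" and nT: "\<omega> \<notin> T i"
            define \<theta> where "\<theta> = \<theta>hat i \<omega>"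
            have arg: "is_arg_min (contrast b (n i) (\<epsilon> i) (l i) (\<lambda>k. X (\<epsilon> i) (real k / real (n i)) \<omega>)) (\<lambda>\<theta>. \<theta> \<in> \<Theta>) \<theta>"
              unfolding \<theta>_def using A by (intro \<theta>hat(2)) simp
            have \<theta>_mem: "\<theta> \<in> \<Theta>" using arg by (simp add: is_arg_min_def)
            have \<theta>_S: "\<theta> \<in> S" using \<theta>_mem A by (simp add: S_def \<theta>_def)
            have sde_i: "sde i \<omega>" using \<open>\<forall>i. sde i \<omega>\<close> by blast
            \<comment> \<open>The noise was defined from increments for the sake of independence; as
              \<open>B 0 \<omega> = 0\<close>, their partial sums restore the path itself.\<close>
            have W_sum: "(\<Sum>k<j. \<xi> i k \<omega>) = W (real j / real (n i))" for j
            proof -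
              have "(\<Sum>k<j. \<xi> i k \<omega>) = (\<Sum>k<j. W (real (Suc k) / real (n i)) - W (real k / real (n i)))"
                by (simp add: \<xi>_def W_def matrix_vector_mult_diff_distrib)
              also have "\<dots> = W (real j / real (n i)) - W 0"
                using sum_lessThan_telescope[of "\<lambda>k. W (real k / real (n i))" j] by simp
              finally show ?thesis using \<open>B 0 \<omega> = 0\<close> by (simp add: W_def)
            qed
            have Z\<tau>: "Z i \<omega> \<le> ennreal \<tau>" and Q\<tau>: "Q i \<omega> \<le> ennreal \<tau>"
              using nT A by (auto simp: T_def not_less)
            have X_eq: "X (\<epsilon> i) t \<omega> = x\<^sub>0 + (LINT s:{0..t}|lborel. b (X (\<epsilon> i) s \<omega>) \<theta>\<^sub>0) + \<epsilon> i *\<^sub>R (W t + J t)"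
              if "t \<in> {0..1}" for t
              using sde_i that by (simp add: sde_def levy_ito_eq W_def J_def)
            have X_int: "set_integrable lborel {0..1} (\<lambda>s. b (X (\<epsilon> i) s \<omega>) \<theta>\<^sub>0)"
              using sde_i by (simp add: sde_def)
            have "(\<Sum>k=1..n i. (norm (b (x (real k / real (n i))) \<theta> - b (x (real k / real (n i))) \<theta>\<^sub>0))\<^sup>2) / real (n i)
              \<le> 2 * (2 * ((C * \<delta> i + C * D / real (n i) + \<eta> i) * (2 * K + 2 * \<eta> i)) + 2 * (\<zeta> i * (2 * K + 2 * \<eta> i))
                + 4 * (K * (1 + ?d * V) * \<tau>) + 4 * C * (2 * (\<epsilon> i * Wm) * V + \<tau>))
              + 8 * (\<eta> i)\<^sup>2 + real (l i) / real (n i) * (2 * K)\<^sup>2"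
            proof (rule mean_square_error_le[where \<Theta> = \<Theta> and R = R and R\<^sub>0 = R\<^sub>0 and H = H and x = x
                  and W = W and J = J and X = "\<lambda>t. X (\<epsilon> i) t \<omega>" and x\<^sub>0 = x\<^sub>0
                  and b = b and C = C and K = K and D = D and \<theta> = \<theta> and \<theta>\<^sub>0 = \<theta>\<^sub>0 and e = "\<epsilon> i"
                  and n = "n i" and l = "l i" and \<delta> = "\<delta> i" and \<zeta> = "\<zeta> i" and \<eta> = "\<eta> i" and V = V
                  and Wm = Wm and F = "2 * K",
                  OF n(1) l(1) \<epsilon>(1) C lip smooth K \<theta>0 \<theta>_mem X_eq X_int _ R0 _ x_lip D H _ Wm _ _ _ _ _ _ F])
              show "norm (X (\<epsilon> i) t \<omega> - x t) \<le> \<delta> i" if "t \<in> {0..1}" for t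
                unfolding \<delta>_def
              proof (rule integral_equation_deviation[where F = "\<lambda>y. b y \<theta>\<^sub>0", OF C lip[OF \<theta>0] X_eq X_int _ x that])
                show "norm (\<epsilon> i *\<^sub>R (W t + J t)) \<le> \<epsilon> i * \<Lambda>" if "t \<in> {0..1}" for t
                  using WJ[OF that] \<epsilon>(1)[of i] by simp
              qed
              show "R\<^sub>0 + \<delta> i + 1 \<le> R" using elim(1) by (simp add: R_def)
              show "\<epsilon> i * (H 1 - H 0) \<le> \<zeta> i" by (simp add: \<zeta>_def)
              show "\<epsilon> i * Wm \<le> 1" using elim(3) by simp
              show "D + C * \<delta> i + \<zeta> i \<le> V"
              proof -
                have "C * \<delta> i \<le> C * 1" using elim(1) C by (intro mult_left_mono) auto
                then show ?thesis using elim(2) by (simp add: V_def)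
              qed
              show "ennreal (\<epsilon> i) * (\<Sum>v=0..l i. ennreal \<bar>am_coeff (l i) v\<bar> *
                  noise (\<epsilon> i) (max v 1) (max (l i) 1 - 1) (n i) (\<lambda>j. W (real j / real (n i)))) \<le> ennreal \<tau>"
                using Z\<tau> by (simp add: Z_def W_sum)
              show "0 \<le> \<tau>" using \<tau> by simp
              have "ennreal ((\<epsilon> i)\<^sup>2 * (\<Sum>j<n i. (norm (\<xi> i j \<omega>))\<^sup>2)) \<le> ennreal \<tau>" using Q\<tau> by (simp add: Q_def)
              then have "(\<epsilon> i)\<^sup>2 * (\<Sum>j<n i. (norm (\<xi> i j \<omega>))\<^sup>2) \<le> \<tau>" using \<tau> by (simp add: ennreal_le_iff)
              then show "(\<epsilon> i)\<^sup>2 * (\<Sum>j<n i. (norm (W (real (Suc j) / real (n i)) - W (real j / real (n i))))\<^sup>2) \<le> \<tau>"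
                by (simp only: \<xi>_def W_def matrix_vector_mult_diff_distrib)
              show "contrast b (n i) (\<epsilon> i) (l i) (\<lambda>k. X (\<epsilon> i) (real k / real (n i)) \<omega>) \<theta>
                  \<le> contrast b (n i) (\<epsilon> i) (l i) (\<lambda>k. X (\<epsilon> i) (real k / real (n i)) \<omega>) \<theta>\<^sub>0"
                using arg \<theta>0 by (auto simp: is_arg_min_def not_less)
              show "\<eta> i = 2 ^ l i * (C * (\<delta> i + D * real (l i) / real (n i)))" by (simp add: \<eta>_def)
            qed (use \<theta>_mem in auto)
            moreover have "integral {0..1} (\<lambda>t. G t \<theta>)
                \<le> (\<Sum>k=1..n i. G (real k / real (n i)) \<theta>) / real (n i) + c / real (n i)"
              by (intro riemann_sum_error_le G_lip c0 n(1) \<theta>_mem)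
            moreover have "\<kappa> \<le> integral {0..1} (\<lambda>t. G t \<theta>)" by (rule \<kappa>(2)[OF \<theta>_S])
            moreover have "2 * (w * \<tau>) = \<kappa> / 4" using w by (simp add: \<tau>_def)
            \<comment> \<open>Since \<open>rest i < \<kappa> / 2\<close>, at most three quarters of
              \<kappa> are available: a contradiction.\<close>
            ultimately have "\<kappa> \<le> rest i + \<kappa> / 4"
              unfolding rest_def G_def w_def by (simp add: algebra_simps)
            then show False using elim(4) \<kappa>(1) by linarith
          qed
        qed
      qed
    qed
  qed
qed

end
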